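(* If $\mathcal R_j\in\{\mathrm{NC}(d),\mathrm{NCP}(k): d,k\ge3\}$ for $j=1,2$, then every positive linear map on $\mathcal R_1\otimes_{\max}\mathcal R_2$ (into any operator system) is completely positive. That is, $$\mathcal R_1\otimes_{\max}\mathcal R_2=(\mathcal R_1\otimes_{\max}\mathcal R_2)^{\max}.$$
   Context: $\mathrm{NC}(d)=\mathrm{Span}\{1,u_1,\dots,u_d\}\subseteq\mathrm C^*( *_1^d\mathbb Z_2)$, where $u_1,\dots,u_d$ are the canonical generating symmetries of the full group C$^*$-algebra of the free product of $d$ copies of $\mathbb Z_2$. $\mathrm{NCP}(k)=\mathrm{Span}\{1,w,\dots,w^{k-1},v\}\subseteq\mathrm C^*(\mathbb Z_k*\mathbb Z_2)$, where $w,v$ are the canonical unitaries from the generators of $\mathbb Z_k$ and $\mathbb Z_2$. Maximal operator system tensor product: $X\in\mathrm M_q(\mathcal R_1\otimes_{\max}\mathcal R_2)$ is positive iff for every $\varepsilon>0$ there are $P\in\mathrm M_p(\mathcal R_1)_+$, $Q\in\mathrm M_r(\mathcal R_2)_+$ and a scalar $q\times pr$ matrix $\alpha$ with $\varepsilon(1\otimes1)\otimes1_q+X=\alpha(P\otimes Q)\alpha^*$. For an operator system $\mathcal S$, $\mathcal S^{\max}$ denotes the maximal operator system structure $\mathrm{OMAX}(\mathcal S)$: the operator system with the same underlying Archimedean order unit space as $\mathcal S$, characterised by the property that every unital positive linear map from $\mathcal S^{\max}$ into any operator system is completely positive. Equality means equality of matrix orders. *)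

theory Defs
  imports
    Complex_Main
    "HOL-Algebra.Elementary_Groups"
    "HOL-Algebra.Module"
    "HOL-Algebra.QuotRing"
    "Jordan_Normal_Form.Matrix"
begin

section \<open>Complex *-vector spaces and operator systems\<close>

definition complex_ring :: "complex ring" where
  "complex_ring = \<lparr>carrier = UNIV, monoid.mult = (*), one = 1, zero = 0, add = (+)\<rparr>"

text \<open>
  One record type carries both *-algebras and *-vector spaces with a distinguished element
  \<open>one\<close> (the order unit). For the latter the field \<open>mult\<close> is never referred to.
\<close>

record 'a star_space = "(complex, 'a) module" +
  star :: "'a \<Rightarrow> 'a"

record 'a opsys = "'a star_space" +
  matpos :: "nat \<Rightarrow> 'a mat set"

locale star_vector_space = module complex_ring V for V (structure) +
  assumes star_closed: "x \<in> carrier V \<Longrightarrow> star V x \<in> carrier V"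
    and star_star: "x \<in> carrier V \<Longrightarrow> star V (star V x) = x"
    and star_add: "\<lbrakk>x \<in> carrier V; y \<in> carrier V\<rbrakk> \<Longrightarrow> star V (x \<oplus> y) = star V x \<oplus> star V y"
    and star_smult: "x \<in> carrier V \<Longrightarrow> star V (c \<odot>\<^bsub>V\<^esub> x) = cnj c \<odot>\<^bsub>V\<^esub> star V x"

definition mats :: "('a, 'm) partial_object_scheme \<Rightarrow> nat \<Rightarrow> 'a mat set" where
  "mats V n = {X \<in> carrier_mat n n. elements_mat X \<subseteq> carrier V}"

definition madd :: "('a, 'm) ring_scheme \<Rightarrow> 'a mat \<Rightarrow> 'a mat \<Rightarrow> 'a mat" where
  "madd V X Y = mat (dim_row X) (dim_col X) (\<lambda>ij. X $$ ij \<oplus>\<^bsub>V\<^esub> Y $$ ij)"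

definition mneg :: "('a, 'm) ring_scheme \<Rightarrow> 'a mat \<Rightarrow> 'a mat" where
  "mneg V X = map_mat (\<lambda>x. \<ominus>\<^bsub>V\<^esub> x) X"

definition mmult :: "('a, 'm) ring_scheme \<Rightarrow> 'a mat \<Rightarrow> 'a mat \<Rightarrow> 'a mat" where
  "mmult V X Y = mat (dim_row X) (dim_col Y)
     (\<lambda>(i, j). \<Oplus>\<^bsub>V\<^esub>k \<in> {..<dim_col X}. X $$ (i, k) \<otimes>\<^bsub>V\<^esub> Y $$ (k, j))"

definition madj :: "('a, 'm) star_space_scheme \<Rightarrow> 'a mat \<Rightarrow> 'a mat" where
  "madj V X = mat (dim_col X) (dim_row X) (\<lambda>(i, j). star V (X $$ (j, i)))"

text \<open>The diagonal matrix \<open>c (1 \<otimes> 1\<^sub>n)\<close>.\<close>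

definition munit :: "('a, 'm) star_space_scheme \<Rightarrow> nat \<Rightarrow> complex \<Rightarrow> 'a mat" where
  "munit V n c = mat n n (\<lambda>(i, j). if i = j then c \<odot>\<^bsub>V\<^esub> \<one>\<^bsub>V\<^esub> else \<zero>\<^bsub>V\<^esub>)"

definition mdiag :: "('a, 'm) ring_scheme \<Rightarrow> 'a list \<Rightarrow> 'a mat" where
  "mdiag V xs = mat (length xs) (length xs) (\<lambda>(i, j). if i = j then xs ! i else \<zero>\<^bsub>V\<^esub>)"

text \<open>The product \<open>\<alpha> X \<alpha>\<^sup>*\<close> with a (rectangular) scalar matrix \<open>\<alpha>\<close>.\<close>

definition compress :: "('a, 'm) star_space_scheme \<Rightarrow> complex mat \<Rightarrow> 'a mat \<Rightarrow> 'a mat" where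
  "compress V \<alpha> X = mat (dim_row \<alpha>) (dim_row \<alpha>)
     (\<lambda>(i, j). \<Oplus>\<^bsub>V\<^esub>k \<in> {..<dim_col \<alpha>}. \<Oplus>\<^bsub>V\<^esub>l \<in> {..<dim_col \<alpha>}.
        (\<alpha> $$ (i, k) * cnj (\<alpha> $$ (j, l))) \<odot>\<^bsub>V\<^esub> X $$ (k, l))"

text \<open>
  Abstract operator systems in the sense of Choi and Effros. The level \<open>n = 0\<close> is
  harmless: the axioms force its cone to consist of the empty matrix.
\<close>

locale operator_system = star_vector_space V for V :: "('a, 'm) opsys_scheme" (structure) +
  assumes one_closed: "\<one> \<in> carrier V"
    and star_one: "star V \<one> = \<one>"
    and matpos_hermitian: "X \<in> matpos V n \<Longrightarrow> X \<in> mats V n \<and> madj V X = X"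
    and matpos_add: "\<lbrakk>X \<in> matpos V n; Y \<in> matpos V n\<rbrakk> \<Longrightarrow> madd V X Y \<in> matpos V n"
    and matpos_compress:
      "\<lbrakk>X \<in> matpos V n; \<alpha> \<in> carrier_mat m n\<rbrakk> \<Longrightarrow> compress V \<alpha> X \<in> matpos V m"
    and matpos_proper:
      "\<lbrakk>X \<in> matpos V n; mneg V X \<in> matpos V n\<rbrakk> \<Longrightarrow> X = mat n n (\<lambda>_. \<zero>)"
    and matrix_order_unit:
      "\<lbrakk>X \<in> mats V n; madj V X = X\<rbrakk> \<Longrightarrow>
        \<exists>r > 0. madd V (munit V n (complex_of_real r)) X \<in> matpos V n"
    and matrix_archimedean:
      "\<lbrakk>X \<in> mats V n; madj V X = X;
        \<And>\<epsilon>. \<epsilon> > 0 \<Longrightarrow> madd V (munit V n (complex_of_real \<epsilon>)) X \<in> matpos V n\<rbrakk> \<Longrightarrow>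
        X \<in> matpos V n"

definition pos_elems :: "('a, 'm) opsys_scheme \<Rightarrow> 'a set" where
  "pos_elems S = {s \<in> carrier S. mat 1 1 (\<lambda>_. s) \<in> matpos S 1}"

definition linear_map ::
  "('a, 'm) star_space_scheme \<Rightarrow> ('b, 'n) star_space_scheme \<Rightarrow> ('a \<Rightarrow> 'b) \<Rightarrow> bool" where
  "linear_map S T \<phi> \<longleftrightarrow>
     (\<forall>x \<in> carrier S. \<phi> x \<in> carrier T) \<and>
     (\<forall>x \<in> carrier S. \<forall>y \<in> carrier S. \<phi> (x \<oplus>\<^bsub>S\<^esub> y) = \<phi> x \<oplus>\<^bsub>T\<^esub> \<phi> y) \<and>
     (\<forall>c. \<forall>x \<in> carrier S. \<phi> (c \<odot>\<^bsub>S\<^esub> x) = c \<odot>\<^bsub>T\<^esub> \<phi> x)"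

definition positive_map ::
  "('a, 'm) opsys_scheme \<Rightarrow> ('b, 'n) opsys_scheme \<Rightarrow> ('a \<Rightarrow> 'b) \<Rightarrow> bool" where
  "positive_map S T \<phi> \<longleftrightarrow> \<phi> ` pos_elems S \<subseteq> pos_elems T"

definition completely_positive_map ::
  "('a, 'm) opsys_scheme \<Rightarrow> ('b, 'n) opsys_scheme \<Rightarrow> ('a \<Rightarrow> 'b) \<Rightarrow> bool" where
  "completely_positive_map S T \<phi> \<longleftrightarrow> (\<forall>n. \<forall>X \<in> matpos S n. map_mat \<phi> X \<in> matpos T n)"

text \<open>
  The maximal operator system structure of Paulsen, Todorov and Tomforde: its cones are the
  Archimedean closures of
  \<open>{\<alpha> diag(s\<^sub>1, \<dots>, s\<^sub>m) \<alpha>\<^sup>* | s\<^sub>i \<ge> 0, \<alpha> a scalar n \<times> m matrix}\<close>. Only the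
  underlying Archimedean order unit space of \<open>S\<close> enters.
\<close>

definition OMAX :: "'a opsys \<Rightarrow> 'a opsys" where
  "OMAX S = S\<lparr>matpos := \<lambda>n. {X \<in> mats S n. \<forall>\<epsilon> > 0. \<exists>ss \<alpha>.
      set ss \<subseteq> pos_elems S \<and> \<alpha> \<in> carrier_mat n (length ss) \<and>
      madd S (munit S n (complex_of_real \<epsilon>)) X = compress S \<alpha> (mdiag S ss)}\<rparr>"

section \<open>Linear spans, quotients, formal linear combinations\<close>

definition cspan :: "('a, 'm) star_space_scheme \<Rightarrow> 'a set \<Rightarrow> 'a set" where
  "cspan V B = \<Inter> {H. submodule H complex_ring V \<and> B \<subseteq> H}"

text \<open>The quotient by a *-invariant subspace (a *-ideal, when the product matters).\<close>

definition star_quotient :: "'a star_space \<Rightarrow> 'a set \<Rightarrow> 'a set star_space" where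
  "star_quotient V N =
    \<lparr>carrier = a_rcosets\<^bsub>V\<^esub> N, monoid.mult = rcoset_mult V N, one = N +>\<^bsub>V\<^esub> \<one>\<^bsub>V\<^esub>,
     zero = N, add = set_add V,
     smult = (\<lambda>c X. \<Union>x \<in> X. N +>\<^bsub>V\<^esub> (c \<odot>\<^bsub>V\<^esub> x)),
     star = (\<lambda>X. \<Union>x \<in> X. N +>\<^bsub>V\<^esub> star V x)\<rparr>"

definition finsupp :: "'x set \<Rightarrow> ('x \<Rightarrow> complex) set" where
  "finsupp A = {f. finite {x. f x \<noteq> 0} \<and> {x. f x \<noteq> 0} \<subseteq> A}"

definition delta :: "'x \<Rightarrow> 'x \<Rightarrow> complex" where
  "delta x = (\<lambda>y. if y = x then 1 else 0)"

section \<open>The full group C*-algebra\<close>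

definition group_algebra :: "('g, 'm) monoid_scheme \<Rightarrow> ('g \<Rightarrow> complex) star_space" where
  "group_algebra G =
    \<lparr>carrier = finsupp (carrier G),
     monoid.mult = (\<lambda>f h x. if x \<in> carrier G
        then \<Sum>g \<in> {g. f g \<noteq> 0}. f g * h (inv\<^bsub>G\<^esub> g \<otimes>\<^bsub>G\<^esub> x) else 0),
     one = delta \<one>\<^bsub>G\<^esub>,
     zero = (\<lambda>_. 0),
     add = (\<lambda>f h x. f x + h x),
     smult = (\<lambda>c f x. c * f x),
     star = (\<lambda>f x. if x \<in> carrier G then cnj (f (inv\<^bsub>G\<^esub> x)) else 0)\<rparr>"

definition cstar_seminorm :: "'a star_space \<Rightarrow> ('a \<Rightarrow> real) \<Rightarrow> bool" where
  "cstar_seminorm A p \<longleftrightarrow>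
     (\<forall>x \<in> carrier A. p x \<ge> 0) \<and>
     (\<forall>x \<in> carrier A. \<forall>y \<in> carrier A. p (x \<oplus>\<^bsub>A\<^esub> y) \<le> p x + p y) \<and>
     (\<forall>c. \<forall>x \<in> carrier A. p (c \<odot>\<^bsub>A\<^esub> x) = cmod c * p x) \<and>
     (\<forall>x \<in> carrier A. \<forall>y \<in> carrier A. p (x \<otimes>\<^bsub>A\<^esub> y) \<le> p x * p y) \<and>
     (\<forall>x \<in> carrier A. p (star A x \<otimes>\<^bsub>A\<^esub> x) = (p x)\<^sup>2)"

text \<open>
  On a group algebra the supremum is over a nonempty set bounded by the \<open>\<ell>\<^sup>1\<close>-norm, because a
  C*-seminorm is at most 1 on group elements. By the Gelfand--Naimark theorem it is the
  supremum of \<open>\<parallel>\<pi>(x)\<parallel>\<close> over all unitary representations \<open>\<pi>\<close> of the group.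
\<close>

definition max_cstar_norm :: "'a star_space \<Rightarrow> 'a \<Rightarrow> real" where
  "max_cstar_norm A x = (SUP p \<in> {p. cstar_seminorm A p}. p x)"

definition cauchy_algebra :: "'a star_space \<Rightarrow> ('a \<Rightarrow> real) \<Rightarrow> (nat \<Rightarrow> 'a) star_space" where
  "cauchy_algebra A p =
    \<lparr>carrier = {x. (\<forall>n. x n \<in> carrier A) \<and>
        (\<forall>e > 0. \<exists>N. \<forall>m \<ge> N. \<forall>n \<ge> N. p (x m \<ominus>\<^bsub>A\<^esub> x n) < e)},
     monoid.mult = (\<lambda>x y n. x n \<otimes>\<^bsub>A\<^esub> y n),
     one = (\<lambda>_. \<one>\<^bsub>A\<^esub>),
     zero = (\<lambda>_. \<zero>\<^bsub>A\<^esub>),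
     add = (\<lambda>x y n. x n \<oplus>\<^bsub>A\<^esub> y n),
     smult = (\<lambda>c x n. c \<odot>\<^bsub>A\<^esub> x n),
     star = (\<lambda>x n. star A (x n))\<rparr>"

definition null_seqs :: "'a star_space \<Rightarrow> ('a \<Rightarrow> real) \<Rightarrow> (nat \<Rightarrow> 'a) set" where
  "null_seqs A p = {x \<in> carrier (cauchy_algebra A p). (\<lambda>n. p (x n)) \<longlonglongrightarrow> 0}"

definition completion :: "'a star_space \<Rightarrow> ('a \<Rightarrow> real) \<Rightarrow> (nat \<Rightarrow> 'a) set star_space" where
  "completion A p = star_quotient (cauchy_algebra A p) (null_seqs A p)"

text \<open>
  The norm of a C*-algebra is determined by its *-algebra structure and is not recorded.
\<close>

definition full_group_cstar ::
  "('g, 'm) monoid_scheme \<Rightarrow> (nat \<Rightarrow> 'g \<Rightarrow> complex) set star_space" where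
  "full_group_cstar G = completion (group_algebra G) (max_cstar_norm (group_algebra G))"

definition group_unitary ::
  "('g, 'm) monoid_scheme \<Rightarrow> 'g \<Rightarrow> (nat \<Rightarrow> 'g \<Rightarrow> complex) set" where
  "group_unitary G g =
     null_seqs (group_algebra G) (max_cstar_norm (group_algebra G))
       +>\<^bsub>cauchy_algebra (group_algebra G) (max_cstar_norm (group_algebra G))\<^esub> (\<lambda>_. delta g)"

text \<open>The operator system structure that a unital C*-algebra \<open>A\<close> induces on a subspace \<open>E\<close>.\<close>

definition opsys_in :: "'a star_space \<Rightarrow> 'a set \<Rightarrow> 'a opsys" where
  "opsys_in A E =
    \<lparr>carrier = E, monoid.mult = monoid.mult A, one = \<one>\<^bsub>A\<^esub>, zero = \<zero>\<^bsub>A\<^esub>, add = add A,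
     smult = smult A, star = star A,
     matpos = (\<lambda>n. {X. X \<in> mats \<lparr>carrier = E\<rparr> n \<and>
        (\<exists>Y \<in> mats A n. X = mmult A (madj A Y) Y)})\<rparr>"

section \<open>Free products of groups\<close>

text \<open>
  Elements are the reduced words: neighbouring letters come from different factors and no
  letter is an identity. \<open>fp_cons\<close> multiplies a reduced word by one letter from the left.
\<close>

fun fp_cons :: "('i \<Rightarrow> 'a monoid) \<Rightarrow> 'i \<times> 'a \<Rightarrow> ('i \<times> 'a) list \<Rightarrow> ('i \<times> 'a) list" where
  "fp_cons G (i, g) [] = (if g = \<one>\<^bsub>G i\<^esub> then [] else [(i, g)])"
| "fp_cons G (i, g) ((j, h) # w) =
     (if g = \<one>\<^bsub>G i\<^esub> then (j, h) # w
      else if i = j then (if g \<otimes>\<^bsub>G i\<^esub> h = \<one>\<^bsub>G i\<^esub> then w else (i, g \<otimes>\<^bsub>G i\<^esub> h) # w)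
      else (i, g) # (j, h) # w)"

definition free_product_group ::
  "'i set \<Rightarrow> ('i \<Rightarrow> 'a monoid) \<Rightarrow> ('i \<times> 'a) list monoid" where
  "free_product_group I G =
    \<lparr>carrier = {w. (\<forall>(i, g) \<in> set w. i \<in> I \<and> g \<in> carrier (G i) \<and> g \<noteq> \<one>\<^bsub>G i\<^esub>) \<and>
        (\<forall>n. Suc n < length w \<longrightarrow> fst (w ! n) \<noteq> fst (w ! Suc n))},
     monoid.mult = (\<lambda>u w. foldr (fp_cons G) u w),
     one = []\<rparr>"

section \<open>The operator systems NC(d) and NCP(k)\<close>

type_synonym fp_cstar = "(nat \<Rightarrow> (nat \<times> int) list \<Rightarrow> complex) set"

definition Z2_free_power :: "nat \<Rightarrow> (nat \<times> int) list monoid" where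
  "Z2_free_power d = free_product_group {1..d} (\<lambda>_. integer_mod_group 2)"

definition NC :: "nat \<Rightarrow> fp_cstar opsys" where
  "NC d = (let G = Z2_free_power d; A = full_group_cstar G in
     opsys_in A (cspan A ({\<one>\<^bsub>A\<^esub>} \<union> {group_unitary G [(i, 1)] | i. i \<in> {1..d}})))"

definition Zk_free_Z2 :: "nat \<Rightarrow> (nat \<times> int) list monoid" where
  "Zk_free_Z2 k = free_product_group {0, 1}
     (\<lambda>i. if i = 0 then integer_mod_group k else integer_mod_group 2)"

definition NCP :: "nat \<Rightarrow> fp_cstar opsys" where
  "NCP k = (let G = Zk_free_Z2 k; A = full_group_cstar G;
       w = group_unitary G [(0, 1)]; v = group_unitary G [(1, 1)] in
     opsys_in A (cspan A ({w [^]\<^bsub>A\<^esub> j | j::nat. j < k} \<union> {v})))"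

section \<open>The maximal tensor product\<close>

text \<open>Formal linear combinations of pairs. The product is never used.\<close>

definition pair_space ::
  "('a, 'm) star_space_scheme \<Rightarrow> ('b, 'n) star_space_scheme \<Rightarrow> ('a \<times> 'b \<Rightarrow> complex) star_space"
where
  "pair_space V W =
    \<lparr>carrier = finsupp (carrier V \<times> carrier W),
     monoid.mult = undefined,
     one = delta (\<one>\<^bsub>V\<^esub>, \<one>\<^bsub>W\<^esub>),
     zero = (\<lambda>_. 0),
     add = (\<lambda>f h z. f z + h z),
     smult = (\<lambda>c f z. c * f z),
     star = (\<lambda>f (v, w). if v \<in> carrier V \<and> w \<in> carrier W
        then cnj (f (star V v, star W w)) else 0)\<rparr>"

definition bilinear_relations ::
  "('a, 'm) star_space_scheme \<Rightarrow> ('b, 'n) star_space_scheme \<Rightarrow> ('a \<times> 'b \<Rightarrow> complex) set"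
where
  "bilinear_relations V W =
     {(\<lambda>z. delta (v \<oplus>\<^bsub>V\<^esub> v', w) z - delta (v, w) z - delta (v', w) z) | v v' w.
        v \<in> carrier V \<and> v' \<in> carrier V \<and> w \<in> carrier W} \<union>
     {(\<lambda>z. delta (v, w \<oplus>\<^bsub>W\<^esub> w') z - delta (v, w) z - delta (v, w') z) | v w w'.
        v \<in> carrier V \<and> w \<in> carrier W \<and> w' \<in> carrier W} \<union>
     {(\<lambda>z. delta (c \<odot>\<^bsub>V\<^esub> v, w) z - c * delta (v, w) z) | c v w.
        v \<in> carrier V \<and> w \<in> carrier W} \<union>
     {(\<lambda>z. delta (v, c \<odot>\<^bsub>W\<^esub> w) z - c * delta (v, w) z) | c v w.
        v \<in> carrier V \<and> w \<in> carrier W}"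

definition tensor_null ::
  "('a, 'm) star_space_scheme \<Rightarrow> ('b, 'n) star_space_scheme \<Rightarrow> ('a \<times> 'b \<Rightarrow> complex) set"
where
  "tensor_null V W = cspan (pair_space V W) (bilinear_relations V W)"

definition alg_tensor ::
  "('a, 'm) star_space_scheme \<Rightarrow> ('b, 'n) star_space_scheme \<Rightarrow>
    ('a \<times> 'b \<Rightarrow> complex) set star_space" where
  "alg_tensor V W = star_quotient (pair_space V W) (tensor_null V W)"

definition elem_tensor ::
  "('a, 'm) star_space_scheme \<Rightarrow> ('b, 'n) star_space_scheme \<Rightarrow> 'a \<Rightarrow> 'b \<Rightarrow>
    ('a \<times> 'b \<Rightarrow> complex) set" where
  "elem_tensor V W v w = tensor_null V W +>\<^bsub>pair_space V W\<^esub> delta (v, w)"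

text \<open>The Kronecker product of \<open>P \<in> M\<^sub>p(V)\<close> and \<open>Q \<in> M\<^sub>r(W)\<close> in \<open>M\<^sub>p\<^sub>r(V \<otimes> W)\<close>.\<close>

definition kron ::
  "('a, 'm) star_space_scheme \<Rightarrow> ('b, 'n) star_space_scheme \<Rightarrow> 'a mat \<Rightarrow> 'b mat \<Rightarrow>
    ('a \<times> 'b \<Rightarrow> complex) set mat" where
  "kron V W P Q = (let r = dim_row Q; m = dim_row P * r in
     mat m m (\<lambda>(i, j). elem_tensor V W
       (P $$ (i div r, j div r)) (Q $$ (i mod r, j mod r))))"

definition max_tensor ::
  "'a opsys \<Rightarrow> 'b opsys \<Rightarrow> ('a \<times> 'b \<Rightarrow> complex) set opsys"  (infixl "\<otimes>\<^sub>m\<^sub>a\<^sub>x" 70)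
where
  "R1 \<otimes>\<^sub>m\<^sub>a\<^sub>x R2 = (let T = alg_tensor R1 R2 in star_space.extend T
     \<lparr>matpos = \<lambda>q. {X. X \<in> mats T q \<and>
       (\<forall>\<epsilon> > 0. \<exists>p r. \<exists>P \<in> matpos R1 p. \<exists>Q \<in> matpos R2 r. \<exists>\<alpha> \<in> carrier_mat q (p * r).
          madd T (munit T q (complex_of_real \<epsilon>)) X = compress T \<alpha> (kron R1 R2 P Q))}\<rparr>)"

end

theory Submission
  imports Defs "HOL-Analysis.L2_Norm"
begin

text \<open>
  Why the theorem holds. Both \<open>NC(d)\<close> and \<open>NCP(k)\<close> are spans of the one-letter words in the full C*-algebra of a
  free product of finite cyclic groups. The span of one cyclic factor is the span of its minimal
  projections, a finite-dimensional commutative C*-algebra, and the system is the coproduct of these algebras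
  with amalgamated unit. Such a system is itself of the form \<open>OMAX\<close>: every positive matrix \<open>P\<close> over it is
  a sum \<open>\<Sum>s. B s \<otimes> proj s\<close> over the minimal projections, with positive scalar matrices \<open>B s\<close>, that is,
  \<open>P = \<alpha> diag(s\<^sub>1, \<dots>, s\<^sub>m) \<alpha>\<^sup>*\<close> with positive \<open>s\<^sub>i\<close>. This is proved by duality (\<open>positive_decomposition\<close>). The
  functional that would separate \<open>P\<close> from these sums assigns to each factor a positive operator valued
  measure, and all of them have the same total mass. A simultaneous Naimark dilation (\<open>simultaneous_dilation\<close>)
  turns them into unitaries of the right orders on one finite-dimensional space, hence into a
  representation of the free product, where \<open>P\<close> would fail to be positive. The dilation needs only a unitary that
  carries one finite family of vectors to another one with the same Gram matrix (\<open>equal_gram_unitary\<close>).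

  The separating functional comes from the nearest point of a cone (\<open>psd_cone_projection\<close>). So the
  decomposition is exact, without an \<open>\<epsilon>\<close>. Therefore \<open>P \<otimes> Q = (\<alpha> \<otimes> \<beta>) diag(s\<^sub>i \<otimes> t\<^sub>j) (\<alpha> \<otimes> \<beta>)\<^sup>*\<close>, and the cones
  of the maximal tensor product are the Archimedean closures of those generated by the tensors
  \<open>s \<otimes> t\<close> of positive elements (\<open>matpos_iff\<close>). These tensors are positive at level one, which gives the
  equality with \<open>OMAX\<close> (\<open>max_tensor_eq_OMAX\<close>). Positive maps into an operator system preserve such
  combinations (\<open>positive_imp_completely_positive\<close>).
\<close>

section \<open>Positive semidefinite forms\<close>

text \<open>Matrices are functions of two indices, read only below \<open>n\<close>. That lets the size \<open>n\<close> vary inside a proof,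
  as it must in an induction on the number of rows.\<close>

definition psd :: "nat \<Rightarrow> (nat \<Rightarrow> nat \<Rightarrow> complex) \<Rightarrow> bool" where
  "psd n E \<longleftrightarrow> (\<forall>k<n. \<forall>l<n. cnj (E k l) = E l k) \<and>
     (\<forall>x. 0 \<le> Re (\<Sum>k<n. \<Sum>l<n. x k * cnj (x l) * E k l))"

lemma psd_hermitian: "psd n E \<Longrightarrow> k < n \<Longrightarrow> l < n \<Longrightarrow> cnj (E k l) = E l k"
  by (auto simp: psd_def)

lemma psd_form: "psd n E \<Longrightarrow> 0 \<le> Re (\<Sum>k<n. \<Sum>l<n. x k * cnj (x l) * E k l)"
  by (auto simp: psd_def)

lemma psd_add: "psd n E \<Longrightarrow> psd n F \<Longrightarrow> psd n (\<lambda>k l. E k l + F k l)"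
  unfolding psd_def by (simp add: distrib_left sum.distrib)

lemma psd_scale:
  assumes "psd n E" "0 \<le> t"
  shows "psd n (\<lambda>k l. complex_of_real t * E k l)"
proof -
  have "(\<Sum>k<n. \<Sum>l<n. x k * cnj (x l) * (complex_of_real t * E k l)) =
      complex_of_real t * (\<Sum>k<n. \<Sum>l<n. x k * cnj (x l) * E k l)" for x
    by (simp add: sum_distrib_left algebra_simps)
  then show ?thesis using assms unfolding psd_def by simp
qed

lemma sum_rank_one:
  fixes z x :: "nat \<Rightarrow> complex"
  shows "(\<Sum>k<n. \<Sum>l<n. x k * cnj (x l) * (z k * cnj (z l))) = complex_of_real ((cmod (\<Sum>k<n. x k * z k))\<^sup>2)"
  unfolding complex_norm_square by (simp add: sum_product algebra_simps)

lemma psd_rank_one: "psd n (\<lambda>k l. z k * cnj (z l))"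
  unfolding psd_def by (auto simp: sum_rank_one simp del: of_real_power)

lemma psd_zero: "psd n (\<lambda>k l. 0)"
  by (simp add: psd_def)

lemma double_sum_two_points:
  fixes E :: "nat \<Rightarrow> nat \<Rightarrow> complex"
  assumes "k < n" "l < n" "k \<noteq> l"
  shows "(\<Sum>i<n. \<Sum>j<n. (if i = k then a else if i = l then b else 0) *
      cnj (if j = k then a else if j = l then b else 0) * E i j) =
    a * cnj a * E k k + a * cnj b * E k l + b * cnj a * E l k + b * cnj b * E l l"
proof -
  have two: "(\<Sum>j<n. (if j = k then f j else if j = l then g j else 0)) = f k + g l"
    for f g :: "nat \<Rightarrow> complex"
  proof -
    have "(\<Sum>j<n. (if j = k then f j else if j = l then g j else 0)) =
        (\<Sum>j<n. (if j = k then f j else 0) + (if j = l then g j else 0))"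
      using assms by (intro sum.cong) auto
    then show ?thesis using assms by (simp add: sum.distrib sum.delta)
  qed
  have inner: "(\<Sum>j<n. c * cnj (if j = k then a else if j = l then b else 0) * E i j) =
      c * cnj a * E i k + c * cnj b * E i l" for c i
  proof -
    have "(\<Sum>j<n. c * cnj (if j = k then a else if j = l then b else 0) * E i j) =
        (\<Sum>j<n. (if j = k then c * cnj a * E i j else if j = l then c * cnj b * E i j else 0))"
      by (intro sum.cong) auto
    then show ?thesis using two[of "\<lambda>j. c * cnj a * E i j" "\<lambda>j. c * cnj b * E i j"] by simp
  qed
  have "(\<Sum>i<n. \<Sum>j<n. (if i = k then a else if i = l then b else 0) *
      cnj (if j = k then a else if j = l then b else 0) * E i j) =
    (\<Sum>i<n. (if i = k then a * cnj a * E i k + a * cnj b * E i l else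
        if i = l then b * cnj a * E i k + b * cnj b * E i l else 0))"
    unfolding inner by (intro sum.cong) auto
  then show ?thesis
    using two[of "\<lambda>i. a * cnj a * E i k + a * cnj b * E i l" "\<lambda>i. b * cnj a * E i k + b * cnj b * E i l"]
    by simp
qed

lemma psd_diag:
  assumes "psd n E" "k < n"
  shows "0 \<le> Re (E k k)" "Im (E k k) = 0"
proof -
  have 1: "(\<Sum>j<n. (if i = k then 1 else 0) * cnj (if j = k then 1 else 0) * E i j) =
      (if i = k then E i k else 0)" for i
  proof -
    have "(\<Sum>j<n. (if i = k then 1 else 0) * cnj (if j = k then 1 else 0) * E i j) =
        (\<Sum>j<n. if j = k then (if i = k then E i k else 0) else 0)"
      by (intro sum.cong) auto
    then show ?thesis using assms by (simp add: sum.delta)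
  qed
  have "(\<Sum>i<n. \<Sum>j<n. (if i = k then 1 else 0) * cnj (if j = k then 1 else 0) * E i j) = E k k"
    unfolding 1 using assms by (simp add: sum.delta)
  then show "0 \<le> Re (E k k)"
    using psd_form[OF assms(1), of "\<lambda>i. if i = k then 1 else 0"] by simp
  show "Im (E k k) = 0"
    using psd_hermitian[OF assms(1) assms(2) assms(2)] by (simp add: complex_eq_iff)
qed

lemma psd_two_points:
  assumes "psd n E" "k < n" "l < n" "k \<noteq> l"
  shows "0 \<le> (cmod a)\<^sup>2 * Re (E k k) + 2 * Re (a * cnj b * E k l) + (cmod b)\<^sup>2 * Re (E l l)"
proof -
  have "0 \<le> Re (a * cnj a * E k k + a * cnj b * E k l + b * cnj a * E l k + b * cnj b * E l l)"
    using psd_form[OF assms(1), of "\<lambda>i. if i = k then a else if i = l then b else 0"]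
    unfolding double_sum_two_points[OF assms(2-4)] .
  moreover have "Re (b * cnj a * E l k) = Re (a * cnj b * E k l)"
    unfolding psd_hermitian[OF assms(1-3), symmetric] by (simp add: algebra_simps)
  moreover have "Re (c * cnj c * z) = (cmod c)\<^sup>2 * Re z" for c z
    unfolding complex_norm_square[symmetric] by (simp del: of_real_power)
  ultimately show ?thesis by (simp del: times_complex.simps)
qed

text \<open>Test the form on the two coordinates of the entry, with the phase chosen against the entry. Bounding
  all entries by the diagonal makes sets of positive matrices with bounded diagonal compact.\<close>

lemma psd_entry_bound:
  assumes "psd n E" "k < n" "l < n"
  shows "cmod (E k l) \<le> Re (E k k) + Re (E l l)"
proof (cases "k = l")
  case True
  then show ?thesis using psd_diag[OF assms(1,2)] by (simp add: cmod_eq_Re)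
next
  case False
  define z where "z = E k l"
  define a where "a = - cnj (sgn z)"
  have a: "a * cnj 1 * z = - of_real (cmod z)"
  proof (cases "z = 0")
    case False
    have "cnj z * z = complex_of_real (cmod z) * complex_of_real (cmod z)"
      using complex_norm_square[of z] by (simp add: power2_eq_square mult.commute)
    then show ?thesis using False by (simp add: a_def sgn_eq)
  qed simp
  have "(cmod a)\<^sup>2 \<le> 1" by (simp add: a_def norm_sgn)
  then have "(cmod a)\<^sup>2 * Re (E k k) \<le> Re (E k k)"
    using psd_diag(1)[OF assms(1,2)] by (simp add: mult_left_le_one_le)
  moreover have "0 \<le> (cmod a)\<^sup>2 * Re (E k k) + 2 * Re (- complex_of_real (cmod z)) + Re (E l l)"
    using psd_two_points[OF assms False, of a 1] unfolding z_def[symmetric] a by simp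
  ultimately show ?thesis
    using psd_diag(1)[OF assms(1,2)] psd_diag(1)[OF assms(1,3)] unfolding z_def by simp
qed

text \<open>If the entry were nonzero, a large multiple of the coordinate \<open>l\<close> would make the form negative.\<close>

lemma psd_null_row:
  assumes "psd n E" "k < n" "l < n" "E l l = 0"
  shows "E k l = 0"
proof (cases "k = l")
  case True then show ?thesis using assms by simp
next
  case False
  define z where "z = E k l"
  { fix t :: real
    have "0 \<le> Re (E k k) + 2 * Re (1 * cnj (complex_of_real t * z) * z)"
      using psd_two_points[OF assms(1-3) False, of 1 "complex_of_real t * z"] assms(4)
      by (simp add: z_def)
    moreover have "Re (1 * cnj (complex_of_real t * z) * z) = t * (cmod z)\<^sup>2"
      unfolding cmod_power2 by (simp add: algebra_simps power2_eq_square)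
    ultimately have "0 \<le> Re (E k k) + 2 * t * (cmod z)\<^sup>2" by simp }
  note * = this
  have "z = 0"
  proof (rule ccontr)
    assume "z \<noteq> 0"
    then have "0 < (cmod z)\<^sup>2" by simp
    then show False
      using *[of "- (Re (E k k) + 1) / (cmod z)\<^sup>2"] psd_diag(1)[OF assms(1,2)] by simp
  qed
  then show ?thesis by (simp add: z_def)
qed

lemma psd_restrict: "psd (Suc n) E \<Longrightarrow> psd n E"
proof -
  assume E: "psd (Suc n) E"
  have "0 \<le> Re (\<Sum>k<n. \<Sum>l<n. x k * cnj (x l) * E k l)" for x
    using psd_form[OF E, of "x(n := 0)"] by simp
  then show ?thesis using E unfolding psd_def by simp
qed

text \<open>One step of the Cholesky algorithm: completing the square in the last coordinate leaves the form of
  the Schur complement.\<close>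

lemma psd_schur_complement:
  assumes E: "psd (Suc n) E" and pos: "0 < Re (E n n)"
  shows "psd n (\<lambda>k l. E k l - E k n * cnj (E l n) / E n n)"
proof -
  have Enn: "E n n = complex_of_real (Re (E n n))"
    using psd_diag(2)[OF E] by (simp add: complex_eq_iff)
  define r where "r = Re (E n n)"
  have r: "E n n = complex_of_real r" "r > 0" using Enn pos by (auto simp: r_def)
  have herm: "cnj (E k n) = E n k" if "k < Suc n" for k
    using psd_hermitian[OF E that, of n] by simp
  have "0 \<le> Re (\<Sum>k<n. \<Sum>l<n. x k * cnj (x l) * (E k l - E k n * cnj (E l n) / E n n))" for x
  proof -
    define s where "s = (\<Sum>k<n. x k * E k n)"
    define t where "t = - s / complex_of_real r"
    define y where "y = x(n := t)"
    have ct: "(\<Sum>k<n. cnj (x k) * E n k) = cnj s"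
      unfolding s_def using herm by simp
    have "(\<Sum>k<Suc n. \<Sum>l<Suc n. y k * cnj (y l) * E k l) =
        (\<Sum>k<n. \<Sum>l<n. x k * cnj (x l) * E k l) + cnj t * (\<Sum>k<n. x k * E k n)
          + t * (\<Sum>k<n. cnj (x k) * E n k) + t * cnj t * r"
      unfolding y_def using r by (simp add: sum.distrib sum_distrib_left algebra_simps)
    also have "\<dots> = (\<Sum>k<n. \<Sum>l<n. x k * cnj (x l) * E k l) - s * cnj s / r"
      unfolding ct s_def[symmetric] using r by (simp add: t_def field_simps)
    also have "s * cnj s / r = (\<Sum>k<n. \<Sum>l<n. x k * cnj (x l) * (E k n * cnj (E l n) / E n n))"
      unfolding s_def r by (simp add: sum_product sum_divide_distrib algebra_simps)
    also have "(\<Sum>k<n. \<Sum>l<n. x k * cnj (x l) * E k l) - \<dots> =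
        (\<Sum>k<n. \<Sum>l<n. x k * cnj (x l) * (E k l - E k n * cnj (E l n) / E n n))"
      by (simp add: sum_subtractf right_diff_distrib)
    finally have "(\<Sum>k<Suc n. \<Sum>l<Suc n. y k * cnj (y l) * E k l) =
        (\<Sum>k<n. \<Sum>l<n. x k * cnj (x l) * (E k l - E k n * cnj (E l n) / E n n))" .
    then show ?thesis using psd_form[OF E, of y] by simp
  qed
  moreover have "cnj (E k l - E k n * cnj (E l n) / E n n) = E l k - E l n * cnj (E k n) / E n n"
    if "k < n" "l < n" for k l
    using psd_hermitian[OF E, of k l] that r by simp
  ultimately show ?thesis unfolding psd_def by blast
qed

text \<open>Cholesky factorisation. A vanishing last diagonal entry needs no pivot, because its row vanishes too.\<close>

theorem psd_gram:
  "psd n E \<Longrightarrow> \<exists>b. \<forall>k<n. \<forall>l<n. E k l = (\<Sum>m<n. b m k * cnj (b m l))"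
proof (induction n arbitrary: E)
  case 0
  then show ?case by simp
next
  case (Suc n)
  have Enn: "E n n = complex_of_real (Re (E n n))"
    using psd_diag(2)[OF Suc.prems] by (simp add: complex_eq_iff)
  define r where "r = Re (E n n)"
  have r: "E n n = complex_of_real r" "r \<ge> 0" using Enn psd_diag(1)[OF Suc.prems] by (auto simp: r_def)
  have herm: "cnj (E k n) = E n k" if "k < Suc n" for k
    using psd_hermitian[OF Suc.prems that, of n] by simp
  show ?case
  proof (cases "r = 0")
    case True
    obtain b where b: "\<And>k l. k < n \<Longrightarrow> l < n \<Longrightarrow> E k l = (\<Sum>m<n. b m k * cnj (b m l))"
      using Suc.IH[OF psd_restrict[OF Suc.prems]] by blast
    have z: "E k n = 0" if "k < Suc n" for k
      using psd_null_row[OF Suc.prems that, of n] r True by simp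
    define b' where "b' m k = (if m < n \<and> k < n then b m k else 0)" for m k
    have "E k l = (\<Sum>m<Suc n. b' m k * cnj (b' m l))" if "k < Suc n" "l < Suc n" for k l
    proof -
      consider "k < n" "l < n" | "k = n" | "l = n" using \<open>k < Suc n\<close> \<open>l < Suc n\<close> by linarith
      then show ?thesis
        by cases (use b z herm that in \<open>auto simp: b'_def\<close>)
    qed
    then show ?thesis by blast
  next
    case False
    then have rp: "r > 0" using r by simp
    define F where "F k l = E k l - E k n * cnj (E l n) / E n n" for k l
    have F: "psd n F" unfolding F_def using psd_schur_complement[OF Suc.prems] rp r_def by simp
    obtain b where b: "\<And>k l. k < n \<Longrightarrow> l < n \<Longrightarrow> F k l = (\<Sum>m<n. b m k * cnj (b m l))"
      using Suc.IH[OF F] by blast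
    define b' where "b' m k = (if m < n then (if k < n then b m k else 0)
        else E k n / complex_of_real (sqrt r))" for m k
    have sq: "complex_of_real (sqrt r) * complex_of_real (sqrt r) = complex_of_real r"
      using rp by (simp flip: of_real_mult)
    have "E k l = (\<Sum>m<Suc n. b' m k * cnj (b' m l))" if kl: "k < Suc n" "l < Suc n" for k l
    proof -
      have last: "b' n k * cnj (b' n l) = E k n * cnj (E l n) / E n n"
        by (simp add: b'_def sq r)
      show ?thesis
      proof (cases "k < n \<and> l < n")
        case True
        then have "(\<Sum>m<n. b' m k * cnj (b' m l)) = F k l"
          using b by (simp add: b'_def)
        then show ?thesis using last by (simp add: F_def)
      next
        case False
        then have "(\<Sum>m<n. b' m k * cnj (b' m l)) = 0" by (auto simp: b'_def)
        moreover have "E k n * cnj (E l n) / E n n = E k l"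
          using False kl herm[of l] herm[of k] r rp
          by (cases "k = n") (auto simp: less_Suc_eq)
        ultimately show ?thesis using last by simp
      qed
    qed
    then show ?thesis by blast
  qed
qed

section \<open>Projection onto a cone of positive matrices\<close>

lemma complex_bounded_subseq:
  fixes z :: "nat \<Rightarrow> complex"
  assumes "\<And>n. cmod (z n) \<le> M"
  shows "\<exists>r l. strict_mono r \<and> (\<lambda>n. z (r n)) \<longlonglongrightarrow> l"
proof -
  have real: "\<exists>r. strict_mono r \<and> convergent (\<lambda>n. s (r n))" if "\<And>n. \<bar>s n\<bar> \<le> M" for s :: "nat \<Rightarrow> real"
  proof -
    obtain r where r: "strict_mono r" "monoseq (\<lambda>n. s (r n))"
      using seq_monosub by blast
    moreover have "Bseq (\<lambda>n. s (r n))" using that by (intro BseqI'[of _ M]) auto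
    ultimately show ?thesis using Bseq_monoseq_convergent by blast
  qed
  obtain r where r: "strict_mono r" "convergent (\<lambda>n. Re (z (r n)))"
    using real[of "\<lambda>n. Re (z n)"] assms abs_Re_le_cmod order_trans by blast
  obtain q where q: "strict_mono q" "convergent (\<lambda>n. Im (z (r (q n))))"
    using real[of "\<lambda>n. Im (z (r n))"] assms abs_Im_le_cmod order_trans by blast
  have "convergent (\<lambda>n. Re (z (r (q n))))"
    using convergent_subseq_convergent[OF r(2) q(1)] by (simp add: o_def)
  then obtain a b where "(\<lambda>n. Re (z (r (q n)))) \<longlonglongrightarrow> a" "(\<lambda>n. Im (z (r (q n)))) \<longlonglongrightarrow> b"
    using q(2) unfolding convergent_def by blast
  then have "(\<lambda>n. z (r (q n))) \<longlonglongrightarrow> Complex a b"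
    by (simp add: tendsto_complex_iff)
  then show ?thesis using strict_mono_o[OF r(1) q(1)] by (auto simp: o_def)
qed

lemma bounded_family_subseq:
  fixes X :: "nat \<Rightarrow> 'i \<Rightarrow> complex"
  assumes "finite A" "\<And>n i. i \<in> A \<Longrightarrow> cmod (X n i) \<le> M i"
  shows "\<exists>r L. strict_mono r \<and> (\<forall>i\<in>A. (\<lambda>n. X (r n) i) \<longlonglongrightarrow> L i)"
  using assms
proof (induction A)
  case empty
  then show ?case using strict_mono_id by auto
next
  case (insert a A)
  obtain r L where r: "strict_mono r" "\<And>i. i \<in> A \<Longrightarrow> (\<lambda>n. X (r n) i) \<longlonglongrightarrow> L i"
    using insert by (metis insertCI)
  obtain q l where q: "strict_mono q" "(\<lambda>n. X (r (q n)) a) \<longlonglongrightarrow> l"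
    using complex_bounded_subseq[of "\<lambda>n. X (r n) a" "M a"] insert.prems by auto
  have "(\<lambda>n. X (r (q n)) i) \<longlonglongrightarrow> (L(a := l)) i" if "i \<in> insert a A" for i
    using q(2) r(2)[of i] LIMSEQ_subseq_LIMSEQ[OF _ q(1), of "\<lambda>n. X (r n) i"] that
    by (auto simp: o_def)
  moreover have "strict_mono (\<lambda>n. r (q n))" using strict_mono_o[OF r(1) q(1)] by (simp add: o_def)
  ultimately show ?case by (intro exI[of _ "\<lambda>n. r (q n)"] exI[of _ "L(a := l)"]) auto
qed

lemma psd_limit:
  assumes "\<And>m. psd n (B m)" and lim: "\<And>k l. k < n \<Longrightarrow> l < n \<Longrightarrow> (\<lambda>m. B m k l) \<longlonglongrightarrow> C k l"
  shows "psd n C"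
proof -
  have "cnj (C k l) = C l k" if kl: "k < n" "l < n" for k l
  proof (rule LIMSEQ_unique)
    show "(\<lambda>m. cnj (B m k l)) \<longlonglongrightarrow> cnj (C k l)" by (intro tendsto_cnj lim kl)
    show "(\<lambda>m. cnj (B m k l)) \<longlonglongrightarrow> C l k"
      using lim[OF kl(2,1)] psd_hermitian[OF assms(1) kl] by simp
  qed
  moreover have "0 \<le> Re (\<Sum>k<n. \<Sum>l<n. x k * cnj (x l) * C k l)" for x
  proof (rule LIMSEQ_le_const)
    show "(\<lambda>m. Re (\<Sum>k<n. \<Sum>l<n. x k * cnj (x l) * B m k l)) \<longlonglongrightarrow>
        Re (\<Sum>k<n. \<Sum>l<n. x k * cnj (x l) * C k l)"
      by (intro tendsto_Re tendsto_sum tendsto_mult tendsto_const lim) auto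
    show "\<exists>N. \<forall>m\<ge>N. 0 \<le> Re (\<Sum>k<n. \<Sum>l<n. x k * cnj (x l) * B m k l)"
      using psd_form[OF assms(1)] by blast
  qed
  ultimately show ?thesis by (simp add: psd_def)
qed

text \<open>The nearest point to \<open>a\<close> in the cone of all \<open>\<Sum>s. B s \<otimes> e s\<close> with positive \<open>B s\<close>. It exists since the
  coordinate \<open>u\<close>, at which every \<open>e s\<close> is positive, controls the diagonals of the \<open>B s\<close> and hence all their
  entries, so that a minimising sequence has a convergent subsequence. Minimality gives the two
  variational facts about the residual \<open>d\<close>: its functional is nonpositive on the cone, and it
  vanishes at the nearest point, so that its value at \<open>a\<close> has real part \<open>\<parallel>d\<parallel>\<^sup>2\<close>. This is the separation of a point
  from a closed convex cone, with the separating functional in coordinates.\<close>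

lemma psd_cone_projection:
  fixes a :: "nat \<Rightarrow> nat \<Rightarrow> 'g \<Rightarrow> complex" and e :: "'s \<Rightarrow> 'g \<Rightarrow> complex"
  assumes fin: "finite \<Gamma>" "finite S" and unit: "u \<in> \<Gamma>"
    and trace: "\<And>s. s \<in> S \<Longrightarrow> 0 < Re (e s u) \<and> Im (e s u) = 0"
  obtains B d where "\<And>s. s \<in> S \<Longrightarrow> psd n (B s)"
    and "d = (\<lambda>k l g. a k l g - (\<Sum>s\<in>S. B s k l * e s g))"
    and "\<And>s x. s \<in> S \<Longrightarrow>
      Re (\<Sum>k<n. \<Sum>l<n. \<Sum>g\<in>\<Gamma>. x k * cnj (x l) * (e s g * cnj (d k l g))) \<le> 0"
    and "Re (\<Sum>k<n. \<Sum>l<n. \<Sum>g\<in>\<Gamma>. cnj (d k l g) * a k l g) =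
      (\<Sum>k<n. \<Sum>l<n. \<Sum>g\<in>\<Gamma>. (cmod (d k l g))\<^sup>2)"
proof -
  define L where "L B k l g = (\<Sum>s\<in>S. B s k l * e s g)" for B :: "'s \<Rightarrow> nat \<Rightarrow> nat \<Rightarrow> complex" and k l g
  define F where "F B = (\<Sum>k<n. \<Sum>l<n. \<Sum>g\<in>\<Gamma>. (cmod (a k l g - L B k l g))\<^sup>2)" for B
  define K where "K = {B. \<forall>s\<in>S. psd n (B s)}"
  define m where "m = Inf (F ` K)"
  have F0: "0 \<le> F B" for B by (auto simp: F_def intro!: sum_nonneg)
  have bdd: "bdd_below (F ` K)" using F0 by (auto intro!: bdd_belowI2)
  have K0: "(\<lambda>s k l. 0) \<in> K" by (simp add: K_def psd_zero)
  have mF: "m \<le> F B" if "B \<in> K" for B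
    unfolding m_def using that bdd by (auto intro: cINF_lower)
  have "\<exists>B\<in>K. F B < m + 1 / real (Suc j)" for j
  proof -
    have "Inf (F ` K) < m + 1 / real (Suc j)" by (simp add: m_def)
    then show ?thesis using cInf_lessD[of "F ` K"] K0 by auto
  qed
  then obtain X where X: "\<And>j. X j \<in> K" "\<And>j. F (X j) < m + 1 / real (Suc j)" by metis
  have Xpsd: "psd n (X j s)" if "s \<in> S" for j s using X(1) that by (auto simp: K_def)
  define R where "R k = cmod (a k k u) + sqrt (m + 1)" for k
  have diag_bound: "Re (X j s k k) \<le> R k / Re (e s u)" if s: "s \<in> S" and k: "k < n" for j s k
  proof -
    have "1 / real (Suc j) \<le> 1" by simp
    then have "F (X j) \<le> m + 1" using X(2)[of j] by linarith
    moreover have "(cmod (a k k u - L (X j) k k u))\<^sup>2 \<le> F (X j)"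
    proof -
      have "(cmod (a k k u - L (X j) k k u))\<^sup>2 \<le> (\<Sum>g\<in>\<Gamma>. (cmod (a k k g - L (X j) k k g))\<^sup>2)"
        using fin unit by (intro member_le_sum) auto
      also have "\<dots> \<le> (\<Sum>l<n. \<Sum>g\<in>\<Gamma>. (cmod (a k l g - L (X j) k l g))\<^sup>2)"
        using k by (intro member_le_sum[of k _ "\<lambda>l. \<Sum>g\<in>\<Gamma>. (cmod (a k l g - L (X j) k l g))\<^sup>2"])
          (auto intro!: sum_nonneg)
      also have "\<dots> \<le> F (X j)" unfolding F_def
        using k by (intro member_le_sum[of k _ "\<lambda>k. \<Sum>l<n. \<Sum>g\<in>\<Gamma>. (cmod (a k l g - L (X j) k l g))\<^sup>2"])
          (auto intro!: sum_nonneg)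
      finally show ?thesis .
    qed
    ultimately have "cmod (a k k u - L (X j) k k u) \<le> sqrt (m + 1)"
      by (intro real_le_rsqrt) simp
    then have "cmod (L (X j) k k u) \<le> R k"
      unfolding R_def using norm_triangle_ineq2[of "L (X j) k k u" "a k k u"]
      by (simp add: norm_minus_commute)
    then have "Re (L (X j) k k u) \<le> R k"
      using complex_Re_le_cmod[of "L (X j) k k u"] by linarith
    moreover have "Re (L (X j) k k u) = (\<Sum>s\<in>S. Re (X j s k k) * Re (e s u))"
      unfolding L_def using trace by simp
    moreover have "Re (X j s k k) * Re (e s u) \<le> (\<Sum>s\<in>S. Re (X j s k k) * Re (e s u))"
      using s fin trace psd_diag(1)[OF Xpsd] k
      by (intro member_le_sum[of s _ "\<lambda>s. Re (X j s k k) * Re (e s u)"])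
        (auto intro!: mult_nonneg_nonneg simp: less_imp_le)
    ultimately show ?thesis using trace[OF s] by (simp add: field_simps)
  qed
  define A where "A = S \<times> {..<n} \<times> {..<n}"
  have "\<exists>r Y. strict_mono r \<and>
      (\<forall>i\<in>A. (\<lambda>j. (case i of (s, k, l) \<Rightarrow> X (r j) s k l)) \<longlonglongrightarrow> Y i)"
  proof (rule bounded_family_subseq)
    show "finite A" using fin by (simp add: A_def)
    show "cmod (case i of (s, k, l) \<Rightarrow> X j s k l) \<le>
        (case i of (s, k, l) \<Rightarrow> R k / Re (e s u) + R l / Re (e s u))" if i: "i \<in> A" for j i
    proof -
      obtain s k l where "i = (s, k, l)" "s \<in> S" "k < n" "l < n"
        using i by (auto simp: A_def)
      then show ?thesis
        using psd_entry_bound[OF Xpsd, of s k l j] diag_bound[of s k j] diag_bound[of s l j] by simp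
    qed
  qed
  then obtain r Y where r: "strict_mono r"
    and Y: "\<And>s k l. s \<in> S \<Longrightarrow> k < n \<Longrightarrow> l < n \<Longrightarrow> (\<lambda>j. X (r j) s k l) \<longlonglongrightarrow> Y (s, k, l)"
    by (fastforce simp: A_def)
  define B where "B s k l = Y (s, k, l)" for s k l
  have Bpsd: "psd n (B s)" if "s \<in> S" for s
    using psd_limit[of n "\<lambda>j. X (r j) s" "B s"] Xpsd[OF that] Y[OF that] by (simp add: B_def)
  then have BK: "B \<in> K" by (simp add: K_def)
  have "(\<lambda>j. F (X (r j))) \<longlonglongrightarrow> F B"
    unfolding F_def L_def B_def
    by (intro tendsto_sum tendsto_power tendsto_norm tendsto_diff tendsto_mult tendsto_const Y) auto
  moreover have "(\<lambda>j. m + 1 / real (Suc j)) \<longlonglongrightarrow> m + 0"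
    by (intro tendsto_add tendsto_const LIMSEQ_Suc[OF lim_inverse_n', unfolded inverse_eq_divide])
  then have "(\<lambda>j. m + 1 / real (Suc (r j))) \<longlonglongrightarrow> m"
    using LIMSEQ_subseq_LIMSEQ[OF _ r] by (force simp: o_def)
  ultimately have "F B \<le> m"
    using X(2) by (intro LIMSEQ_le) (auto intro: less_imp_le)
  then have min: "F B \<le> F C" if "C \<in> K" for C using mF[OF that] by linarith
  define d where "d k l g = a k l g - L B k l g" for k l g
  \<comment> \<open>the one-sided derivative of the squared distance at its minimum\<close>
  have var: "Re (\<Sum>k<n. \<Sum>l<n. \<Sum>g\<in>\<Gamma>. cnj (d k l g) * L C k l g) \<le> 0"
    if C: "\<And>t. 0 \<le> t \<Longrightarrow> t \<le> 1 \<Longrightarrow> (\<lambda>s k l. B s k l + complex_of_real t * C s k l) \<in> K" for C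
  proof (rule ccontr)
    define N where "N = (\<Sum>k<n. \<Sum>l<n. \<Sum>g\<in>\<Gamma>. (cmod (L C k l g))\<^sup>2)"
    define \<rho> where "\<rho> = Re (\<Sum>k<n. \<Sum>l<n. \<Sum>g\<in>\<Gamma>. cnj (d k l g) * L C k l g)"
    assume "\<not> ?thesis"
    then have \<rho>: "\<rho> > 0" by (simp add: \<rho>_def)
    have N: "N \<ge> 0" by (auto simp: N_def intro!: sum_nonneg)
    \<comment> \<open>small enough for the linear term of the perturbed distance to beat the quadratic one\<close>
    define t where "t = \<rho> / (\<rho> + N + 1)"
    have t: "0 < t" "t \<le> 1" "t * N < \<rho>"
      using \<rho> N by (auto simp: t_def field_simps add_pos_pos)
    have sq: "(cmod (p - complex_of_real t * q))\<^sup>2 = (cmod p)\<^sup>2 - 2 * t * Re (cnj p * q) + t\<^sup>2 * (cmod q)\<^sup>2" for p q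
      unfolding cmod_power2 by (simp add: power2_eq_square algebra_simps)
    have "F (\<lambda>s k l. B s k l + complex_of_real t * C s k l) =
        (\<Sum>k<n. \<Sum>l<n. \<Sum>g\<in>\<Gamma>. (cmod (d k l g - complex_of_real t * L C k l g))\<^sup>2)"
      unfolding F_def d_def L_def by (simp add: sum.distrib sum_distrib_left algebra_simps)
    also have "\<dots> = F B - 2 * t * \<rho> + t\<^sup>2 * N"
      unfolding sq unfolding F_def d_def \<rho>_def N_def
      by (simp only: sum.distrib sum_subtractf Re_sum flip: sum_distrib_left)
    finally have "2 * t * \<rho> \<le> t\<^sup>2 * N" using min[OF C[of t]] t by simp
    then have "t * (2 * \<rho>) \<le> t * (t * N)" by (simp add: power2_eq_square algebra_simps)
    then have "2 * \<rho> \<le> t * N" using t by simp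
    then show False using t \<rho> by linarith
  qed
  have "Re (\<Sum>k<n. \<Sum>l<n. \<Sum>g\<in>\<Gamma>. cnj (d k l g) * L B k l g) \<le> 0"
  proof (rule var)
    fix t :: real assume t: "0 \<le> t" "t \<le> 1"
    have "psd n (\<lambda>k l. B s k l + complex_of_real t * B s k l)" if "s \<in> S" for s
      using psd_add[OF Bpsd[OF that] psd_scale[OF Bpsd[OF that] t(1)]] .
    then show "(\<lambda>s k l. B s k l + complex_of_real t * B s k l) \<in> K"
      by (simp add: K_def)
  qed
  moreover have "Re (\<Sum>k<n. \<Sum>l<n. \<Sum>g\<in>\<Gamma>. cnj (d k l g) * L (\<lambda>s k l. - B s k l) k l g) \<le> 0"
  proof (rule var)
    fix t :: real assume t: "0 \<le> t" "t \<le> 1"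
    have "psd n (\<lambda>k l. B s k l + complex_of_real t * - B s k l)" if "s \<in> S" for s
      using psd_scale[OF Bpsd[OF that], of "1 - t"] t by (simp add: algebra_simps)
    then show "(\<lambda>s k l. B s k l + complex_of_real t * - B s k l) \<in> K"
      by (simp add: K_def)
  qed
  moreover have "L (\<lambda>s k l. - B s k l) k l g = - L B k l g" for k l g
    by (simp add: L_def sum_negf)
  ultimately have orth: "Re (\<Sum>k<n. \<Sum>l<n. \<Sum>g\<in>\<Gamma>. cnj (d k l g) * L B k l g) = 0"
    by (simp add: sum_negf del: times_complex.simps)
  show ?thesis
  proof (rule that[of B d])
    show "psd n (B s)" if "s \<in> S" for s by (rule Bpsd[OF that])
    show "d = (\<lambda>k l g. a k l g - (\<Sum>s\<in>S. B s k l * e s g))"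
      by (simp add: d_def L_def fun_eq_iff)
    show "Re (\<Sum>k<n. \<Sum>l<n. \<Sum>g\<in>\<Gamma>. x k * cnj (x l) * (e s g * cnj (d k l g))) \<le> 0"
      if s: "s \<in> S" for s x
    proof -
      define C where "C = (\<lambda>s' k l. if s' = s then x k * cnj (x l) else 0)"
      have "L C k l g = x k * cnj (x l) * e s g" for k l g
        unfolding L_def C_def using s fin by (simp add: if_distrib[of "\<lambda>z. z * _"] sum.delta cong: if_cong)
      moreover have "Re (\<Sum>k<n. \<Sum>l<n. \<Sum>g\<in>\<Gamma>. cnj (d k l g) * L C k l g) \<le> 0"
      proof (rule var)
        fix t :: real assume t: "0 \<le> t" "t \<le> 1"
        have C: "psd n (C s')" for s'
          unfolding C_def using psd_rank_one psd_zero by (cases "s' = s") auto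
        have "psd n (\<lambda>k l. B s k l + complex_of_real t * C s k l)" if "s \<in> S" for s
          using psd_add[OF Bpsd[OF that] psd_scale[OF C t(1)]] .
        then show "(\<lambda>s k l. B s k l + complex_of_real t * C s k l) \<in> K"
          by (simp add: K_def)
      qed
      ultimately show ?thesis by (simp only: mult_ac)
    qed
    have "(\<Sum>k<n. \<Sum>l<n. \<Sum>g\<in>\<Gamma>. cnj (d k l g) * a k l g) =
      (\<Sum>k<n. \<Sum>l<n. \<Sum>g\<in>\<Gamma>. cnj (d k l g) * L B k l g) +
      complex_of_real (\<Sum>k<n. \<Sum>l<n. \<Sum>g\<in>\<Gamma>. (cmod (d k l g))\<^sup>2)"
    proof -
      have "cnj (d k l g) * a k l g = cnj (d k l g) * L B k l g + complex_of_real ((cmod (d k l g))\<^sup>2)" for k l g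
        unfolding complex_norm_square by (simp add: d_def algebra_simps)
      then show ?thesis by (simp only: sum.distrib of_real_sum)
    qed
    then show "Re (\<Sum>k<n. \<Sum>l<n. \<Sum>g\<in>\<Gamma>. cnj (d k l g) * a k l g) =
      (\<Sum>k<n. \<Sum>l<n. \<Sum>g\<in>\<Gamma>. (cmod (d k l g))\<^sup>2)"
      using orth by simp
  qed
qed

section \<open>Unitaries and simultaneous dilation\<close>

definition ip :: "'i set \<Rightarrow> ('i \<Rightarrow> complex) \<Rightarrow> ('i \<Rightarrow> complex) \<Rightarrow> complex" where
  "ip J x y = (\<Sum>i\<in>J. x i * cnj (y i))"

text \<open>Operators act on all functions, although the form only sees the coordinates in \<open>J\<close>. Reflections and
  diagonal operators are invertible on the whole function space, which keeps every operator identity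
  an equality of functions.\<close>

definition lin_op :: "(('i \<Rightarrow> complex) \<Rightarrow> ('i \<Rightarrow> complex)) \<Rightarrow> bool" where
  "lin_op T \<longleftrightarrow> (\<forall>a b x y. T (\<lambda>i. a * x i + b * y i) = (\<lambda>i. a * T x i + b * T y i))"

definition unitary_op ::
  "'i set \<Rightarrow> (('i \<Rightarrow> complex) \<Rightarrow> ('i \<Rightarrow> complex)) \<Rightarrow> (('i \<Rightarrow> complex) \<Rightarrow> ('i \<Rightarrow> complex)) \<Rightarrow> bool" where
  "unitary_op J U U' \<longleftrightarrow> lin_op U \<and> lin_op U' \<and> (\<forall>x. U (U' x) = x) \<and> (\<forall>x. U' (U x) = x) \<and>
     (\<forall>x y. ip J (U x) y = ip J x (U' y))"

lemma ip_lincomb_left: "ip J (\<lambda>i. a * x i + b * y i) z = a * ip J x z + b * ip J y z"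
  by (simp add: ip_def sum.distrib sum_distrib_left algebra_simps)

lemma ip_diff_left: "ip J (\<lambda>i. x i - y i) z = ip J x z - ip J y z"
  using ip_lincomb_left[of J 1 x "-1" y z] by simp

lemma ip_scale_left: "ip J (\<lambda>i. a * x i) z = a * ip J x z"
  using ip_lincomb_left[of J a x 0 x z] by simp

lemma ip_cnj: "cnj (ip J x y) = ip J y x"
  by (simp add: ip_def mult.commute)

lemma ip_diff_right: "ip J z (\<lambda>i. x i - y i) = ip J z x - ip J z y"
  by (simp add: ip_def sum_subtractf algebra_simps)

lemma ip_scale_right: "ip J z (\<lambda>i. a * x i) = cnj a * ip J z x"
  by (simp add: ip_def sum_distrib_left algebra_simps)

lemma ip_sum_left: "ip J (\<lambda>i. \<Sum>k\<in>A. f k i) z = (\<Sum>k\<in>A. ip J (f k) z)"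
  by (subst ip_def, simp add: sum_distrib_right, subst sum.swap, simp add: ip_def)

lemma ip_sum_right: "ip J z (\<lambda>i. \<Sum>k\<in>A. f k i) = (\<Sum>k\<in>A. ip J z (f k))"
  using arg_cong[OF ip_sum_left[where J = J and A = A and f = f and z = z], of cnj] by (simp add: ip_cnj)

lemma ip_self: "ip J x x = complex_of_real (\<Sum>i\<in>J. (cmod (x i))\<^sup>2)"
  unfolding ip_def of_real_sum complex_norm_square by simp

lemma ip_self_eq_0: "finite J \<Longrightarrow> ip J x x = 0 \<Longrightarrow> i \<in> J \<Longrightarrow> x i = 0"
  unfolding ip_self of_real_eq_0_iff by (simp add: sum_nonneg_eq_0_iff)

lemma lin_opD: "lin_op T \<Longrightarrow> T (\<lambda>i. a * x i + b * y i) = (\<lambda>i. a * T x i + b * T y i)"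
  by (simp add: lin_op_def)

lemma lin_op_comp: "lin_op S \<Longrightarrow> lin_op T \<Longrightarrow> lin_op (\<lambda>x. S (T x))"
  by (simp add: lin_op_def)

lemma unitary_id: "unitary_op J (\<lambda>x. x) (\<lambda>x. x)"
  by (simp add: unitary_op_def lin_op_def)

lemma unitary_comp: "unitary_op J U U' \<Longrightarrow> unitary_op J V V' \<Longrightarrow> unitary_op J (\<lambda>x. U (V x)) (\<lambda>x. V' (U' x))"
  by (simp add: unitary_op_def lin_op_comp)

lemma unitary_inverse: "unitary_op J U U' \<Longrightarrow> unitary_op J U' U"
  unfolding unitary_op_def by (metis ip_cnj)

lemma unitary_ip: "unitary_op J U U' \<Longrightarrow> ip J (U x) (U y) = ip J x y"
  by (simp add: unitary_op_def)

text \<open>A vector that is orthogonal to itself vanishes only on \<open>J\<close>; for vectors supported in \<open>J\<close> this means that it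
  is zero.\<close>

definition supported :: "'i set \<Rightarrow> ('i \<Rightarrow> complex) \<Rightarrow> bool" where
  "supported J x \<longleftrightarrow> (\<forall>i. i \<notin> J \<longrightarrow> x i = 0)"

text \<open>Reflect along \<open>x = v - w\<close>, with the rank one correction divided by \<open>s = \<langle>v, x\<rangle>\<close>. This sends \<open>v\<close> to \<open>w\<close> and fixes
  everything orthogonal to \<open>x\<close>. Since \<open>v\<close> and \<open>w\<close> have the same norm, \<open>2 Re s = \<parallel>x\<parallel>\<^sup>2\<close>, which is exactly
  unitarity and shows that \<open>s\<close> is nonzero unless \<open>v = w\<close>.\<close>

lemma householder_unitary:
  assumes J: "finite J" and supp: "supported J v" "supported J w"
    and eq: "ip J v v = ip J w w"
  shows "\<exists>U U'. unitary_op J U U' \<and> U v = w \<and> (\<forall>x. supported J x \<longrightarrow> supported J (U x)) \<and>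
    (\<forall>y. ip J y (\<lambda>i. v i - w i) = 0 \<longrightarrow> U y = y)"
proof (cases "v = w")
  case True
  then show ?thesis using unitary_id by blast
next
  case False
  define x where "x = (\<lambda>i. v i - w i)"
  define s where "s = ip J v x"
  have xx: "ip J x x = s + cnj s"
    using eq unfolding s_def ip_cnj unfolding x_def ip_diff_left ip_diff_right by simp
  have s0: "s \<noteq> 0"
  proof
    assume "s = 0"
    then have "x i = 0" for i
      using ip_self_eq_0[OF J, of x i] xx supp by (cases "i \<in> J") (auto simp: x_def supported_def)
    then show False using False by (auto simp: x_def)
  qed
  define H where "H c y = (\<lambda>i. y i - c * ip J y x * x i)" for c y
  have lin: "lin_op (H c)" for c
    unfolding lin_op_def H_def ip_lincomb_left by (simp add: algebra_simps fun_eq_iff)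
  have inv: "H c (H c' y) = y" if "c + c' = c * c' * ip J x x" for c c' y
  proof -
    have "H c (H c' y) = (\<lambda>i. y i - (c + c' - c * c' * ip J x x) * ip J y x * x i)"
      unfolding H_def ip_diff_left ip_scale_left by (simp add: algebra_simps fun_eq_iff)
    then show ?thesis using that by simp
  qed
  have c: "1 / s + cnj (1 / s) = 1 / s * cnj (1 / s) * ip J x x"
    using s0 by (simp add: xx field_simps)
  have "unitary_op J (H (1 / s)) (H (cnj (1 / s)))"
    unfolding unitary_op_def
  proof (intro conjI allI lin)
    show "H (1 / s) (H (cnj (1 / s)) y) = y" for y by (rule inv[OF c])
    show "H (cnj (1 / s)) (H (1 / s) y) = y" for y
      using c by (intro inv) (simp only: add.commute mult.commute)
    show "ip J (H (1 / s) y) z = ip J y (H (cnj (1 / s)) z)" for y z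
      unfolding H_def ip_diff_left ip_diff_right ip_scale_left ip_scale_right
      by (simp add: ip_cnj)
  qed
  moreover have "H (1 / s) v = w" using s0 by (simp add: H_def s_def[symmetric]) (simp add: x_def)
  moreover have "x i = 0" if "i \<notin> J" for i using supp that by (simp add: x_def supported_def)
  ultimately show ?thesis
    unfolding x_def[symmetric] by (intro exI[of _ "H (1 / s)"] exI[of _ "H (cnj (1 / s))"]) (auto simp: H_def supported_def)
qed

text \<open>Correct the vectors one at a time. By equality of the Gram matrices, the vectors that are already in
  place are orthogonal to the next difference, so the next reflection does not move them. The
  vectors may be linearly dependent, which covers singular Gram matrices.\<close>

theorem equal_gram_unitary:
  fixes n :: nat and v w :: "nat \<Rightarrow> 'i \<Rightarrow> complex"
  assumes J: "finite J"
    and supp: "\<And>k. k < n \<Longrightarrow> supported J (v k)" "\<And>k. k < n \<Longrightarrow> supported J (w k)"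
    and gram: "\<And>k l. k < n \<Longrightarrow> l < n \<Longrightarrow> ip J (v k) (v l) = ip J (w k) (w l)"
  shows "\<exists>U U'. unitary_op J U U' \<and> (\<forall>k<n. U (v k) = w k) \<and>
    (\<forall>x. supported J x \<longrightarrow> supported J (U x))"
  using supp gram
proof (induction n)
  case 0
  then show ?case using unitary_id by blast
next
  case (Suc n)
  have "\<exists>U U'. unitary_op J U U' \<and> (\<forall>k<n. U (v k) = w k) \<and>
    (\<forall>x. supported J x \<longrightarrow> supported J (U x))"
    by (rule Suc.IH) (use Suc.prems in auto)
  then obtain U U' where U: "unitary_op J U U'" "\<And>k. k < n \<Longrightarrow> U (v k) = w k"
    "\<And>x. supported J x \<Longrightarrow> supported J (U x)"
    by blast
  have "ip J (U (v n)) (U (v n)) = ip J (w n) (w n)"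
    using Suc.prems(3)[of n n] unitary_ip[OF U(1)] by simp
  from householder_unitary[OF J U(3)[OF Suc.prems(1)] Suc.prems(2) this]
  obtain H H' where H: "unitary_op J H H'" "H (U (v n)) = w n"
    "\<And>x. supported J x \<Longrightarrow> supported J (H x)"
    "\<And>y. ip J y (\<lambda>i. U (v n) i - w n i) = 0 \<Longrightarrow> H y = y"
    by auto
  have "H (U (v k)) = w k" if k: "k < Suc n" for k
  proof (cases "k = n")
    case False
    then have "k < n" using k by simp
    then have "ip J (w k) (\<lambda>i. U (v n) i - w n i) = ip J (U (v k)) (U (v n)) - ip J (w k) (w n)"
      unfolding ip_diff_right using U(2) by simp
    also have "\<dots> = 0" using Suc.prems(3)[OF k, of n] unitary_ip[OF U(1)] by simp
    finally show ?thesis using H(4) U(2) \<open>k < n\<close> by simp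
  qed (use H(2) in simp)
  moreover have "unitary_op J (\<lambda>x. H (U x)) (\<lambda>x. U' (H' x))"
    by (rule unitary_comp[OF H(1) U(1)])
  moreover have "\<forall>x. supported J x \<longrightarrow> supported J (H (U x))" using U(3) H(3) by simp
  ultimately show ?case
    by (intro exI[of _ "\<lambda>x. H (U x)"] exI[of _ "\<lambda>x. U' (H' x)"] conjI allI impI) auto
qed

definition zeta :: "nat \<Rightarrow> complex" where
  "zeta K = cis (2 * pi / real K)"

lemma zeta_pow_order: "K > 0 \<Longrightarrow> zeta K ^ K = 1"
  by (simp add: zeta_def DeMoivre)

lemma zeta_cnj: "zeta K * cnj (zeta K) = 1"
  by (simp add: zeta_def cis_cnj cis_mult)

text \<open>A common Naimark dilation of finitely many positive operator valued measures with the same total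
  mass \<open>S\<close>, which may be singular. Stacking Gram factors of \<open>E i j\<close> over \<open>j\<close> gives vectors whose Gram matrix
  is \<open>S\<close> for every \<open>i\<close>. Hence unitaries identify all these families with the one of a fixed \<open>i0\<close>. Pulling
  the diagonal operator with entries \<open>zeta (K i) ^ j\<close> back through them gives a unitary of order \<open>K i\<close> whose
  spectral measure compresses to \<open>E i\<close>.\<close>

theorem simultaneous_dilation:
  fixes E :: "'f \<Rightarrow> nat \<Rightarrow> nat \<Rightarrow> nat \<Rightarrow> complex"
  assumes I: "finite I" "I \<noteq> {}"
    and E: "\<And>i j. i \<in> I \<Longrightarrow> j < K i \<Longrightarrow> psd p (E i j)"
    and K: "\<And>i. i \<in> I \<Longrightarrow> K i > 0"
    and total: "\<And>i k l. i \<in> I \<Longrightarrow> k < p \<Longrightarrow> l < p \<Longrightarrow> (\<Sum>j<K i. E i j k l) = S k l"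
  obtains J :: "(nat \<times> nat) set" and W W' v where "finite J"
    and "\<And>i. i \<in> I \<Longrightarrow> unitary_op J (W i) (W' i)"
    and "\<And>i x. i \<in> I \<Longrightarrow> (W i ^^ K i) x = x"
    and "\<And>i g k l. i \<in> I \<Longrightarrow> k < p \<Longrightarrow> l < p \<Longrightarrow>
      ip J ((W i ^^ g) (v k)) (v l) = (\<Sum>j<K i. zeta (K i) ^ (j * g) * E i j k l)"
proof -
  define b where "b i j = (SOME b. \<forall>k<p. \<forall>l<p. E i j k l = (\<Sum>m<p. b m k * cnj (b m l)))" for i j
  have b: "E i j k l = (\<Sum>m<p. b i j m k * cnj (b i j m l))"
    if "i \<in> I" "j < K i" "k < p" "l < p" for i j k l
    using someI_ex[OF psd_gram[OF E[OF that(1,2)]], folded b_def] that(3,4) by blast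
  define J where "J = {..<Max (K ` I)} \<times> {..<p}"
  have J: "finite J" by (simp add: J_def)
  define V where "V i k = (\<lambda>(j, m). if j < K i \<and> m < p then b i j m k else 0)" for i k
  have Kle: "K i \<le> Max (K ` I)" if "i \<in> I" for i using that I by simp
  have V0: "V i k x = 0" if "x \<notin> {..<K i} \<times> {..<p}" for i k x
    using that by (cases x) (auto simp: V_def)
  have sub: "{..<K i} \<times> {..<p} \<subseteq> J" if "i \<in> I" for i
    using Kle[OF that] by (auto simp: J_def)
  have suppV: "supported J (V i k)" if "i \<in> I" for i k
    using V0 sub that unfolding supported_def by blast
  have V: "(\<Sum>x\<in>J. c (fst x) * V i k x * cnj (V i l x)) = (\<Sum>j<K i. c j * E i j k l)"
    if "i \<in> I" "k < p" "l < p" for c i k l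
  proof -
    have "(\<Sum>x\<in>J. c (fst x) * V i k x * cnj (V i l x)) =
        (\<Sum>x\<in>{..<K i} \<times> {..<p}. c (fst x) * V i k x * cnj (V i l x))"
      using V0 by (intro sum.mono_neutral_right J sub that) auto
    also have "\<dots> = (\<Sum>j<K i. \<Sum>m<p. c j * (b i j m k * cnj (b i j m l)))"
      by (simp add: sum.cartesian_product V_def mult.assoc cong: sum.cong) (auto intro!: sum.cong)
    also have "\<dots> = (\<Sum>j<K i. c j * E i j k l)"
      using b that by (simp add: sum_distrib_left)
    finally show ?thesis .
  qed
  obtain i0 where i0: "i0 \<in> I" using I by blast
  define v where "v = V i0"
  have "\<exists>U U'. unitary_op J U U' \<and> (\<forall>k<p. U (v k) = V i k)" if i: "i \<in> I" for i
  proof -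
    have "ip J (v k) (v l) = ip J (V i k) (V i l)" if "k < p" "l < p" for k l
      using V[OF i0 that, of "\<lambda>_. 1"] V[OF i that, of "\<lambda>_. 1"] total i i0 that
      by (simp add: ip_def v_def)
    then show ?thesis
      using equal_gram_unitary[OF J, of p v "V i"] suppV i i0 unfolding v_def by blast
  qed
  then obtain U U' where U: "\<And>i. i \<in> I \<Longrightarrow> unitary_op J (U i) (U' i)"
    "\<And>i k. i \<in> I \<Longrightarrow> k < p \<Longrightarrow> U i (v k) = V i k"
    by metis
  define D where "D c = (\<lambda>x (y :: nat \<times> nat). c ^ fst y * x y)" for c :: complex and x
  have D: "unitary_op J (D c) (D (cnj c))" if "c * cnj c = 1" for c
  proof -
    have 1: "c ^ j * cnj c ^ j = 1" for j using that by (simp flip: power_mult_distrib)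
    have 2: "c ^ j * (cnj c ^ j * z) = z" for j z
      unfolding mult.assoc[symmetric] 1 by simp
    have 3: "cnj c ^ j * (c ^ j * z) = z" for j z
      unfolding mult.assoc[symmetric] mult.commute[of "cnj c ^ j"] 1 by simp
    have "lin_op (D e)" for e
      unfolding lin_op_def D_def by (simp add: algebra_simps)
    moreover have "ip J (D c x) y = ip J x (D (cnj c) y)" for x y
      unfolding ip_def D_def by (intro sum.cong) (simp_all add: mult_ac)
    ultimately show ?thesis
      unfolding unitary_op_def by (simp add: D_def 2 3)
  qed
  define W where "W i = (\<lambda>x. U' i (D (zeta (K i)) (U i x)))" for i
  define W' where "W' i = (\<lambda>x. U' i (D (cnj (zeta (K i))) (U i x)))" for i
  have Wpow: "(W i ^^ g) x = U' i (\<lambda>y. zeta (K i) ^ (fst y * g) * U i x y)" if i: "i \<in> I" for i g x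
  proof (induction g)
    case 0
    then show ?case using U(1)[OF i] by (simp add: unitary_op_def)
  next
    case (Suc g)
    have inv: "U i (U' i y) = y" for y using U(1)[OF i] by (simp add: unitary_op_def)
    have "(W i ^^ Suc g) x = U' i (D (zeta (K i)) (\<lambda>y. zeta (K i) ^ (fst y * g) * U i x y))"
      unfolding funpow.simps o_apply Suc by (simp add: W_def inv)
    also have "D (zeta (K i)) (\<lambda>y. zeta (K i) ^ (fst y * g) * U i x y) =
        (\<lambda>y. zeta (K i) ^ (fst y * Suc g) * U i x y)"
      by (simp add: D_def power_add mult.assoc)
    finally show ?case .
  qed
  show ?thesis
  proof (rule that[of J W W' v, OF J])
    fix i assume i: "i \<in> I"
    show "unitary_op J (W i) (W' i)"
      unfolding W_def W'_def
      using unitary_comp[OF unitary_inverse[OF U(1)[OF i]] unitary_comp[OF D[OF zeta_cnj] U(1)[OF i]]] by simp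
    show "(W i ^^ K i) x = x" for x
    proof -
      have "zeta (K i) ^ (m * K i) = 1" for m
        using zeta_pow_order[OF K[OF i]] power_mult[of "zeta (K i)" "K i" m] by (simp add: mult.commute)
      then show ?thesis
        unfolding Wpow[OF i] using U(1)[OF i] by (simp add: unitary_op_def)
    qed
    fix g k l assume kl: "k < p" "l < p"
    have "ip J ((W i ^^ g) (v k)) (v l) = ip J (\<lambda>y. zeta (K i) ^ (fst y * g) * U i (v k) y) (U i (v l))"
      using unitary_inverse[OF U(1)[OF i]] unfolding Wpow[OF i] unitary_op_def by blast
    also have "\<dots> = (\<Sum>j<K i. zeta (K i) ^ (j * g) * E i j k l)"
      unfolding U(2)[OF i kl(1)] U(2)[OF i kl(2)] ip_def
      by (rule V[OF i kl, of "\<lambda>j. zeta (K i) ^ (j * g)"])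
    finally show "ip J ((W i ^^ g) (v k)) (v l) = (\<Sum>j<K i. zeta (K i) ^ (j * g) * E i j k l)" .
  qed
qed

section \<open>Free products of groups\<close>

lemma free_product_carrier_Nil: "[] \<in> carrier (free_product_group I G)"
  by (simp add: free_product_group_def)

lemma free_product_carrier_Cons:
  "(i, g) # w \<in> carrier (free_product_group I G) \<longleftrightarrow>
     i \<in> I \<and> g \<in> carrier (G i) \<and> g \<noteq> \<one>\<^bsub>G i\<^esub> \<and> w \<in> carrier (free_product_group I G) \<and>
     (\<forall>j h v. w = (j, h) # v \<longrightarrow> i \<noteq> j)"
proof -
  have "(\<forall>n. Suc n < length ((i, g) # w) \<longrightarrow> fst (((i, g) # w) ! n) \<noteq> fst (((i, g) # w) ! Suc n)) \<longleftrightarrow>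
      (\<forall>j h v. w = (j, h) # v \<longrightarrow> i \<noteq> j) \<and> (\<forall>n. Suc n < length w \<longrightarrow> fst (w ! n) \<noteq> fst (w ! Suc n))"
    (is "?L \<longleftrightarrow> ?A \<and> ?B")
  proof
    assume L: ?L
    have ?A using L[THEN spec, of 0] by auto
    moreover have ?B using L[THEN spec, of "Suc _"] by auto
    ultimately show "?A \<and> ?B" ..
  next
    assume AB: "?A \<and> ?B"
    show ?L
    proof (intro allI impI)
      fix n assume n: "Suc n < length ((i, g) # w)"
      show "fst (((i, g) # w) ! n) \<noteq> fst (((i, g) # w) ! Suc n)"
      proof (cases n)
        case 0
        then show ?thesis using AB n by (cases w) auto
      next
        case (Suc m)
        then show ?thesis using AB n by auto
      qed
    qed
  qed
  then show ?thesis by (auto simp: free_product_group_def)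
qed

lemma free_product_mult: "u \<otimes>\<^bsub>free_product_group I G\<^esub> w = foldr (fp_cons G) u w"
  by (simp add: free_product_group_def)

lemma free_product_one: "\<one>\<^bsub>free_product_group I G\<^esub> = []"
  by (simp add: free_product_group_def)

locale free_product =
  fixes I :: "'i set" and G :: "'i \<Rightarrow> 'a monoid"
  assumes factors: "i \<in> I \<Longrightarrow> group (G i)"
begin

abbreviation FP where "FP \<equiv> free_product_group I G"

lemma fp_cons_one: "fp_cons G (i, \<one>\<^bsub>G i\<^esub>) w = w"
  by (cases w) auto

lemma fp_cons_closed:
  assumes "i \<in> I" "g \<in> carrier (G i)" "w \<in> carrier FP"
  shows "fp_cons G (i, g) w \<in> carrier FP"
proof -
  interpret group "G i" by (rule factors[OF assms(1)])
  show ?thesis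
  proof (cases w)
    case Nil
    then show ?thesis using assms by (simp add: free_product_carrier_Cons free_product_carrier_Nil)
  next
    case (Cons a v)
    obtain j h where a: "a = (j, h)" by (cases a)
    have "h \<in> carrier (G i)" if "i = j"
      using assms that unfolding Cons a by (auto simp: free_product_carrier_Cons)
    then have "g \<otimes>\<^bsub>G i\<^esub> h \<in> carrier (G i)" if "i = j"
      using assms(2) that m_closed by blast
    then show ?thesis using assms unfolding Cons a
      by (auto simp: free_product_carrier_Cons)
  qed
qed

text \<open>A factor acts on the reduced words. A cancellation can occur only with the first letter, since the
  second letter of a reduced word lies in another factor.\<close>

lemma fp_cons_mult:
  assumes "i \<in> I" "g \<in> carrier (G i)" "h \<in> carrier (G i)" "w \<in> carrier FP"
  shows "fp_cons G (i, g) (fp_cons G (i, h) w) = fp_cons G (i, g \<otimes>\<^bsub>G i\<^esub> h) w"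
proof -
  interpret group "G i" by (rule factors[OF assms(1)])
  show ?thesis
  proof (cases "h = \<one>\<^bsub>G i\<^esub> \<or> g = \<one>\<^bsub>G i\<^esub>")
    case True
    then show ?thesis using assms by (auto simp: fp_cons_one)
  next
    case False
    show ?thesis
    proof (cases w)
      case Nil
      then show ?thesis using False by simp
    next
      case (Cons a v)
      obtain j k where a: "a = (j, k)" by (cases a)
      show ?thesis
      proof (cases "i = j")
        case True
        have k: "k \<in> carrier (G i)" "k \<noteq> \<one>\<^bsub>G i\<^esub>" and v: "\<And>j' h' v'. v = (j', h') # v' \<Longrightarrow> i \<noteq> j'"
          using assms(4) True unfolding Cons a by (auto simp: free_product_carrier_Cons)
        have gv: "fp_cons G (i, g) v = (i, g) # v"
        proof (cases v)
          case Nil then show ?thesis using False by simp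
        next
          case (Cons b v')
          obtain j' h' where "b = (j', h')" by (cases b)
          then show ?thesis using Cons v False by auto
        qed
        show ?thesis
        proof (cases "h \<otimes>\<^bsub>G i\<^esub> k = \<one>\<^bsub>G i\<^esub>")
          case hk: True
          have g: "g \<otimes>\<^bsub>G i\<^esub> h \<otimes>\<^bsub>G i\<^esub> k = g" using hk assms k by (simp add: m_assoc)
          then have "g = k" if "g \<otimes>\<^bsub>G i\<^esub> h = \<one>\<^bsub>G i\<^esub>"
            using that k by simp
          then show ?thesis using False hk True gv g by (auto simp: Cons a)
        next
          case hk: False
          have g: "g \<otimes>\<^bsub>G i\<^esub> h \<otimes>\<^bsub>G i\<^esub> k = g \<otimes>\<^bsub>G i\<^esub> (h \<otimes>\<^bsub>G i\<^esub> k)" using assms k by (simp add: m_assoc)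
          then have "g \<otimes>\<^bsub>G i\<^esub> (h \<otimes>\<^bsub>G i\<^esub> k) = k" if "g \<otimes>\<^bsub>G i\<^esub> h = \<one>\<^bsub>G i\<^esub>"
            using that k by simp
          then show ?thesis using False hk True g k by (auto simp: Cons a)
        qed
      next
        case ij: False
        then show ?thesis using False by (auto simp: Cons a)
      qed
    qed
  qed
qed

lemma act_closed:
  "u \<in> carrier FP \<Longrightarrow> w \<in> carrier FP \<Longrightarrow> foldr (fp_cons G) u w \<in> carrier FP"
  by (induction u) (auto simp: free_product_carrier_Cons intro!: fp_cons_closed)

text \<open>Left multiplication by \<open>u\<close> is the composite of the letters of \<open>u\<close>, also when the first letters merge.
  Associativity follows by induction.\<close>

lemma act_fp_cons:
  assumes "i \<in> I" "g \<in> carrier (G i)" "u \<in> carrier FP" "w \<in> carrier FP"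
  shows "foldr (fp_cons G) (fp_cons G (i, g) u) w = fp_cons G (i, g) (foldr (fp_cons G) u w)"
proof (cases u)
  case Nil
  then show ?thesis by (auto simp: fp_cons_one)
next
  case (Cons a v)
  obtain j h where a: "a = (j, h)" by (cases a)
  have h: "h \<in> carrier (G j)" and v: "v \<in> carrier FP"
    using assms(3) unfolding Cons a by (auto simp: free_product_carrier_Cons)
  have "fp_cons G (i, g) (fp_cons G (i, h) (foldr (fp_cons G) v w)) =
      fp_cons G (i, g \<otimes>\<^bsub>G i\<^esub> h) (foldr (fp_cons G) v w)" if "i = j"
    using fp_cons_mult assms h v act_closed that by auto
  moreover have "fp_cons G (i, \<one>\<^bsub>G i\<^esub>) z = z" for z by (rule fp_cons_one)
  ultimately show ?thesis by (auto simp: Cons a)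
qed

lemma act_assoc:
  "u \<in> carrier FP \<Longrightarrow> w \<in> carrier FP \<Longrightarrow> z \<in> carrier FP \<Longrightarrow>
    foldr (fp_cons G) (foldr (fp_cons G) u w) z = foldr (fp_cons G) u (foldr (fp_cons G) w z)"
proof (induction u)
  case Nil
  then show ?case by simp
next
  case (Cons a u)
  obtain i g where a: "a = (i, g)" by (cases a)
  have "i \<in> I" "g \<in> carrier (G i)" "u \<in> carrier FP"
    using Cons.prems(1) unfolding a by (auto simp: free_product_carrier_Cons)
  then show ?case using Cons by (simp add: a act_fp_cons act_closed)
qed

lemma left_inverse_exists: "u \<in> carrier FP \<Longrightarrow> \<exists>v\<in>carrier FP. foldr (fp_cons G) v u = []"
proof (induction u)
  case Nil
  then show ?case by (auto simp: free_product_carrier_Nil intro!: bexI[of _ "[]"])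
next
  case (Cons a u)
  obtain i g where a: "a = (i, g)" by (cases a)
  have u: "i \<in> I" "g \<in> carrier (G i)" "g \<noteq> \<one>\<^bsub>G i\<^esub>" "u \<in> carrier FP"
    using Cons.prems(1) unfolding a by (auto simp: free_product_carrier_Cons)
  interpret group "G i" by (rule factors[OF u(1)])
  obtain v where v: "v \<in> carrier FP" "foldr (fp_cons G) v u = []" using Cons.IH u by blast
  define l where "l = [(i, inv\<^bsub>G i\<^esub> g)]"
  have l: "l \<in> carrier FP" using u by (simp add: l_def free_product_carrier_Cons free_product_carrier_Nil)
  have "fp_cons G (i, inv\<^bsub>G i\<^esub> g) ((i, g) # u) = u" using u by simp
  then have "foldr (fp_cons G) (foldr (fp_cons G) v l) ((i, g) # u) = []"
    using act_assoc[OF v(1) l Cons.prems] v(2) unfolding a by (simp add: l_def)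
  then show ?case unfolding a using act_closed[OF v(1) l] by blast
qed

theorem group_free_product: "group FP"
proof (rule groupI)
  show "\<exists>y\<in>carrier FP. y \<otimes>\<^bsub>FP\<^esub> x = \<one>\<^bsub>FP\<^esub>" if "x \<in> carrier FP" for x
    using left_inverse_exists[OF that] by (simp add: free_product_mult free_product_one)
qed (auto simp: free_product_mult free_product_one act_closed act_assoc free_product_carrier_Nil)

end

definition word_rep :: "('i \<Rightarrow> 'x \<Rightarrow> 'x) \<Rightarrow> ('i \<times> int) list \<Rightarrow> 'x \<Rightarrow> 'x" where
  "word_rep W w = foldr (\<lambda>(i, g) x. (W i ^^ nat g) x) w"

lemma word_rep_Nil [simp]: "word_rep W [] x = x"
  by (simp add: word_rep_def)

lemma word_rep_Cons [simp]: "word_rep W ((i, g) # w) x = (W i ^^ nat g) (word_rep W w x)"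
  by (simp add: word_rep_def)

locale cyclic_free_product =
  fixes I :: "'i set" and K :: "'i \<Rightarrow> nat"
  assumes K_pos: "i \<in> I \<Longrightarrow> 0 < K i"
begin

sublocale free_product I "\<lambda>i. integer_mod_group (K i)"
  by (rule free_product.intro) (rule group_integer_mod_group)

lemma funpow_mod:
  assumes "i \<in> I" and W: "\<And>x. (W i ^^ K i) x = x"
  shows "(W i ^^ (n mod K i)) x = (W i ^^ n) x"
proof -
  have id: "((W i ^^ K i) ^^ m) y = y" for m y
    by (induction m) (simp_all add: W)
  have "(W i ^^ n) x = (W i ^^ (n mod K i + K i * (n div K i))) x" by simp
  also have "\<dots> = (W i ^^ (n mod K i)) x"
    by (simp only: funpow_add o_apply funpow_mult[symmetric] id)
  finally show ?thesis by simp
qed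

text \<open>Operators \<open>W i\<close> with \<open>W i ^^ K i\<close> the identity extend to the free product: letters that merge add
  their exponents modulo \<open>K i\<close>, and so do the powers of \<open>W i\<close>.\<close>

lemma word_rep_fp_cons:
  assumes W: "\<And>i x. i \<in> I \<Longrightarrow> (W i ^^ K i) x = x"
    and i: "i \<in> I" and g: "g \<in> carrier (integer_mod_group (K i))" and w: "w \<in> carrier FP"
  shows "word_rep W (fp_cons (\<lambda>i. integer_mod_group (K i)) (i, g) w) x = (W i ^^ nat g) (word_rep W w x)"
proof (cases w)
  case Nil
  then show ?thesis by simp
next
  case (Cons a v)
  obtain j h where a: "a = (j, h)" by (cases a)
  have K: "K i > 0" using K_pos i .
  show ?thesis
  proof (cases "i = j")
    case True
    have gh: "0 \<le> g" "0 \<le> h"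
      using g w K unfolding Cons a True by (auto simp: free_product_carrier_Cons carrier_integer_mod_group split: if_splits)
    have "nat ((g + h) mod int (K i)) = (nat g + nat h) mod K i"
      using gh by (simp add: nat_mod_distrib nat_add_distrib)
    then have "(W i ^^ nat ((g + h) mod int (K i))) y = (W i ^^ nat g) ((W i ^^ nat h) y)" for y
      using funpow_mod[of i W, OF i W[OF i]] by (simp add: funpow_add)
    from this[symmetric] show ?thesis using True by (auto simp: Cons a)
  next
    case False
    then show ?thesis by (auto simp: Cons a)
  qed
qed

lemma word_rep_mult:
  assumes W: "\<And>i x. i \<in> I \<Longrightarrow> (W i ^^ K i) x = x"
    and "u \<in> carrier FP" "w \<in> carrier FP"
  shows "word_rep W (u \<otimes>\<^bsub>FP\<^esub> w) x = word_rep W u (word_rep W w x)"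
  using assms(2)
proof (induction u)
  case Nil
  then show ?case by (simp add: free_product_mult)
next
  case (Cons a u)
  obtain i g where a: "a = (i, g)" by (cases a)
  have u: "i \<in> I" "g \<in> carrier (integer_mod_group (K i))" "u \<in> carrier FP"
    using Cons.prems unfolding a by (auto simp: free_product_carrier_Cons)
  show ?case
    using word_rep_fp_cons[OF W u(1,2) act_closed[OF u(3) assms(3)]] Cons.IH[OF u(3)]
    by (simp add: free_product_mult a)
qed

end

section \<open>Complex modules and their quotients\<close>

lemma complex_ring_simps [simp]:
  "carrier complex_ring = UNIV" "a \<otimes>\<^bsub>complex_ring\<^esub> b = a * b" "\<one>\<^bsub>complex_ring\<^esub> = 1"
  "\<zero>\<^bsub>complex_ring\<^esub> = 0" "a \<oplus>\<^bsub>complex_ring\<^esub> b = a + b"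
  by (simp_all add: complex_ring_def)

lemma cring_complex_ring: "cring complex_ring"
proof (rule cringI)
  show "abelian_group complex_ring"
    by (rule abelian_groupI) (auto simp: algebra_simps intro: exI[of _ "- _"] left_minus)
  show "Group.comm_monoid complex_ring"
    by (rule comm_monoidI) auto
qed (auto simp: algebra_simps)

lemma complex_moduleI:
  fixes M (structure)
  assumes "\<And>x y. x \<in> carrier M \<Longrightarrow> y \<in> carrier M \<Longrightarrow> x \<oplus> y \<in> carrier M"
    and "\<zero> \<in> carrier M"
    and "\<And>x y z. x \<in> carrier M \<Longrightarrow> y \<in> carrier M \<Longrightarrow> z \<in> carrier M \<Longrightarrow> (x \<oplus> y) \<oplus> z = x \<oplus> (y \<oplus> z)"
    and "\<And>x y. x \<in> carrier M \<Longrightarrow> y \<in> carrier M \<Longrightarrow> x \<oplus> y = y \<oplus> x"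
    and zero: "\<And>x. x \<in> carrier M \<Longrightarrow> \<zero> \<oplus> x = x"
    and null: "\<And>x. x \<in> carrier M \<Longrightarrow> 0 \<odot> x = \<zero>"
    and closed: "\<And>c x. x \<in> carrier M \<Longrightarrow> c \<odot> x \<in> carrier M"
    and distl: "\<And>a b x. x \<in> carrier M \<Longrightarrow> (a + b) \<odot> x = a \<odot> x \<oplus> b \<odot> x"
    and distr: "\<And>a x y. x \<in> carrier M \<Longrightarrow> y \<in> carrier M \<Longrightarrow> a \<odot> (x \<oplus> y) = a \<odot> x \<oplus> a \<odot> y"
    and assoc: "\<And>a b x. x \<in> carrier M \<Longrightarrow> (a * b) \<odot> x = a \<odot> (b \<odot> x)"
    and one: "\<And>x. x \<in> carrier M \<Longrightarrow> 1 \<odot> x = x"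
  shows "Module.module complex_ring M"
proof (rule Module.moduleI[OF cring_complex_ring])
  show "abelian_group M"
  proof (rule abelian_groupI)
    show "\<exists>y\<in>carrier M. y \<oplus> x = \<zero>" if "x \<in> carrier M" for x
      using distl[OF that, of "-1" 1] null[OF that] one[OF that] closed[OF that, of "-1"] by auto
  qed (use assms in auto)
qed (use assms in auto)

locale complex_module = Module.module complex_ring V for V :: "('a, 'm) star_space_scheme" (structure)
begin

lemma smult_minus_one: "x \<in> carrier V \<Longrightarrow> (-1) \<odot> x = \<ominus> x"
proof -
  assume x: "x \<in> carrier V"
  have "(-1) \<odot> x \<oplus> x = (-1 + 1) \<odot> x"
    using smult_l_distr[of "-1" 1 x] smult_one x by simp
  then have "(-1) \<odot> x \<oplus> x = \<zero>" using smult_l_null[OF x] by simp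
  moreover have "(-1) \<odot> x \<in> carrier V" using smult_closed[of "-1" x] x by simp
  ultimately show ?thesis using M.minus_equality[of "(-1) \<odot> x" x] x by simp
qed

lemma submodule_complexI:
  assumes "H \<subseteq> carrier V" "\<zero> \<in> H" "\<And>x y. x \<in> H \<Longrightarrow> y \<in> H \<Longrightarrow> x \<oplus> y \<in> H" "\<And>c x. x \<in> H \<Longrightarrow> c \<odot> x \<in> H"
  shows "submodule H complex_ring V"
proof (rule submoduleI)
  show "\<ominus> a \<in> H" if "a \<in> H" for a
    using assms(4)[OF that, of "-1"] assms(1) that by (simp add: smult_minus_one subset_iff)
qed (use assms in auto)

lemma submodule_complexD:
  assumes "submodule H complex_ring V"
  shows "H \<subseteq> carrier V" "\<zero> \<in> H" "\<And>x y. x \<in> H \<Longrightarrow> y \<in> H \<Longrightarrow> x \<oplus> y \<in> H"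
    "\<And>c x. x \<in> H \<Longrightarrow> c \<odot> x \<in> H" "\<And>x. x \<in> H \<Longrightarrow> \<ominus> x \<in> H"
proof -
  show "H \<subseteq> carrier V" "\<And>x y. x \<in> H \<Longrightarrow> y \<in> H \<Longrightarrow> x \<oplus> y \<in> H"
    "\<And>c x. x \<in> H \<Longrightarrow> c \<odot> x \<in> H" "\<And>x. x \<in> H \<Longrightarrow> \<ominus> x \<in> H"
    using submoduleE[OF assms] by auto
  show "\<zero> \<in> H" using subgroup.one_closed[OF submodule.axioms(1)[OF assms]] by simp
qed

lemma cspan_submodule:
  assumes "B \<subseteq> carrier V"
  shows "submodule (cspan V B) complex_ring V"
proof (rule submodule_complexI)
  show "cspan V B \<subseteq> carrier V"
    using carrier_is_submodule assms by (auto simp: cspan_def)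
  show "\<zero> \<in> cspan V B" unfolding cspan_def using submodule_complexD(2) by blast
  show "x \<oplus> y \<in> cspan V B" if "x \<in> cspan V B" "y \<in> cspan V B" for x y
    using that submodule_complexD(3) unfolding cspan_def by blast
  show "c \<odot> x \<in> cspan V B" if "x \<in> cspan V B" for c x
    using that submodule_complexD(4) unfolding cspan_def by blast
qed

end

lemma cspan_base: "x \<in> B \<Longrightarrow> x \<in> cspan V B"
  by (auto simp: cspan_def)

lemma cspan_least: "submodule H complex_ring V \<Longrightarrow> B \<subseteq> H \<Longrightarrow> cspan V B \<subseteq> H"
  by (auto simp: cspan_def)

text \<open>Both the completion of the group algebra and the algebraic tensor product are instances of
  \<^const>\<open>star_quotient\<close>.\<close>

locale quotient_space = complex_module V for V :: "'a star_space" (structure) +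
  fixes N
  assumes N: "submodule N complex_ring V"
begin

sublocale abelian_subgroup N V
  using N by (intro abelian_subgroupI3 M.abelian_group_axioms) (simp add: additive_subgroup_def submodule_def)

abbreviation Q where "Q \<equiv> star_quotient V N"

abbreviation coset where "coset x \<equiv> N +> x"

lemma Q_carrier: "carrier Q = coset ` carrier V"
  by (auto simp: star_quotient_def A_RCOSETS_def RCOSETS_def a_r_coset_def)

lemma coset_closed: "x \<in> carrier V \<Longrightarrow> coset x \<in> carrier Q"
  by (simp add: Q_carrier)

lemma coset_eq_iff: "x \<in> carrier V \<Longrightarrow> y \<in> carrier V \<Longrightarrow> coset x = coset y \<longleftrightarrow> x \<ominus> y \<in> N"
  using a_rcos_module[of y x] a_repr_independence'[of x y] a_repr_independenceD[of x y]
  unfolding a_minus_def by metis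

lemma coset_mem: "x \<in> carrier V \<Longrightarrow> z \<in> coset x \<longleftrightarrow> z \<in> carrier V \<and> coset z = coset x"
  using a_elemrcos_carrier[of x z] a_repr_independence'[of z x] a_repr_independenceD[of z x] by blast

lemma coset_add: "x \<in> carrier V \<Longrightarrow> y \<in> carrier V \<Longrightarrow> coset x \<oplus>\<^bsub>Q\<^esub> coset y = coset (x \<oplus> y)"
  by (simp add: star_quotient_def a_rcos_sum)

lemma coset_zero: "\<zero>\<^bsub>Q\<^esub> = coset \<zero>"
  using a_rcos_const[OF submodule_complexD(2)[OF N]] by (simp add: star_quotient_def)

lemma coset_one: "\<one>\<^bsub>Q\<^esub> = coset \<one>"
  by (simp add: star_quotient_def)

text \<open>The operations of \<^const>\<open>star_quotient\<close> are unions over all representatives. They collapse to one term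
  once the operation respects cosets.\<close>

lemma UN_coset:
  assumes "x \<in> carrier V" and f: "\<And>y. y \<in> carrier V \<Longrightarrow> coset y = coset x \<Longrightarrow> F y = F x"
  shows "(\<Union>y\<in>coset x. F y) = F x"
proof -
  have "F y = F x" if "y \<in> coset x" for y
    using f that by (simp add: coset_mem[OF assms(1)])
  moreover have "x \<in> coset x" using assms(1) by (rule a_rcos_self)
  ultimately show ?thesis by blast
qed

lemma coset_smult: assumes x: "x \<in> carrier V" shows "c \<odot>\<^bsub>Q\<^esub> coset x = coset (c \<odot> x)"
proof -
  have "(\<Union>y\<in>coset x. coset (c \<odot> y)) = coset (c \<odot> x)"
  proof (rule UN_coset[OF x])
    fix y assume y: "y \<in> carrier V" "coset y = coset x"
    then have "c \<odot> (y \<ominus> x) \<in> N" using x submodule_complexD(4)[OF N] coset_eq_iff by simp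
    then have "c \<odot> y \<ominus> c \<odot> x \<in> N"
      using x y by (simp add: a_minus_def smult_r_distr smult_r_minus)
    then show "coset (c \<odot> y) = coset (c \<odot> x)" using x y by (simp add: coset_eq_iff)
  qed
  then show ?thesis by (simp add: star_quotient_def)
qed

lemma quotient_module: "Module.module complex_ring Q"
proof (rule complex_moduleI)
  fix X Y Z c d assume "X \<in> carrier Q" "Y \<in> carrier Q" "Z \<in> carrier Q"
  then obtain x y z where XYZ: "X = coset x" "Y = coset y" "Z = coset z"
    and x: "x \<in> carrier V" "y \<in> carrier V" "z \<in> carrier V"
    by (auto simp: Q_carrier)
  show "X \<oplus>\<^bsub>Q\<^esub> Y \<oplus>\<^bsub>Q\<^esub> Z = X \<oplus>\<^bsub>Q\<^esub> (Y \<oplus>\<^bsub>Q\<^esub> Z)"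
    using x by (simp add: XYZ coset_add M.a_assoc)
  show "X \<oplus>\<^bsub>Q\<^esub> Y = Y \<oplus>\<^bsub>Q\<^esub> X"
    using x by (simp add: XYZ coset_add M.a_comm)
qed (auto simp: Q_carrier coset_add coset_zero coset_smult smult_l_distr[simplified] smult_r_distr
        smult_assoc1[simplified] smult_one[simplified] smult_l_null[simplified])

lemma coset_star:
  assumes x: "x \<in> carrier V"
    and star: "\<And>y. y \<in> carrier V \<Longrightarrow> star V y \<in> carrier V"
    and diff: "\<And>y. y \<in> carrier V \<Longrightarrow> star V (y \<ominus> x) = star V y \<ominus> star V x"
    and inv: "\<And>y. y \<in> N \<Longrightarrow> star V y \<in> N"
  shows "star Q (coset x) = coset (star V x)"
proof -
  have "(\<Union>y\<in>coset x. coset (star V y)) = coset (star V x)"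
  proof (rule UN_coset[OF x])
    fix y assume y: "y \<in> carrier V" "coset y = coset x"
    then have "star V (y \<ominus> x) \<in> N" using inv coset_eq_iff x by simp
    then show "coset (star V y) = coset (star V x)" using diff[OF y(1)] coset_eq_iff star x y by simp
  qed
  then show ?thesis by (simp add: star_quotient_def)
qed

lemma coset_mult:
  assumes x: "x \<in> carrier V" "y \<in> carrier V"
    and closed: "\<And>a b. a \<in> carrier V \<Longrightarrow> b \<in> carrier V \<Longrightarrow> a \<otimes> b \<in> carrier V"
    and distl: "\<And>a. a \<in> carrier V \<Longrightarrow> (a \<otimes> y) \<ominus> (x \<otimes> y) = (a \<ominus> x) \<otimes> y"
    and distr: "\<And>a b. a \<in> carrier V \<Longrightarrow> b \<in> carrier V \<Longrightarrow> (a \<otimes> b) \<ominus> (a \<otimes> y) = a \<otimes> (b \<ominus> y)"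
    and ideal: "\<And>a b. a \<in> N \<Longrightarrow> b \<in> carrier V \<Longrightarrow> a \<otimes> b \<in> N" "\<And>a b. a \<in> carrier V \<Longrightarrow> b \<in> N \<Longrightarrow> a \<otimes> b \<in> N"
  shows "coset x \<otimes>\<^bsub>Q\<^esub> coset y = coset (x \<otimes> y)"
proof -
  have 1: "(\<Union>b\<in>coset y. coset (a \<otimes> b)) = coset (a \<otimes> y)" if a: "a \<in> carrier V" for a
  proof (rule UN_coset[OF x(2)])
    fix b assume b: "b \<in> carrier V" "coset b = coset y"
    then have "a \<otimes> (b \<ominus> y) \<in> N" using ideal(2)[OF a] coset_eq_iff x by simp
    then show "coset (a \<otimes> b) = coset (a \<otimes> y)" using distr[OF a b(1)] coset_eq_iff closed a b x by simp
  qed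
  have "(\<Union>a\<in>coset x. \<Union>b\<in>coset y. coset (a \<otimes> b)) = (\<Union>b\<in>coset y. coset (x \<otimes> b))"
  proof (rule UN_coset[OF x(1)])
    fix a assume a: "a \<in> carrier V" "coset a = coset x"
    then have "(a \<ominus> x) \<otimes> y \<in> N" using ideal(1)[OF _ x(2)] coset_eq_iff x by simp
    then have "coset (a \<otimes> y) = coset (x \<otimes> y)" using distl[OF a(1)] coset_eq_iff closed a x by simp
    then show "(\<Union>b\<in>coset y. coset (a \<otimes> b)) = (\<Union>b\<in>coset y. coset (x \<otimes> b))"
      using 1 a x by simp
  qed
  then show ?thesis using 1[OF x(1)] by (simp add: star_quotient_def rcoset_mult_def)
qed

lemma coset_finsum:
  "finite F \<Longrightarrow> (\<And>k. k \<in> F \<Longrightarrow> f k \<in> carrier V) \<Longrightarrow>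
    (\<Oplus>\<^bsub>Q\<^esub>k\<in>F. coset (f k)) = coset (\<Oplus>k\<in>F. f k)"
proof (induction F rule: finite_induct)
  case empty
  interpret Q: Module.module complex_ring Q by (rule quotient_module)
  show ?case using coset_zero by simp
next
  case (insert k F)
  interpret Q: Module.module complex_ring Q by (rule quotient_module)
  have "(\<Oplus>\<^bsub>Q\<^esub>k\<in>insert k F. coset (f k)) = coset (f k) \<oplus>\<^bsub>Q\<^esub> (\<Oplus>\<^bsub>Q\<^esub>k\<in>F. coset (f k))"
    using insert by (intro Q.finsum_insert) (auto intro!: coset_closed)
  then show ?case using insert by (simp add: coset_add Pi_def)
qed

end

section \<open>Completion of a seminormed *-algebra\<close>

text \<open>What the completion uses of the maximal norm on a group algebra: bilinearity of the product and the bounds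
  on \<open>p\<close> make the coset operations well defined.\<close>

locale seminormed_star_algebra = complex_module A for A :: "'a star_space" (structure) +
  fixes p :: "'a \<Rightarrow> real"
  assumes one_closed: "\<one> \<in> carrier A"
    and mult_closed: "x \<in> carrier A \<Longrightarrow> y \<in> carrier A \<Longrightarrow> x \<otimes> y \<in> carrier A"
    and star_closed: "x \<in> carrier A \<Longrightarrow> star A x \<in> carrier A"
    and mult_l_distr: "x \<in> carrier A \<Longrightarrow> y \<in> carrier A \<Longrightarrow> z \<in> carrier A \<Longrightarrow> (x \<oplus> y) \<otimes> z = x \<otimes> z \<oplus> y \<otimes> z"
    and mult_r_distr: "x \<in> carrier A \<Longrightarrow> y \<in> carrier A \<Longrightarrow> z \<in> carrier A \<Longrightarrow> z \<otimes> (x \<oplus> y) = z \<otimes> x \<oplus> z \<otimes> y"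
    and smult_mult_l: "x \<in> carrier A \<Longrightarrow> y \<in> carrier A \<Longrightarrow> (c \<odot> x) \<otimes> y = c \<odot> (x \<otimes> y)"
    and smult_mult_r: "x \<in> carrier A \<Longrightarrow> y \<in> carrier A \<Longrightarrow> x \<otimes> (c \<odot> y) = c \<odot> (x \<otimes> y)"
    and star_add: "x \<in> carrier A \<Longrightarrow> y \<in> carrier A \<Longrightarrow> star A (x \<oplus> y) = star A x \<oplus> star A y"
    and star_smult: "x \<in> carrier A \<Longrightarrow> star A (c \<odot> x) = cnj c \<odot> star A x"
    and star_mult: "x \<in> carrier A \<Longrightarrow> y \<in> carrier A \<Longrightarrow> star A (x \<otimes> y) = star A y \<otimes> star A x"
    and star_star: "x \<in> carrier A \<Longrightarrow> star A (star A x) = x"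
    and p_nonneg: "x \<in> carrier A \<Longrightarrow> 0 \<le> p x"
    and p_add: "x \<in> carrier A \<Longrightarrow> y \<in> carrier A \<Longrightarrow> p (x \<oplus> y) \<le> p x + p y"
    and p_smult: "x \<in> carrier A \<Longrightarrow> p (c \<odot> x) \<le> cmod c * p x"
    and p_mult: "x \<in> carrier A \<Longrightarrow> y \<in> carrier A \<Longrightarrow> p (x \<otimes> y) \<le> p x * p y"
    and p_star: "x \<in> carrier A \<Longrightarrow> p (star A x) \<le> p x"
begin

lemma smult_in [simp]: "x \<in> carrier A \<Longrightarrow> c \<odot> x \<in> carrier A"
  using smult_closed[of c x] by simp

lemma minus_smult: "x \<in> carrier A \<Longrightarrow> y \<in> carrier A \<Longrightarrow> x \<ominus> y = x \<oplus> (-1) \<odot> y"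
  by (simp add: a_minus_def smult_minus_one)

lemma p_zero: "p \<zero> = 0"
  using p_smult[of \<zero> 0] p_nonneg[of \<zero>] by (simp add: smult_l_null[simplified])

lemma p_minus_split: "x \<in> carrier A \<Longrightarrow> y \<in> carrier A \<Longrightarrow> p x \<le> p (x \<ominus> y) + p y"
  using p_add[of "x \<ominus> y" y] by (simp add: a_minus_def M.a_assoc M.l_neg)

lemma mult_diff_l: "x \<in> carrier A \<Longrightarrow> y \<in> carrier A \<Longrightarrow> z \<in> carrier A \<Longrightarrow> x \<otimes> z \<ominus> y \<otimes> z = (x \<ominus> y) \<otimes> z"
  by (simp add: minus_smult mult_l_distr smult_mult_l mult_closed)

lemma mult_diff_r: "x \<in> carrier A \<Longrightarrow> y \<in> carrier A \<Longrightarrow> z \<in> carrier A \<Longrightarrow> z \<otimes> x \<ominus> z \<otimes> y = z \<otimes> (x \<ominus> y)"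
  by (simp add: minus_smult mult_r_distr smult_mult_r mult_closed)

lemma star_diff: "x \<in> carrier A \<Longrightarrow> y \<in> carrier A \<Longrightarrow> star A (x \<ominus> y) = star A x \<ominus> star A y"
  by (simp add: minus_smult star_add star_smult star_closed)

abbreviation C where "C \<equiv> cauchy_algebra A p"

abbreviation N where "N \<equiv> null_seqs A p"

lemma C_simps [simp]:
  "(x \<oplus>\<^bsub>C\<^esub> y) = (\<lambda>n. x n \<oplus> y n)" "(x \<otimes>\<^bsub>C\<^esub> y) = (\<lambda>n. x n \<otimes> y n)" "\<zero>\<^bsub>C\<^esub> = (\<lambda>_. \<zero>)" "\<one>\<^bsub>C\<^esub> = (\<lambda>_. \<one>)"
  "c \<odot>\<^bsub>C\<^esub> x = (\<lambda>n. c \<odot> x n)" "star C x = (\<lambda>n. star A (x n))"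
  by (simp_all add: cauchy_algebra_def)

lemma C_in: "x \<in> carrier C \<Longrightarrow> x n \<in> carrier A"
  by (simp add: cauchy_algebra_def)

lemma C_cauchy: "x \<in> carrier C \<Longrightarrow> 0 < e \<Longrightarrow> \<exists>M. \<forall>m\<ge>M. \<forall>n\<ge>M. p (x m \<ominus> x n) < e"
  by (simp add: cauchy_algebra_def)

lemma C_bound: assumes x: "x \<in> carrier C" obtains B where "B > 0" "\<And>n. p (x n) \<le> B"
proof -
  obtain M where M: "\<And>m n. m \<ge> M \<Longrightarrow> n \<ge> M \<Longrightarrow> p (x m \<ominus> x n) < 1"
    using C_cauchy[OF x, of 1] by auto
  define B where "B = Max ((\<lambda>n. p (x n)) ` {..M}) + 1"
  have B: "p (x n) + 1 \<le> B" if "n \<le> M" for n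
    unfolding B_def using that by simp
  have "p (x n) \<le> B" for n
  proof (cases "n \<le> M")
    case True then show ?thesis using B[of n] by simp
  next
    case False
    then have "p (x n) \<le> p (x n \<ominus> x M) + p (x M)" "p (x n \<ominus> x M) < 1"
      using p_minus_split[OF C_in[OF x] C_in[OF x]] M by auto
    then show ?thesis using B[of M] by simp
  qed
  moreover have "B > 0" using B[of M] p_nonneg[OF C_in[OF x, of M]] by simp
  ultimately show ?thesis using that by blast
qed

text \<open>A single estimate for sums, multiples, adjoints and products of Cauchy sequences.\<close>

lemma C_I:
  assumes z: "\<And>n. z n \<in> carrier A" and xy: "x \<in> carrier C" "y \<in> carrier C" and B: "B > 0"
    and le: "\<And>m n. p (z m \<ominus> z n) \<le> B * (p (x m \<ominus> x n) + p (y m \<ominus> y n))"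
  shows "z \<in> carrier C"
proof -
  have "\<exists>M. \<forall>m\<ge>M. \<forall>n\<ge>M. p (z m \<ominus> z n) < e" if e: "e > 0" for e
  proof -
    have e': "e / (2 * B) > 0" using e B by simp
    obtain M1 where M1: "\<And>m n. m \<ge> M1 \<Longrightarrow> n \<ge> M1 \<Longrightarrow> p (x m \<ominus> x n) < e / (2 * B)"
      using C_cauchy[OF xy(1) e'] by auto
    obtain M2 where M2: "\<And>m n. m \<ge> M2 \<Longrightarrow> n \<ge> M2 \<Longrightarrow> p (y m \<ominus> y n) < e / (2 * B)"
      using C_cauchy[OF xy(2) e'] by auto
    have "p (z m \<ominus> z n) < e" if "m \<ge> max M1 M2" "n \<ge> max M1 M2" for m n
    proof -
      have "p (x m \<ominus> x n) + p (y m \<ominus> y n) < e / B"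
        using M1[of m n] M2[of m n] that by (simp add: field_simps)
      then show ?thesis using le[of m n] B by (simp add: field_simps)
    qed
    then show ?thesis by blast
  qed
  then show ?thesis using z by (simp add: cauchy_algebra_def)
qed

lemma const_C: "a \<in> carrier A \<Longrightarrow> (\<lambda>_. a) \<in> carrier C"
  by (simp add: cauchy_algebra_def a_minus_def M.r_neg p_zero)

lemma C_add: assumes x: "x \<in> carrier C" "y \<in> carrier C" shows "(\<lambda>n. x n \<oplus> y n) \<in> carrier C"
proof (rule C_I[OF _ x, of _ 1])
  show "p ((x m \<oplus> y m) \<ominus> (x n \<oplus> y n)) \<le> 1 * (p (x m \<ominus> x n) + p (y m \<ominus> y n))" for m n
  proof -
    have "(x m \<oplus> y m) \<ominus> (x n \<oplus> y n) = (x m \<ominus> x n) \<oplus> (y m \<ominus> y n)"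
      using C_in[OF x(1)] C_in[OF x(2)] by (simp add: a_minus_def M.minus_add M.a_ac)
    then show ?thesis using p_add[of "x m \<ominus> x n" "y m \<ominus> y n"] C_in[OF x(1)] C_in[OF x(2)] by simp
  qed
qed (use C_in x in auto)

lemma C_smult: assumes x: "x \<in> carrier C" shows "(\<lambda>n. c \<odot> x n) \<in> carrier C"
proof (rule C_I[OF _ x x, of _ "cmod c + 1"])
  show "p (c \<odot> x m \<ominus> c \<odot> x n) \<le> (cmod c + 1) * (p (x m \<ominus> x n) + p (x m \<ominus> x n))" for m n
  proof -
    have "c \<odot> x m \<ominus> c \<odot> x n = c \<odot> (x m \<ominus> x n)"
      using C_in[OF x] by (simp add: a_minus_def smult_r_distr smult_r_minus)
    then have "p (c \<odot> x m \<ominus> c \<odot> x n) \<le> cmod c * p (x m \<ominus> x n)"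
      using p_smult[of "x m \<ominus> x n"] C_in[OF x] by simp
    also have "\<dots> \<le> (cmod c + 1) * (p (x m \<ominus> x n) + p (x m \<ominus> x n))"
      using p_nonneg[of "x m \<ominus> x n"] C_in[OF x] by (intro mult_mono) auto
    finally show ?thesis .
  qed
  show "0 < cmod c + 1" using norm_ge_zero[of c] by linarith
qed (use C_in x in auto)

lemma C_star: assumes x: "x \<in> carrier C" shows "(\<lambda>n. star A (x n)) \<in> carrier C"
proof (rule C_I[OF _ x x, of _ 1])
  show "p (star A (x m) \<ominus> star A (x n)) \<le> 1 * (p (x m \<ominus> x n) + p (x m \<ominus> x n))" for m n
    using p_star[of "x m \<ominus> x n"] star_diff[of "x m" "x n"] C_in[OF x] p_nonneg[of "x m \<ominus> x n"] by simp
qed (use C_in x star_closed in auto)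

lemma C_mult: assumes x: "x \<in> carrier C" "y \<in> carrier C" shows "(\<lambda>n. x n \<otimes> y n) \<in> carrier C"
proof -
  obtain B1 where B1: "B1 > 0" "\<And>n. p (x n) \<le> B1" by (rule C_bound[OF x(1)]) blast
  obtain B2 where B2: "B2 > 0" "\<And>n. p (y n) \<le> B2" by (rule C_bound[OF x(2)]) blast
  show ?thesis
  proof (rule C_I[OF _ x, of _ "B1 + B2"])
    show "p ((x m \<otimes> y m) \<ominus> (x n \<otimes> y n)) \<le> (B1 + B2) * (p (x m \<ominus> x n) + p (y m \<ominus> y n))" for m n
    proof -
      note c = C_in[OF x(1)] C_in[OF x(2)] mult_closed
      have "(x m \<otimes> y m) \<ominus> (x n \<otimes> y n) = ((x m \<otimes> y m) \<ominus> (x n \<otimes> y m)) \<oplus> ((x n \<otimes> y m) \<ominus> (x n \<otimes> y n))"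
        using c by (simp add: a_minus_def M.a_assoc M.l_neg) (simp add: M.a_assoc[symmetric] M.l_neg)
      also have "\<dots> = (x m \<ominus> x n) \<otimes> y m \<oplus> x n \<otimes> (y m \<ominus> y n)"
        using c by (simp add: mult_diff_l mult_diff_r)
      finally have "p ((x m \<otimes> y m) \<ominus> (x n \<otimes> y n)) \<le> p ((x m \<ominus> x n) \<otimes> y m) + p (x n \<otimes> (y m \<ominus> y n))"
        using p_add c by simp
      also have "\<dots> \<le> p (x m \<ominus> x n) * p (y m) + p (x n) * p (y m \<ominus> y n)"
        using c by (intro add_mono p_mult) auto
      also have "\<dots> \<le> p (x m \<ominus> x n) * (B1 + B2) + (B1 + B2) * p (y m \<ominus> y n)"
        using B1 B2 c p_nonneg by (intro add_mono mult_mono) (auto intro: add_increasing add_increasing2 less_imp_le)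
      finally show ?thesis by (simp add: algebra_simps)
    qed
  qed (use C_in x mult_closed B1 B2 in auto)
qed

lemma C_module: "Module.module complex_ring C"
proof (rule complex_moduleI)
  show "x \<oplus>\<^bsub>C\<^esub> y = y \<oplus>\<^bsub>C\<^esub> x" if "x \<in> carrier C" "y \<in> carrier C" for x y
    using that by (simp add: C_in M.a_comm)
qed (auto simp: C_add C_smult const_C C_in M.a_assoc smult_l_distr[simplified] smult_r_distr
       smult_assoc1[simplified] smult_one[simplified] smult_l_null[simplified])

sublocale C: complex_module C
  by (rule complex_module.intro) (rule C_module)

lemma N_D: "x \<in> N \<Longrightarrow> x \<in> carrier C" "x \<in> N \<Longrightarrow> (\<lambda>n. p (x n)) \<longlonglongrightarrow> 0"
  by (simp_all add: null_seqs_def)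

lemma N_I:
  assumes z: "z \<in> carrier C" and q: "q \<longlonglongrightarrow> 0" and le: "\<And>n. p (z n) \<le> q n"
  shows "z \<in> N"
proof -
  have "(\<lambda>n. p (z n)) \<longlonglongrightarrow> 0"
    by (rule tendsto_sandwich[OF _ _ tendsto_const q]) (auto simp: p_nonneg C_in[OF z] le)
  then show ?thesis using z by (simp add: null_seqs_def)
qed

lemma N_submodule: "submodule N complex_ring C"
proof (rule C.submodule_complexI)
  show "N \<subseteq> carrier C" using N_D by auto
  show "\<zero>\<^bsub>C\<^esub> \<in> N" using const_C[of \<zero>] by (auto simp: null_seqs_def p_zero)
  show "x \<oplus>\<^bsub>C\<^esub> y \<in> N" if "x \<in> N" "y \<in> N" for x y
    using N_D[OF that(1)] N_D[OF that(2)] tendsto_add[of "\<lambda>n. p (x n)" 0 _ "\<lambda>n. p (y n)" 0]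
    by (intro N_I[of _ "\<lambda>n. p (x n) + p (y n)"]) (auto simp: C_add p_add C_in)
  show "c \<odot>\<^bsub>C\<^esub> x \<in> N" if "x \<in> N" for c x
    using N_D[OF that] tendsto_mult[OF tendsto_const, of "\<lambda>n. p (x n)" 0 _ "cmod c"]
    by (intro N_I[of _ "\<lambda>n. cmod c * p (x n)"]) (auto simp: C_smult p_smult C_in)
qed

sublocale Q: quotient_space C N
  by (rule quotient_space.intro) (auto intro: C.complex_module_axioms quotient_space_axioms.intro N_submodule)

lemma completion_eq: "completion A p = Q.Q"
  by (simp add: completion_def)

lemma C_minus: "x \<in> carrier C \<Longrightarrow> y \<in> carrier C \<Longrightarrow> x \<ominus>\<^bsub>C\<^esub> y = (\<lambda>n. x n \<ominus> y n)"
  using C.smult_minus_one[of y] by (auto simp: a_minus_def fun_eq_iff smult_minus_one C_in)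

lemma coset_star: "x \<in> carrier C \<Longrightarrow> star Q.Q (Q.coset x) = Q.coset (\<lambda>n. star A (x n))"
proof -
  assume x: "x \<in> carrier C"
  have "star Q.Q (Q.coset x) = Q.coset (star C x)"
  proof (rule Q.coset_star[OF x])
    show "star C y \<in> carrier C" if "y \<in> carrier C" for y using C_star[OF that] by simp
    show "star C (y \<ominus>\<^bsub>C\<^esub> x) = star C y \<ominus>\<^bsub>C\<^esub> star C x" if "y \<in> carrier C" for y
      using that x by (simp add: C_minus C_star star_diff C_in)
    show "star C y \<in> N" if "y \<in> N" for y
      using N_D[OF that] by (intro N_I[of _ "\<lambda>n. p (y n)"]) (auto simp: C_star p_star C_in)
  qed
  then show ?thesis by simp
qed

lemma coset_mult:
  assumes xy: "x \<in> carrier C" "y \<in> carrier C"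
  shows "Q.coset x \<otimes>\<^bsub>Q.Q\<^esub> Q.coset y = Q.coset (\<lambda>n. x n \<otimes> y n)"
proof -
  have "Q.coset x \<otimes>\<^bsub>Q.Q\<^esub> Q.coset y = Q.coset (x \<otimes>\<^bsub>C\<^esub> y)"
  proof (rule Q.coset_mult[OF xy])
    show "a \<otimes>\<^bsub>C\<^esub> b \<in> carrier C" if "a \<in> carrier C" "b \<in> carrier C" for a b
      using C_mult[OF that] by simp
    show "(a \<otimes>\<^bsub>C\<^esub> y) \<ominus>\<^bsub>C\<^esub> (x \<otimes>\<^bsub>C\<^esub> y) = (a \<ominus>\<^bsub>C\<^esub> x) \<otimes>\<^bsub>C\<^esub> y" if "a \<in> carrier C" for a
      using that xy by (simp add: C_minus C_mult mult_diff_l C_in)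
    show "(a \<otimes>\<^bsub>C\<^esub> b) \<ominus>\<^bsub>C\<^esub> (a \<otimes>\<^bsub>C\<^esub> y) = a \<otimes>\<^bsub>C\<^esub> (b \<ominus>\<^bsub>C\<^esub> y)" if "a \<in> carrier C" "b \<in> carrier C" for a b
      using that xy by (simp add: C_minus C_mult mult_diff_r C_in)
    show "a \<otimes>\<^bsub>C\<^esub> b \<in> N" if a: "a \<in> N" and b: "b \<in> carrier C" for a b
    proof -
      obtain B where B: "B > 0" "\<And>n. p (b n) \<le> B" by (rule C_bound[OF b]) blast
      have "p (a n \<otimes> b n) \<le> p (a n) * B" for n
        using p_mult[of "a n" "b n"] mult_left_mono[OF B(2)[of n] p_nonneg[of "a n"]] C_in N_D(1)[OF a] b
        by (meson order_trans)
      then show ?thesis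
        using tendsto_mult[OF N_D(2)[OF a] tendsto_const, of B] C_mult[OF N_D(1)[OF a] b]
        by (intro N_I[of _ "\<lambda>n. p (a n) * B"]) auto
    qed
    show "a \<otimes>\<^bsub>C\<^esub> b \<in> N" if a: "a \<in> carrier C" and b: "b \<in> N" for a b
    proof -
      obtain B where B: "B > 0" "\<And>n. p (a n) \<le> B" by (rule C_bound[OF a]) blast
      have "p (a n \<otimes> b n) \<le> B * p (b n)" for n
        using p_mult[of "a n" "b n"] mult_right_mono[OF B(2)[of n] p_nonneg[of "b n"]] C_in N_D(1)[OF b] a
        by (meson order_trans)
      then show ?thesis
        using tendsto_mult[OF tendsto_const N_D(2)[OF b], of B] C_mult[OF a N_D(1)[OF b]]
        by (intro N_I[of _ "\<lambda>n. B * p (b n)"]) auto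
    qed
  qed
  then show ?thesis by simp
qed

lemma C_finsum:
  "finite F \<Longrightarrow> (\<And>k. k \<in> F \<Longrightarrow> f k \<in> carrier C) \<Longrightarrow> (\<Oplus>\<^bsub>C\<^esub>k\<in>F. f k) = (\<lambda>n. \<Oplus>k\<in>F. f k n)"
proof (induction F rule: finite_induct)
  case (insert k F)
  then show ?case using C_in by (simp add: Pi_def fun_eq_iff)
qed simp

definition emb :: "'a \<Rightarrow> (nat \<Rightarrow> 'a) set" where
  "emb a = Q.coset (\<lambda>_. a)"

lemma emb_closed: "a \<in> carrier A \<Longrightarrow> emb a \<in> carrier Q.Q"
  unfolding emb_def by (intro Q.coset_closed const_C)

lemma emb_add: "a \<in> carrier A \<Longrightarrow> b \<in> carrier A \<Longrightarrow> emb a \<oplus>\<^bsub>Q.Q\<^esub> emb b = emb (a \<oplus> b)"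
  unfolding emb_def by (simp add: Q.coset_add const_C)

lemma emb_smult: "a \<in> carrier A \<Longrightarrow> c \<odot>\<^bsub>Q.Q\<^esub> emb a = emb (c \<odot> a)"
  unfolding emb_def by (simp add: Q.coset_smult const_C)

lemma emb_zero: "\<zero>\<^bsub>Q.Q\<^esub> = emb \<zero>"
  unfolding emb_def by (simp add: Q.coset_zero)

lemma emb_one: "\<one>\<^bsub>Q.Q\<^esub> = emb \<one>"
  unfolding emb_def by (simp add: Q.coset_one)

lemma emb_mult: "a \<in> carrier A \<Longrightarrow> b \<in> carrier A \<Longrightarrow> emb a \<otimes>\<^bsub>Q.Q\<^esub> emb b = emb (a \<otimes> b)"
  unfolding emb_def by (simp add: coset_mult const_C)

lemma emb_star: "a \<in> carrier A \<Longrightarrow> star Q.Q (emb a) = emb (star A a)"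
  unfolding emb_def by (simp add: coset_star const_C)

lemma emb_finsum:
  "finite F \<Longrightarrow> (\<And>k. k \<in> F \<Longrightarrow> f k \<in> carrier A) \<Longrightarrow> (\<Oplus>\<^bsub>Q.Q\<^esub>k\<in>F. emb (f k)) = emb (\<Oplus>k\<in>F. f k)"
  unfolding emb_def by (simp add: Q.coset_finsum C_finsum const_C)

end

section \<open>The group algebra and its maximal C*-norm\<close>

lemma delta_simps [simp]: "delta x x = 1" "y \<noteq> x \<Longrightarrow> delta x y = 0"
  by (auto simp: delta_def)

lemma finsuppD: "f \<in> finsupp A \<Longrightarrow> finite {x. f x \<noteq> 0}" "f \<in> finsupp A \<Longrightarrow> f x \<noteq> 0 \<Longrightarrow> x \<in> A"
  by (auto simp: finsupp_def)

lemma finsupp_add: "f \<in> finsupp A \<Longrightarrow> h \<in> finsupp A \<Longrightarrow> (\<lambda>x. f x + h x) \<in> finsupp A"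
proof -
  assume fh: "f \<in> finsupp A" "h \<in> finsupp A"
  have sub: "{x. f x + h x \<noteq> 0} \<subseteq> {x. f x \<noteq> 0} \<union> {x. h x \<noteq> 0}" by auto
  show ?thesis using fh finite_subset[OF sub] sub unfolding finsupp_def by blast
qed

lemma finsupp_smult: "f \<in> finsupp A \<Longrightarrow> (\<lambda>x. c * f x) \<in> finsupp A"
  unfolding finsupp_def by (auto intro: finite_subset[of _ "{x. f x \<noteq> 0}"])

lemma finsupp_zero: "(\<lambda>_. 0) \<in> finsupp A"
  by (simp add: finsupp_def)

lemma finsupp_delta: "x \<in> A \<Longrightarrow> delta x \<in> finsupp A"
  by (auto simp: finsupp_def delta_def)

lemma finsupp_sum: "finite F \<Longrightarrow> (\<And>k. k \<in> F \<Longrightarrow> f k \<in> finsupp A) \<Longrightarrow> (\<lambda>x. \<Sum>k\<in>F. f k x) \<in> finsupp A"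
  by (induction F rule: finite_induct) (auto simp: finsupp_zero finsupp_add)

text \<open>The pairing of a formal linear combination with a function. An element of the group algebra is
  determined by its pairings, and products and adjoints have simple pairings; identities in the
  group algebra are therefore checked by pairing both sides with an arbitrary function.\<close>

definition lin_ext :: "('x \<Rightarrow> complex) \<Rightarrow> ('x \<Rightarrow> complex) \<Rightarrow> complex" where
  "lin_ext f F = (\<Sum>x\<in>{x. f x \<noteq> 0}. f x * F x)"

lemma lin_ext_eq_sum: "finite S \<Longrightarrow> {x. f x \<noteq> 0} \<subseteq> S \<Longrightarrow> lin_ext f F = (\<Sum>x\<in>S. f x * F x)"
  unfolding lin_ext_def by (rule sum.mono_neutral_left) auto

lemma lin_ext_delta_right: "finite {x. f x \<noteq> 0} \<Longrightarrow> lin_ext f (delta x) = f x"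
proof -
  assume fin: "finite {x. f x \<noteq> 0}"
  have "lin_ext f (delta x) = (\<Sum>y\<in>insert x {x. f x \<noteq> 0}. f y * delta x y)"
    using fin by (intro lin_ext_eq_sum) auto
  also have "\<dots> = (\<Sum>y\<in>insert x {x. f x \<noteq> 0}. if y = x then f y else 0)"
    by (intro sum.cong) (auto simp: delta_def)
  finally show ?thesis using fin by (simp add: sum.delta)
qed

lemma lin_ext_delta: "lin_ext (delta x) F = F x"
proof -
  have "lin_ext (delta x) F = (\<Sum>y\<in>{x}. delta x y * F y)"
    by (rule lin_ext_eq_sum) (auto simp: delta_def)
  then show ?thesis by simp
qed

lemma lin_ext_add: 
  assumes "f \<in> finsupp A" "h \<in> finsupp A"
  shows "lin_ext (\<lambda>x. f x + h x) F = lin_ext f F + lin_ext h F"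
proof -
  let ?S = "{x. f x \<noteq> 0} \<union> {x. h x \<noteq> 0}"
  have S: "finite ?S" using assms by (simp add: finsupp_def)
  have "lin_ext (\<lambda>x. f x + h x) F = (\<Sum>x\<in>?S. (f x + h x) * F x)"
    "lin_ext f F = (\<Sum>x\<in>?S. f x * F x)" "lin_ext h F = (\<Sum>x\<in>?S. h x * F x)"
    by (rule lin_ext_eq_sum[OF S]; auto)+
  then show ?thesis by (simp add: distrib_right sum.distrib)
qed

lemma lin_ext_smult: "f \<in> finsupp A \<Longrightarrow> lin_ext (\<lambda>x. c * f x) F = c * lin_ext f F"
proof -
  assume f: "f \<in> finsupp A"
  have "lin_ext (\<lambda>x. c * f x) F = (\<Sum>x\<in>{x. f x \<noteq> 0}. c * f x * F x)"
    by (rule lin_ext_eq_sum) (use finsuppD[OF f] in auto)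
  then show ?thesis by (simp add: lin_ext_def sum_distrib_left mult.assoc)
qed

context group
begin

abbreviation CG where "CG \<equiv> group_algebra G"

lemma CG_simps [simp]:
  "carrier CG = finsupp (carrier G)" "\<one>\<^bsub>CG\<^esub> = delta \<one>" "\<zero>\<^bsub>CG\<^esub> = (\<lambda>_. 0)"
  "f \<oplus>\<^bsub>CG\<^esub> h = (\<lambda>x. f x + h x)" "c \<odot>\<^bsub>CG\<^esub> f = (\<lambda>x. c * f x)"
  by (simp_all add: group_algebra_def)

lemma CG_star: "star CG f = (\<lambda>x. if x \<in> carrier G then cnj (f (inv x)) else 0)"
  by (simp add: group_algebra_def)

lemma CG_mult: "f \<otimes>\<^bsub>CG\<^esub> h = (\<lambda>x. if x \<in> carrier G then lin_ext f (\<lambda>g. h (inv g \<otimes> x)) else 0)"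
  by (simp add: group_algebra_def lin_ext_def fun_eq_iff)

lemma CG_module: "Module.module complex_ring CG"
  by (rule complex_moduleI) (auto simp: finsupp_add finsupp_zero finsupp_smult algebra_simps)

lemma CG_mult_support:
  assumes f: "f \<in> finsupp (carrier G)" and h: "h \<in> finsupp (carrier G)"
  shows "{x. (f \<otimes>\<^bsub>CG\<^esub> h) x \<noteq> 0} \<subseteq> (\<lambda>(g, k). g \<otimes> k) ` ({x. f x \<noteq> 0} \<times> {x. h x \<noteq> 0})"
proof
  fix x assume "x \<in> {x. (f \<otimes>\<^bsub>CG\<^esub> h) x \<noteq> 0}"
  then have x: "x \<in> carrier G" "lin_ext f (\<lambda>g. h (inv g \<otimes> x)) \<noteq> 0"
    by (auto simp: CG_mult split: if_splits)
  then obtain g where g: "f g \<noteq> 0" "h (inv g \<otimes> x) \<noteq> 0"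
    unfolding lin_ext_def by (metis (mono_tags, lifting) mem_Collect_eq mult_not_zero sum.neutral)
  have gc: "g \<in> carrier G" using finsuppD(2)[OF f g(1)] .
  have "x = g \<otimes> (inv g \<otimes> x)" using x(1) gc by (simp add: m_assoc[symmetric])
  then show "x \<in> (\<lambda>(g, k). g \<otimes> k) ` ({x. f x \<noteq> 0} \<times> {x. h x \<noteq> 0})"
    using g by (intro image_eqI[of _ _ "(g, inv g \<otimes> x)"]) auto
qed

lemma CG_mult_closed:
  assumes f: "f \<in> finsupp (carrier G)" and h: "h \<in> finsupp (carrier G)"
  shows "f \<otimes>\<^bsub>CG\<^esub> h \<in> finsupp (carrier G)"
proof -
  have "finite {x. (f \<otimes>\<^bsub>CG\<^esub> h) x \<noteq> 0}"
    using finsuppD(1)[OF f] finsuppD(1)[OF h] by (intro finite_subset[OF CG_mult_support[OF f h]]) auto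
  then show ?thesis by (auto simp: finsupp_def CG_mult split: if_splits)
qed

lemma lin_ext_mult:
  assumes f: "f \<in> finsupp (carrier G)" and h: "h \<in> finsupp (carrier G)"
  shows "lin_ext (f \<otimes>\<^bsub>CG\<^esub> h) F = lin_ext f (\<lambda>g. lin_ext h (\<lambda>k. F (g \<otimes> k)))"
proof -
  define T where "T = (\<lambda>(g, k). g \<otimes> k) ` ({x. f x \<noteq> 0} \<times> {x. h x \<noteq> 0})"
  have T: "finite T" "T \<subseteq> carrier G"
    unfolding T_def using finsuppD[OF f] finsuppD[OF h] by auto
  have inner: "(\<Sum>x\<in>T. h (inv g \<otimes> x) * F x) = lin_ext h (\<lambda>k. F (g \<otimes> k))" if g: "f g \<noteq> 0" for g
  proof -
    have gc: "g \<in> carrier G" using finsuppD(2)[OF f g] .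
    have hc: "{x. h x \<noteq> 0} \<subseteq> carrier G" using finsuppD(2)[OF h] by auto
    have "lin_ext h (\<lambda>k. F (g \<otimes> k)) = (\<Sum>k\<in>{x. h x \<noteq> 0}. h (inv g \<otimes> (g \<otimes> k)) * F (g \<otimes> k))"
      unfolding lin_ext_def using gc hc by (intro sum.cong) (auto simp: m_assoc[symmetric])
    also have "\<dots> = (\<Sum>x\<in>(\<lambda>k. g \<otimes> k) ` {x. h x \<noteq> 0}. h (inv g \<otimes> x) * F x)"
      using gc hc[THEN subsetD] by (subst sum.reindex) (auto intro!: inj_onI)
    also have "\<dots> = (\<Sum>x\<in>T. h (inv g \<otimes> x) * F x)"
    proof (rule sum.mono_neutral_left[OF T(1)])
      show "(\<lambda>k. g \<otimes> k) ` {x. h x \<noteq> 0} \<subseteq> T" using g by (auto simp: T_def)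
      show "\<forall>x\<in>T - (\<lambda>k. g \<otimes> k) ` {x. h x \<noteq> 0}. h (inv g \<otimes> x) * F x = 0"
      proof
        fix x assume x: "x \<in> T - (\<lambda>k. g \<otimes> k) ` {x. h x \<noteq> 0}"
        then have "x = g \<otimes> (inv g \<otimes> x)" using T(2) gc by (auto simp: m_assoc[symmetric])
        then show "h (inv g \<otimes> x) * F x = 0" using x by auto
      qed
    qed
    finally show ?thesis by simp
  qed
  have "lin_ext (f \<otimes>\<^bsub>CG\<^esub> h) F = (\<Sum>x\<in>T. (f \<otimes>\<^bsub>CG\<^esub> h) x * F x)"
    using CG_mult_support[OF f h] T by (intro lin_ext_eq_sum) (auto simp: T_def)
  also have "\<dots> = (\<Sum>x\<in>T. \<Sum>g\<in>{x. f x \<noteq> 0}. f g * (h (inv g \<otimes> x) * F x))"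
    using T(2) by (intro sum.cong) (auto simp: CG_mult lin_ext_def sum_distrib_right mult.assoc)
  also have "\<dots> = (\<Sum>g\<in>{x. f x \<noteq> 0}. \<Sum>x\<in>T. f g * (h (inv g \<otimes> x) * F x))"
    by (rule sum.swap)
  also have "\<dots> = (\<Sum>g\<in>{x. f x \<noteq> 0}. f g * lin_ext h (\<lambda>k. F (g \<otimes> k)))"
    by (intro sum.cong) (auto simp: inner simp flip: sum_distrib_left)
  finally show ?thesis by (simp add: lin_ext_def)
qed

lemma CG_star_support: "{x. star CG f x \<noteq> 0} \<subseteq> (\<lambda>x. inv x) ` {x. f x \<noteq> 0}"
  by (auto simp: CG_star image_iff intro: exI[of _ "inv _"] split: if_splits) (metis inv_inv)

lemma CG_star_closed: "f \<in> finsupp (carrier G) \<Longrightarrow> star CG f \<in> finsupp (carrier G)"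
  using finite_subset[OF CG_star_support[of f]] finsuppD(1)[of f]
  by (auto simp: finsupp_def CG_star split: if_splits)

lemma lin_ext_star:
  assumes f: "f \<in> finsupp (carrier G)"
  shows "lin_ext (star CG f) F = cnj (lin_ext f (\<lambda>g. cnj (F (inv g))))"
proof -
  have fc: "{x. f x \<noteq> 0} \<subseteq> carrier G" using finsuppD(2)[OF f] by auto
  have "lin_ext (star CG f) F = (\<Sum>x\<in>(\<lambda>x. inv x) ` {x. f x \<noteq> 0}. star CG f x * F x)"
    by (rule lin_ext_eq_sum) (use finsuppD(1)[OF f] CG_star_support in auto)
  also have "\<dots> = (\<Sum>x\<in>{x. f x \<noteq> 0}. star CG f (inv x) * F (inv x))"
    using fc by (subst sum.reindex) (auto intro!: inj_onI dest: inv_inj[THEN inj_onD])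
  also have "\<dots> = (\<Sum>x\<in>{x. f x \<noteq> 0}. cnj (f x) * F (inv x))"
    using fc by (intro sum.cong) (auto simp: CG_star)
  finally show ?thesis by (simp add: lin_ext_def)
qed

lemma CG_eqI:
  assumes "f \<in> finsupp (carrier G)" "h \<in> finsupp (carrier G)" "\<And>F. lin_ext f F = lin_ext h F"
  shows "f = h"
  using assms lin_ext_delta_right[OF finsuppD(1)] by (metis ext)

lemma CG_star_mult:
  assumes f: "f \<in> finsupp (carrier G)" and h: "h \<in> finsupp (carrier G)"
  shows "star CG (f \<otimes>\<^bsub>CG\<^esub> h) = star CG h \<otimes>\<^bsub>CG\<^esub> star CG f"
proof (rule CG_eqI)
  note c = CG_star_closed CG_mult_closed f h
  have cf: "f g \<noteq> 0 \<Longrightarrow> g \<in> carrier G" "h g \<noteq> 0 \<Longrightarrow> g \<in> carrier G" for g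
    using finsuppD(2)[OF f] finsuppD(2)[OF h] by auto
  show "lin_ext (star CG (f \<otimes>\<^bsub>CG\<^esub> h)) F = lin_ext (star CG h \<otimes>\<^bsub>CG\<^esub> star CG f) F" for F
    using c apply (simp add: lin_ext_star lin_ext_mult)
    apply (simp add: lin_ext_def sum_distrib_left)
    apply (subst sum.swap)
    apply (intro sum.cong refl)
    apply (auto simp: cf inv_mult_group mult_ac)
    done
qed (use CG_star_closed CG_mult_closed f h in auto)

lemma CG_star_star: "f \<in> finsupp (carrier G) \<Longrightarrow> star CG (star CG f) = f"
  by (auto simp: CG_star fun_eq_iff dest: finsuppD(2))

lemma CG_mult_delta:
  assumes "g \<in> carrier G" "k \<in> carrier G"
  shows "delta g \<otimes>\<^bsub>CG\<^esub> delta k = delta (g \<otimes> k)"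
  by (rule CG_eqI) (use assms in \<open>auto simp: lin_ext_mult lin_ext_delta finsupp_delta CG_mult_closed\<close>)

lemma CG_star_delta: "g \<in> carrier G \<Longrightarrow> star CG (delta g) = delta (inv g)"
  by (rule CG_eqI) (auto simp: lin_ext_star lin_ext_delta finsupp_delta CG_star_closed)

lemma CG_mult_distr:
  assumes "f \<in> finsupp (carrier G)" "f' \<in> finsupp (carrier G)" "h \<in> finsupp (carrier G)"
  shows "(\<lambda>x. f x + f' x) \<otimes>\<^bsub>CG\<^esub> h = (\<lambda>x. (f \<otimes>\<^bsub>CG\<^esub> h) x + (f' \<otimes>\<^bsub>CG\<^esub> h) x)"
    and "h \<otimes>\<^bsub>CG\<^esub> (\<lambda>x. f x + f' x) = (\<lambda>x. (h \<otimes>\<^bsub>CG\<^esub> f) x + (h \<otimes>\<^bsub>CG\<^esub> f') x)"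
    and "(\<lambda>x. c * f x) \<otimes>\<^bsub>CG\<^esub> h = (\<lambda>x. c * (f \<otimes>\<^bsub>CG\<^esub> h) x)"
    and "h \<otimes>\<^bsub>CG\<^esub> (\<lambda>x. c * f x) = (\<lambda>x. c * (h \<otimes>\<^bsub>CG\<^esub> f) x)"
  using assms by (auto simp: CG_mult fun_eq_iff lin_ext_add lin_ext_smult)
    (simp_all add: lin_ext_def algebra_simps sum.distrib sum_distrib_left)

text \<open>By the C*-identity the square of the seminorm of a group element is the seminorm of the unit, and the
  latter is idempotent.\<close>

lemma cstar_seminorm_delta_le_1:
  assumes p: "cstar_seminorm CG p" and g: "g \<in> carrier G"
  shows "p (delta g) \<le> 1"
proof -
  have "p (star CG (delta g) \<otimes>\<^bsub>CG\<^esub> delta g) = (p (delta g))\<^sup>2" if "g \<in> carrier G" for g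
    using p that finsupp_delta[of g "carrier G"] unfolding cstar_seminorm_def CG_simps by blast
  then have sq: "(p (delta g))\<^sup>2 = p (delta \<one>)" if "g \<in> carrier G" for g
    using that by (simp add: CG_star_delta CG_mult_delta)
  have "p (delta \<one>) = 0 \<or> p (delta \<one>) = 1"
    using sq[of \<one>] by (auto simp: power2_eq_square)
  then have "(p (delta g))\<^sup>2 \<le> 1\<^sup>2" using sq[OF g] by auto
  then show ?thesis by (rule power2_le_imp_le) simp
qed

lemma cstar_seminorm_le_l1:
  assumes p: "cstar_seminorm CG p" and f: "f \<in> finsupp (carrier G)"
  shows "p f \<le> (\<Sum>g\<in>{g. f g \<noteq> 0}. cmod (f g))"
proof -
  have add: "p (\<lambda>x. a x + b x) \<le> p a + p b" if "a \<in> finsupp (carrier G)" "b \<in> finsupp (carrier G)" for a b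
    using p that unfolding cstar_seminorm_def CG_simps by blast
  have sm: "p (\<lambda>x. c * a x) = cmod c * p a" if "a \<in> finsupp (carrier G)" for a c
    using p that unfolding cstar_seminorm_def CG_simps by blast
  have "(\<lambda>x. if x \<in> S then f x else 0) \<in> finsupp (carrier G) \<and>
      p (\<lambda>x. if x \<in> S then f x else 0) \<le> (\<Sum>g\<in>S. cmod (f g))"
    if "finite S" "S \<subseteq> carrier G" for S
    using that
  proof (induction S rule: finite_induct)
    case empty
    then show ?case using sm[OF finsupp_zero, of 0] by (simp add: finsupp_zero)
  next
    case (insert g S)
    let ?a = "\<lambda>x. if x \<in> S then f x else 0"
    have eq: "(\<lambda>x. if x \<in> insert g S then f x else 0) = (\<lambda>x. f g * delta g x + ?a x)"
      using insert.hyps by (auto simp: fun_eq_iff delta_def)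
    have g: "delta g \<in> finsupp (carrier G)" using insert.prems by (auto intro: finsupp_delta)
    have "p (\<lambda>x. f g * delta g x + ?a x) \<le> p (\<lambda>x. f g * delta g x) + p ?a"
      using insert by (intro add finsupp_smult g) auto
    also have "\<dots> \<le> cmod (f g) * 1 + (\<Sum>g\<in>S. cmod (f g))"
      unfolding sm[OF g] using insert cstar_seminorm_delta_le_1[OF p, of g]
      by (intro add_mono mult_left_mono) auto
    finally show ?case
      unfolding eq using insert finsupp_add[OF finsupp_smult[OF g]] by simp
  qed
  from this[of "{g. f g \<noteq> 0}"] finsuppD[OF f]
  have "p (\<lambda>x. if x \<in> {g. f g \<noteq> 0} then f x else 0) \<le> (\<Sum>g\<in>{g. f g \<noteq> 0}. cmod (f g))" by blast
  moreover have "(\<lambda>x. if x \<in> {g. f g \<noteq> 0} then f x else 0) = f" by auto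
  ultimately show ?thesis by simp
qed

abbreviation MN where "MN \<equiv> max_cstar_norm CG"

lemma cstar_seminorm_le_max:
  assumes "cstar_seminorm CG p" "f \<in> finsupp (carrier G)"
  shows "p f \<le> MN f"
  unfolding max_cstar_norm_def
  by (rule cSUP_upper) (use assms cstar_seminorm_le_l1 in \<open>auto intro!: bdd_aboveI2\<close>)

lemma max_le:
  assumes "\<And>p. cstar_seminorm CG p \<Longrightarrow> p f \<le> c"
  shows "MN f \<le> c"
proof -
  have "cstar_seminorm CG (\<lambda>_. 0)" by (simp add: cstar_seminorm_def)
  then show ?thesis unfolding max_cstar_norm_def using assms by (intro cSUP_least) auto
qed

lemma max_nonneg: "f \<in> finsupp (carrier G) \<Longrightarrow> 0 \<le> MN f"
  using cstar_seminorm_le_max[of "\<lambda>_. 0" f] by (simp add: cstar_seminorm_def)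

lemma cstar_seminorm_star:
  assumes p: "cstar_seminorm CG p" and f: "f \<in> finsupp (carrier G)"
  shows "p (star CG f) \<le> p f"
proof -
  have fs: "star CG f \<in> finsupp (carrier G)" using CG_star_closed[OF f] .
  have "(p (star CG f))\<^sup>2 = p (star CG (star CG f) \<otimes>\<^bsub>CG\<^esub> star CG f)"
    using p fs unfolding cstar_seminorm_def CG_simps by simp
  also have "\<dots> \<le> p f * p (star CG f)"
    using p f fs unfolding CG_star_star[OF f] cstar_seminorm_def CG_simps by blast
  finally have "p (star CG f) * p (star CG f) \<le> p f * p (star CG f)" by (simp add: power2_eq_square)
  moreover have "0 \<le> p f" "0 \<le> p (star CG f)"
    using p f fs unfolding cstar_seminorm_def CG_simps by auto
  ultimately show ?thesis by (cases "p (star CG f) = 0") auto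
qed

lemma seminormed_CG: "seminormed_star_algebra CG MN"
proof (intro seminormed_star_algebra.intro complex_module.intro CG_module seminormed_star_algebra_axioms.intro)
  fix x y z c assume x: "x \<in> carrier CG"
  then show "star CG x \<in> carrier CG" "star CG (star CG x) = x"
    "star CG (c \<odot>\<^bsub>CG\<^esub> x) = cnj c \<odot>\<^bsub>CG\<^esub> star CG x" "0 \<le> MN x"
    by (auto simp: CG_star_closed CG_star_star max_nonneg) (auto simp: CG_star fun_eq_iff)
  show "MN (star CG x) \<le> MN x"
    by (rule max_le) (use x cstar_seminorm_star cstar_seminorm_le_max order_trans in \<open>simp, blast\<close>)
  show "MN (c \<odot>\<^bsub>CG\<^esub> x) \<le> cmod c * MN x"
  proof (rule max_le)
    fix p assume p: "cstar_seminorm CG p"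
    then have "p (c \<odot>\<^bsub>CG\<^esub> x) = cmod c * p x" using x unfolding cstar_seminorm_def by blast
    then show "p (c \<odot>\<^bsub>CG\<^esub> x) \<le> cmod c * MN x"
      using cstar_seminorm_le_max[OF p, of x] x by (simp add: mult_left_mono)
  qed
  assume y: "y \<in> carrier CG"
  show "x \<otimes>\<^bsub>CG\<^esub> y \<in> carrier CG" "star CG (x \<otimes>\<^bsub>CG\<^esub> y) = star CG y \<otimes>\<^bsub>CG\<^esub> star CG x"
    "(c \<odot>\<^bsub>CG\<^esub> x) \<otimes>\<^bsub>CG\<^esub> y = c \<odot>\<^bsub>CG\<^esub> (x \<otimes>\<^bsub>CG\<^esub> y)" "x \<otimes>\<^bsub>CG\<^esub> (c \<odot>\<^bsub>CG\<^esub> y) = c \<odot>\<^bsub>CG\<^esub> (x \<otimes>\<^bsub>CG\<^esub> y)"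
    using x y by (simp_all add: CG_mult_closed CG_star_mult CG_mult_distr)
  show "star CG (x \<oplus>\<^bsub>CG\<^esub> y) = star CG x \<oplus>\<^bsub>CG\<^esub> star CG y"
    by (auto simp: CG_star fun_eq_iff)
  show "MN (x \<oplus>\<^bsub>CG\<^esub> y) \<le> MN x + MN y"
  proof (rule max_le)
    fix p assume p: "cstar_seminorm CG p"
    then have "p (x \<oplus>\<^bsub>CG\<^esub> y) \<le> p x + p y" using x y unfolding cstar_seminorm_def by blast
    then show "p (x \<oplus>\<^bsub>CG\<^esub> y) \<le> MN x + MN y"
      using cstar_seminorm_le_max[OF p, of x] cstar_seminorm_le_max[OF p, of y] x y by simp
  qed
  show "MN (x \<otimes>\<^bsub>CG\<^esub> y) \<le> MN x * MN y"
  proof (rule max_le)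
    fix p assume p: "cstar_seminorm CG p"
    then have "p (x \<otimes>\<^bsub>CG\<^esub> y) \<le> p x * p y" "0 \<le> p y" using x y unfolding cstar_seminorm_def by blast+
    then show "p (x \<otimes>\<^bsub>CG\<^esub> y) \<le> MN x * MN y"
      using cstar_seminorm_le_max[OF p, of x] cstar_seminorm_le_max[OF p, of y] x y max_nonneg[of x]
        mult_mono[of "p x" "MN x" "p y" "MN y"] by simp
  qed
  assume z: "z \<in> carrier CG"
  show "(x \<oplus>\<^bsub>CG\<^esub> y) \<otimes>\<^bsub>CG\<^esub> z = x \<otimes>\<^bsub>CG\<^esub> z \<oplus>\<^bsub>CG\<^esub> y \<otimes>\<^bsub>CG\<^esub> z"
    "z \<otimes>\<^bsub>CG\<^esub> (x \<oplus>\<^bsub>CG\<^esub> y) = z \<otimes>\<^bsub>CG\<^esub> x \<oplus>\<^bsub>CG\<^esub> z \<otimes>\<^bsub>CG\<^esub> y"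
    using x y z by (simp_all add: CG_mult_distr)
qed (simp add: finsupp_delta)

end

section \<open>Finite-dimensional unitary representations\<close>

lemma lin_op_sum:
  assumes T: "lin_op T" and "finite S"
  shows "T (\<lambda>i. \<Sum>k\<in>S. c k * y k i) = (\<lambda>i. \<Sum>k\<in>S. c k * T (y k) i)"
  using assms(2)
proof (induction S rule: finite_induct)
  case empty
  show ?case using lin_opD[OF T, of 0 "\<lambda>_. 0" 0 "\<lambda>_. 0"] by simp
next
  case (insert k S)
  then show ?case
    using lin_opD[OF T, of "c k" "y k" 1 "\<lambda>i. \<Sum>k\<in>S. c k * y k i"] by simp
qed

definition nrm :: "'i set \<Rightarrow> ('i \<Rightarrow> complex) \<Rightarrow> real" where
  "nrm J x = L2_set (\<lambda>i. cmod (x i)) J"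

lemma nrm_nonneg [simp]: "0 \<le> nrm J x"
  by (simp add: nrm_def)

lemma ip_self_nrm: "ip J x x = complex_of_real ((nrm J x)\<^sup>2)"
  by (simp add: ip_self nrm_def L2_set_def sum_nonneg del: of_real_sum)

lemma nrm_smult: "nrm J (\<lambda>i. c * x i) = cmod c * nrm J x"
  by (simp add: nrm_def norm_mult L2_set_right_distrib)

lemma nrm_add: "nrm J (\<lambda>i. x i + y i) \<le> nrm J x + nrm J y"
proof -
  have "nrm J (\<lambda>i. x i + y i) \<le> L2_set (\<lambda>i. cmod (x i) + cmod (y i)) J"
    unfolding nrm_def by (intro L2_set_mono norm_triangle_ineq) auto
  also have "\<dots> \<le> nrm J x + nrm J y"
    unfolding nrm_def by (rule L2_set_triangle_ineq)
  finally show ?thesis .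
qed

lemma cauchy_schwarz: "cmod (ip J x y) \<le> nrm J x * nrm J y"
proof -
  have "cmod (ip J x y) \<le> (\<Sum>i\<in>J. \<bar>cmod (x i)\<bar> * \<bar>cmod (y i)\<bar>)"
    unfolding ip_def by (rule order_trans[OF norm_sum]) (simp add: norm_mult)
  also have "\<dots> \<le> nrm J x * nrm J y"
    unfolding nrm_def by (rule L2_set_mult_ineq)
  finally show ?thesis .
qed

lemma nrm_zero: "nrm J (\<lambda>_. 0) = 0"
  using nrm_smult[of J 0 "\<lambda>_. 0"] by simp

lemma nrm_sum: "finite S \<Longrightarrow> nrm J (\<lambda>i. \<Sum>k\<in>S. c k * y k i) \<le> (\<Sum>k\<in>S. cmod (c k) * nrm J (y k))"
proof (induction S rule: finite_induct)
  case (insert k S)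
  then show ?case
    using nrm_add[of J "\<lambda>i. c k * y k i" "\<lambda>i. \<Sum>k\<in>S. c k * y k i"] by (simp add: nrm_smult)
qed (simp add: nrm_zero)

text \<open>Unitarity is expressed by preservation of the form alone; the adjoint of \<open>U g\<close> is \<open>U (inv g)\<close>.\<close>

locale unitary_rep = group G for G :: "('g, 'm) monoid_scheme" (structure) +
  fixes J :: "'i set" and U :: "'g \<Rightarrow> ('i \<Rightarrow> complex) \<Rightarrow> ('i \<Rightarrow> complex)"
  assumes U_lin: "g \<in> carrier G \<Longrightarrow> lin_op (U g)"
    and U_mult: "g \<in> carrier G \<Longrightarrow> h \<in> carrier G \<Longrightarrow> U (g \<otimes> h) x = U g (U h x)"
    and U_one: "U \<one> x = x"
    and U_ip: "g \<in> carrier G \<Longrightarrow> ip J (U g x) (U g y) = ip J x y"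
begin

definition act :: "('g \<Rightarrow> complex) \<Rightarrow> ('i \<Rightarrow> complex) \<Rightarrow> ('i \<Rightarrow> complex)" where
  "act a x = (\<lambda>i. lin_ext a (\<lambda>g. U g x i))"

lemma act_add: "a \<in> finsupp (carrier G) \<Longrightarrow> b \<in> finsupp (carrier G) \<Longrightarrow>
    act (\<lambda>g. a g + b g) x = (\<lambda>i. act a x i + act b x i)"
  by (simp add: act_def lin_ext_add)

lemma act_smult: "a \<in> finsupp (carrier G) \<Longrightarrow> act (\<lambda>g. c * a g) x = (\<lambda>i. c * act a x i)"
  by (simp add: act_def lin_ext_smult)

lemma act_lin: "a \<in> finsupp (carrier G) \<Longrightarrow> lin_op (act a)"
  unfolding lin_op_def
proof (intro allI)
  fix c d x y assume a: "a \<in> finsupp (carrier G)"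
  have "a g * U g (\<lambda>i. c * x i + d * y i) i = c * (a g * U g x i) + d * (a g * U g y i)" for g i
    using lin_opD[OF U_lin[OF finsuppD(2)[OF a, of g]], of c x d y]
    by (cases "a g = 0") (simp_all add: algebra_simps)
  then show "act a (\<lambda>i. c * x i + d * y i) = (\<lambda>i. c * act a x i + d * act a y i)"
    by (simp add: act_def lin_ext_def fun_eq_iff sum.distrib sum_distrib_left)
qed

lemma act_mult:
  assumes a: "a \<in> finsupp (carrier G)" and b: "b \<in> finsupp (carrier G)"
  shows "act (a \<otimes>\<^bsub>CG\<^esub> b) x = act a (act b x)"
proof
  fix i
  have "lin_ext b (\<lambda>k. U (g \<otimes> k) x i) = U g (act b x) i" if g: "a g \<noteq> 0" for g
  proof -
    have gc: "g \<in> carrier G" using finsuppD(2)[OF a g] .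
    have "U g (act b x) = (\<lambda>i. \<Sum>k\<in>{k. b k \<noteq> 0}. b k * U g (U k x) i)"
      unfolding act_def lin_ext_def by (rule lin_op_sum[OF U_lin[OF gc] finsuppD(1)[OF b]])
    then show ?thesis
      unfolding lin_ext_def using gc finsuppD(2)[OF b] by (auto intro!: sum.cong simp: U_mult)
  qed
  then show "act (a \<otimes>\<^bsub>CG\<^esub> b) x i = act a (act b x) i"
    by (simp add: act_def[of "a \<otimes>\<^bsub>CG\<^esub> b"] lin_ext_mult[OF a b] act_def[of a]) (simp add: lin_ext_def)
qed

lemma ip_act_left: "ip J (act a x) y = lin_ext a (\<lambda>g. ip J (U g x) y)"
  unfolding act_def lin_ext_def ip_sum_left ip_scale_left ..

lemma ip_U: "g \<in> carrier G \<Longrightarrow> ip J (U g x) y = ip J x (U (inv g) y)"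
  using U_ip[of g x "U (inv g) y"] U_mult[of g "inv g" y] U_one by simp

lemma act_star:
  assumes a: "a \<in> finsupp (carrier G)"
  shows "ip J (act a x) y = ip J x (act (star CG a) y)"
proof -
  have "ip J x (act (star CG a) y) = cnj (lin_ext (star CG a) (\<lambda>g. ip J (U g y) x))"
    unfolding ip_act_left[symmetric] ip_cnj ..
  also have "\<dots> = lin_ext a (\<lambda>g. ip J x (U (inv g) y))"
    by (simp add: lin_ext_star[OF a] ip_cnj)
  also have "\<dots> = lin_ext a (\<lambda>g. ip J (U g x) y)"
    unfolding lin_ext_def using finsuppD(2)[OF a] by (intro sum.cong) (auto simp: ip_U)
  finally show ?thesis by (simp add: ip_act_left)
qed

lemma nrm_U: "g \<in> carrier G \<Longrightarrow> nrm J (U g x) = nrm J x"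
  using U_ip[of g x x] unfolding ip_self_nrm by (simp add: power2_eq_iff_nonneg del: of_real_power)

lemma nrm_act_le:
  assumes a: "a \<in> finsupp (carrier G)"
  shows "nrm J (act a x) \<le> (\<Sum>g\<in>{g. a g \<noteq> 0}. cmod (a g)) * nrm J x"
proof -
  have "nrm J (act a x) \<le> (\<Sum>g\<in>{g. a g \<noteq> 0}. cmod (a g) * nrm J (U g x))"
    unfolding act_def lin_ext_def by (rule nrm_sum[OF finsuppD(1)[OF a]])
  also have "\<dots> = (\<Sum>g\<in>{g. a g \<noteq> 0}. cmod (a g)) * nrm J x"
    unfolding sum_distrib_right using finsuppD(2)[OF a] by (intro sum.cong) (auto simp: nrm_U)
  finally show ?thesis .
qed

lemma act_bdd:
  assumes a: "a \<in> finsupp (carrier G)"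
  shows "bdd_above ((\<lambda>x. nrm J (act a x)) ` {x. nrm J x \<le> 1})"
proof (rule bdd_aboveI2)
  fix x assume "x \<in> {x. nrm J x \<le> 1}"
  then have "(\<Sum>g\<in>{g. a g \<noteq> 0}. cmod (a g)) * nrm J x \<le> (\<Sum>g\<in>{g. a g \<noteq> 0}. cmod (a g))"
    by (intro mult_left_le) (auto intro: sum_nonneg)
  then show "nrm J (act a x) \<le> (\<Sum>g\<in>{g. a g \<noteq> 0}. cmod (a g))"
    using nrm_act_le[OF a, of x] by linarith
qed

definition op_norm :: "('g \<Rightarrow> complex) \<Rightarrow> real" where
  "op_norm a = (SUP x\<in>{x. nrm J x \<le> 1}. nrm J (act a x))"

lemma op_norm_le: "0 \<le> c \<Longrightarrow> (\<And>x. nrm J (act a x) \<le> c * nrm J x) \<Longrightarrow> op_norm a \<le> c"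
  unfolding op_norm_def
proof (rule cSUP_least)
  show "{x. nrm J x \<le> 1} \<noteq> {}" using nrm_zero[of J] by (auto intro!: exI[of _ "\<lambda>_. 0"])
  fix x assume "0 \<le> c" "\<And>x. nrm J (act a x) \<le> c * nrm J x" "x \<in> {x. nrm J x \<le> 1}"
  then show "nrm J (act a x) \<le> c" by (metis mem_Collect_eq mult_left_le order_trans)
qed

lemma nrm_act:
  assumes a: "a \<in> finsupp (carrier G)"
  shows "nrm J (act a x) \<le> op_norm a * nrm J x"
proof (cases "nrm J x = 0")
  case True
  then show ?thesis using nrm_act_le[OF a, of x] by simp
next
  case False
  define y where "y = (\<lambda>i. complex_of_real (1 / nrm J x) * x i)"
  have "nrm J y = 1" unfolding y_def nrm_smult using False by (simp add: norm_divide)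
  then have "nrm J (act a y) \<le> op_norm a"
    unfolding op_norm_def by (intro cSUP_upper act_bdd a) auto
  moreover have "act a y = (\<lambda>i. complex_of_real (1 / nrm J x) * act a x i)"
    using lin_opD[OF act_lin[OF a], of "complex_of_real (1 / nrm J x)" x 0 x] by (simp add: y_def)
  then have "nrm J (act a y) = nrm J (act a x) / nrm J x"
    by (simp only: nrm_smult) (simp add: norm_divide)
  ultimately show ?thesis using False nrm_nonneg[of J x] by (simp add: divide_le_eq)
qed

lemma op_norm_nonneg: "a \<in> finsupp (carrier G) \<Longrightarrow> 0 \<le> op_norm a"
  unfolding op_norm_def by (rule cSUP_upper2[OF act_bdd, of a "\<lambda>_. 0"]) (auto simp: nrm_zero)

text \<open>Hence a finite-dimensional representation is bounded by the maximal norm and passes to the full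
  group C*-algebra.\<close>

theorem op_norm_cstar_seminorm: "cstar_seminorm CG op_norm"
  unfolding cstar_seminorm_def CG_simps
proof (intro conjI ballI allI)
  fix a b c assume a: "a \<in> finsupp (carrier G)"
  note sa = CG_star_closed[OF a]
  show "0 \<le> op_norm a" by (rule op_norm_nonneg[OF a])
  have sm: "op_norm (\<lambda>x. c * a x) \<le> cmod c * op_norm a" if "a \<in> finsupp (carrier G)" for a c
    using nrm_act[OF that] op_norm_nonneg[OF that]
    by (intro op_norm_le) (auto simp: act_smult[OF that] nrm_smult mult.assoc intro!: mult_left_mono)
  show "op_norm (\<lambda>x. c * a x) = cmod c * op_norm a"
  proof (cases "c = 0")
    case True
    then show ?thesis using sm[OF a, of 0] op_norm_nonneg[OF finsupp_smult[OF a, of 0]] by simp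
  next
    case False
    have "op_norm a \<le> cmod (1 / c) * op_norm (\<lambda>x. c * a x)"
      using sm[OF finsupp_smult[OF a, of c], of "1 / c"] False by simp
    then have "cmod c * op_norm a \<le> op_norm (\<lambda>x. c * a x)"
      using False by (simp add: norm_divide field_simps)
    then show ?thesis using sm[OF a, of c] by simp
  qed
  have st: "op_norm (star CG a) \<le> op_norm a" if a: "a \<in> finsupp (carrier G)" for a
  proof (rule op_norm_le[OF op_norm_nonneg[OF a]])
    fix x
    let ?y = "act (star CG a) x"
    have "complex_of_real ((nrm J ?y)\<^sup>2) = ip J (act a ?y) x"
      using act_star[OF a, of ?y x] unfolding ip_self_nrm by simp
    from arg_cong[OF this, of cmod] have "(nrm J ?y)\<^sup>2 = cmod (ip J (act a ?y) x)"
      by (simp only: norm_of_real abs_power2)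
    also have "\<dots> \<le> nrm J (act a ?y) * nrm J x" by (rule cauchy_schwarz)
    also have "\<dots> \<le> op_norm a * nrm J ?y * nrm J x" by (intro mult_right_mono nrm_act[OF a]) simp
    finally have "nrm J ?y * nrm J ?y \<le> (op_norm a * nrm J x) * nrm J ?y" by (simp add: power2_eq_square mult_ac)
    then show "nrm J ?y \<le> op_norm a * nrm J x"
      using op_norm_nonneg[OF a] nrm_nonneg[of J ?y] by (cases "nrm J ?y = 0") auto
  qed
  have mu: "op_norm (a \<otimes>\<^bsub>CG\<^esub> b) \<le> op_norm a * op_norm b" if a: "a \<in> finsupp (carrier G)" and b: "b \<in> finsupp (carrier G)" for a b
  proof (rule op_norm_le)
    show "0 \<le> op_norm a * op_norm b" using op_norm_nonneg a b by simp
    fix x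
    have "nrm J (act a (act b x)) \<le> op_norm a * nrm J (act b x)" by (rule nrm_act[OF a])
    also have "\<dots> \<le> op_norm a * (op_norm b * nrm J x)"
      by (intro mult_left_mono nrm_act[OF b] op_norm_nonneg[OF a])
    finally show "nrm J (act (a \<otimes>\<^bsub>CG\<^esub> b) x) \<le> op_norm a * op_norm b * nrm J x"
      by (simp add: act_mult[OF a b] mult.assoc)
  qed
  show "op_norm (star CG a \<otimes>\<^bsub>CG\<^esub> a) = (op_norm a)\<^sup>2"
  proof (rule antisym)
    have "op_norm (star CG a \<otimes>\<^bsub>CG\<^esub> a) \<le> op_norm (star CG a) * op_norm a" by (rule mu[OF sa a])
    also have "\<dots> \<le> op_norm a * op_norm a" by (intro mult_right_mono st a op_norm_nonneg)
    finally show "op_norm (star CG a \<otimes>\<^bsub>CG\<^esub> a) \<le> (op_norm a)\<^sup>2" by (simp add: power2_eq_square)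
    let ?c = "op_norm (star CG a \<otimes>\<^bsub>CG\<^esub> a)"
    have c: "0 \<le> ?c" by (intro op_norm_nonneg CG_mult_closed sa a)
    have "op_norm a \<le> sqrt ?c"
    proof (rule op_norm_le)
      fix x
      have "ip J (act a x) (act a x) = ip J x (act (star CG a \<otimes>\<^bsub>CG\<^esub> a) x)"
        using act_star[OF a] by (simp add: act_mult[OF sa a])
      from arg_cong[OF this, of cmod]
      have "(nrm J (act a x))\<^sup>2 = cmod (ip J x (act (star CG a \<otimes>\<^bsub>CG\<^esub> a) x))"
        unfolding ip_self_nrm by (simp only: norm_of_real abs_power2)
      also have "\<dots> \<le> nrm J x * nrm J (act (star CG a \<otimes>\<^bsub>CG\<^esub> a) x)" by (rule cauchy_schwarz)
      also have "\<dots> \<le> nrm J x * (?c * nrm J x)"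
        by (intro mult_left_mono nrm_act CG_mult_closed sa a) simp
      finally have "(nrm J (act a x))\<^sup>2 \<le> (sqrt ?c * nrm J x)\<^sup>2"
        using c by (simp add: power_mult_distrib power2_eq_square mult_ac)
      then show "nrm J (act a x) \<le> sqrt ?c * nrm J x"
        by (rule power2_le_imp_le) (use c in simp)
    qed (use c in simp)
    then show "(op_norm a)\<^sup>2 \<le> ?c"
      using power_mono[of "op_norm a" "sqrt ?c" 2] op_norm_nonneg[OF a] c by simp
  qed
  assume b: "b \<in> finsupp (carrier G)"
  show "op_norm (a \<otimes>\<^bsub>CG\<^esub> b) \<le> op_norm a * op_norm b" by (rule mu[OF a b])
  show "op_norm (\<lambda>x. a x + b x) \<le> op_norm a + op_norm b"
  proof (rule op_norm_le)
    fix x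
    show "nrm J (act (\<lambda>x. a x + b x) x) \<le> (op_norm a + op_norm b) * nrm J x"
      unfolding act_add[OF a b] using nrm_add[of J "act a x" "act b x"] nrm_act[OF a, of x] nrm_act[OF b, of x]
      by (simp add: distrib_right)
  qed (use op_norm_nonneg a b in simp)
qed

lemma ip_act_bound:
  assumes a: "a \<in> finsupp (carrier G)"
  shows "cmod (ip J (act a x) y) \<le> MN a * (nrm J x * nrm J y)"
proof -
  have "cmod (ip J (act a x) y) \<le> nrm J (act a x) * nrm J y" by (rule cauchy_schwarz)
  also have "\<dots> \<le> (op_norm a * nrm J x) * nrm J y" by (intro mult_right_mono nrm_act[OF a]) simp
  also have "\<dots> \<le> (MN a * nrm J x) * nrm J y"
    by (intro mult_right_mono cstar_seminorm_le_max op_norm_cstar_seminorm a) auto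
  finally show ?thesis by (simp add: mult.assoc)
qed

end

context group
begin

interpretation SA: seminormed_star_algebra CG MN
  by (rule seminormed_CG)

lemma CG_finsum:
  "finite F \<Longrightarrow> (\<And>k. k \<in> F \<Longrightarrow> f k \<in> finsupp (carrier G)) \<Longrightarrow> (\<Oplus>\<^bsub>CG\<^esub>k\<in>F. f k) = (\<lambda>x. \<Sum>k\<in>F. f k x)"
proof (induction F rule: finite_induct)
  case (insert k F)
  then show ?case by (simp add: SA.M.finsum_insert Pi_def)
qed simp

text \<open>A matrix over the group algebra that becomes of the form \<open>Y\<^sup>* Y\<close> in the C*-algebra is positive in every
  finite-dimensional representation. For the Cauchy sequences that represent \<open>Y\<close> the quadratic form is a sum of
  squared norms, and the form is continuous for the maximal norm.\<close>

theorem gram_positive: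
  fixes J :: "'i set" and n :: nat
  assumes rep: "unitary_rep G J U"
    and a: "\<And>k l. k < n \<Longrightarrow> l < n \<Longrightarrow> a k l \<in> finsupp (carrier G)"
    and y: "\<And>m k. m < n \<Longrightarrow> k < n \<Longrightarrow> y m k \<in> carrier SA.C"
    and eq: "\<And>k l. k < n \<Longrightarrow> l < n \<Longrightarrow>
      SA.emb (a k l) = SA.Q.coset (\<lambda>t. \<Oplus>\<^bsub>CG\<^esub>m\<in>{..<n}. star CG (y m k t) \<otimes>\<^bsub>CG\<^esub> y m l t)"
  shows "0 \<le> Re (\<Sum>k<n. \<Sum>l<n. lin_ext (a k l) (\<lambda>g. ip J (U g (v l)) (v k)))"
proof -
  interpret unitary_rep G J U by (rule rep)
  define z where "z k l t = (\<Oplus>\<^bsub>CG\<^esub>m\<in>{..<n}. star CG (y m k t) \<otimes>\<^bsub>CG\<^esub> y m l t)" for k l t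
  have yc: "y m k t \<in> finsupp (carrier G)" if "m < n" "k < n" for m k t
    using SA.C_in[OF y[OF that]] by simp
  have syc: "star CG (y m k t) \<otimes>\<^bsub>CG\<^esub> y m l t \<in> finsupp (carrier G)" if "m < n" "k < n" "l < n" for m k l t
    using that by (intro CG_mult_closed CG_star_closed yc)
  have zeq: "z k l t = (\<lambda>x. \<Sum>m<n. (star CG (y m k t) \<otimes>\<^bsub>CG\<^esub> y m l t) x)" if "k < n" "l < n" for k l t
    unfolding z_def using that syc by (intro CG_finsum) auto
  have zC: "z k l \<in> carrier SA.C" if "k < n" "l < n" for k l
  proof -
    have "(\<lambda>t. star CG (y m k t) \<otimes>\<^bsub>CG\<^esub> y m l t) \<in> carrier SA.C" if "m < n" for m
      using that \<open>k < n\<close> \<open>l < n\<close> by (intro SA.C_mult SA.C_star y)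
    then have c: "(\<Oplus>\<^bsub>SA.C\<^esub>m\<in>{..<n}. (\<lambda>t. star CG (y m k t) \<otimes>\<^bsub>CG\<^esub> y m l t)) \<in> carrier SA.C"
      and m: "\<And>m. m \<in> {..<n} \<Longrightarrow> (\<lambda>t. star CG (y m k t) \<otimes>\<^bsub>CG\<^esub> y m l t) \<in> carrier SA.C"
      by (auto intro!: SA.C.M.finsum_closed)
    have "(\<Oplus>\<^bsub>SA.C\<^esub>m\<in>{..<n}. (\<lambda>t. star CG (y m k t) \<otimes>\<^bsub>CG\<^esub> y m l t)) = z k l"
      using SA.C_finsum[of "{..<n}" "\<lambda>m t. star CG (y m k t) \<otimes>\<^bsub>CG\<^esub> y m l t", OF finite_lessThan m]
      unfolding z_def[abs_def] .
    then show ?thesis using c by simp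
  qed
  have zc: "z k l t \<in> finsupp (carrier G)" if "k < n" "l < n" for k l t
    using SA.C_in[OF zC[OF that]] by simp
  have null: "(\<lambda>t. MN (a k l \<ominus>\<^bsub>CG\<^esub> z k l t)) \<longlonglongrightarrow> 0" if kl: "k < n" "l < n" for k l
  proof -
    have c: "(\<lambda>_. a k l) \<in> carrier SA.C" using SA.const_C a[OF kl] by simp
    have "SA.Q.coset (\<lambda>_. a k l) = SA.Q.coset (z k l)"
      using eq[OF kl] by (simp add: SA.emb_def z_def[abs_def])
    then have "(\<lambda>_. a k l) \<ominus>\<^bsub>SA.C\<^esub> z k l \<in> SA.N"
      using SA.Q.coset_eq_iff[OF c zC[OF kl]] by simp
    then show ?thesis using SA.N_D(2) by (simp add: SA.C_minus[OF c zC[OF kl]])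
  qed
  have lim: "(\<lambda>t. ip J (act (z k l t) (v l)) (v k)) \<longlonglongrightarrow> ip J (act (a k l) (v l)) (v k)"
    if kl: "k < n" "l < n" for k l
  proof -
    have "cmod (ip J (act (z k l t) (v l)) (v k) - ip J (act (a k l) (v l)) (v k)) \<le>
        norm (MN (a k l \<ominus>\<^bsub>CG\<^esub> z k l t)) * (nrm J (v l) * nrm J (v k))" for t
    proof -
      have eq: "a k l \<ominus>\<^bsub>CG\<^esub> z k l t = (\<lambda>x. a k l x + (-1) * z k l t x)"
        using a[OF kl] zc[OF kl] by (simp add: SA.minus_smult)
      have c: "a k l \<ominus>\<^bsub>CG\<^esub> z k l t \<in> finsupp (carrier G)"
        unfolding eq by (intro finsupp_add finsupp_smult a zc kl)
      have "ip J (act (a k l \<ominus>\<^bsub>CG\<^esub> z k l t) (v l)) (v k) =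
          ip J (act (a k l) (v l)) (v k) - ip J (act (z k l t) (v l)) (v k)"
        unfolding eq using ip_lincomb_left[of J 1 "act (a k l) (v l)" "-1" "act (z k l t) (v l)" "v k"]
        by (simp only: act_add[OF a[OF kl] finsupp_smult[OF zc[OF kl]]] act_smult[OF zc[OF kl]]) simp
      then show ?thesis using ip_act_bound[OF c, of "v l" "v k"] max_nonneg[OF c] by (simp add: norm_minus_commute)
    qed
    then have "(\<lambda>t. ip J (act (z k l t) (v l)) (v k) - ip J (act (a k l) (v l)) (v k)) \<longlonglongrightarrow> 0"
      by (intro tendsto_0_le[OF null[OF kl], where K = "nrm J (v l) * nrm J (v k)"] always_eventually) simp
    then show ?thesis by (simp add: LIM_zero_iff)
  qed
  have pos: "0 \<le> Re (\<Sum>k<n. \<Sum>l<n. ip J (act (z k l t) (v l)) (v k))" for t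
  proof -
    have "ip J (act (z k l t) (v l)) (v k) = (\<Sum>m<n. ip J (act (y m l t) (v l)) (act (y m k t) (v k)))"
      if kl: "k < n" "l < n" for k l
    proof -
      have "act (z k l t) (v l) = (\<lambda>i. \<Sum>m<n. act (star CG (y m k t) \<otimes>\<^bsub>CG\<^esub> y m l t) (v l) i)"
      proof -
        have act_sum: "act (\<lambda>x. \<Sum>m\<in>F. f m x) w = (\<lambda>i. \<Sum>m\<in>F. act (f m) w i)"
          if "finite F" "\<And>m. m \<in> F \<Longrightarrow> f m \<in> finsupp (carrier G)" for F :: "nat set" and f w
          using that
        proof (induction F rule: finite_induct)
          case empty
          then show ?case by (simp add: act_def lin_ext_def)
        next
          case (insert m F)
          then show ?case using act_add[OF _ finsupp_sum, of "f m" F f] by simp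
        qed
        show ?thesis unfolding zeq[OF kl] by (rule act_sum) (use syc kl in auto)
      qed
      then have "ip J (act (z k l t) (v l)) (v k) =
          (\<Sum>m<n. ip J (act (star CG (y m k t)) (act (y m l t) (v l))) (v k))"
        using kl by (simp add: ip_sum_left act_mult CG_star_closed yc)
      also have "\<dots> = (\<Sum>m<n. ip J (act (y m l t) (v l)) (act (y m k t) (v k)))"
        using kl by (intro sum.cong) (auto simp: act_star CG_star_closed CG_star_star yc)
      finally show ?thesis .
    qed
    then have "(\<Sum>k<n. \<Sum>l<n. ip J (act (z k l t) (v l)) (v k)) =
        (\<Sum>k<n. \<Sum>l<n. \<Sum>m<n. ip J (act (y m l t) (v l)) (act (y m k t) (v k)))"
      by simp
    also have "\<dots> = (\<Sum>k<n. \<Sum>m<n. \<Sum>l<n. ip J (act (y m l t) (v l)) (act (y m k t) (v k)))"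
      by (intro sum.cong refl sum.swap)
    also have "\<dots> = (\<Sum>m<n. \<Sum>k<n. \<Sum>l<n. ip J (act (y m l t) (v l)) (act (y m k t) (v k)))"
      by (rule sum.swap)
    also have "\<dots> = (\<Sum>m<n. ip J (\<lambda>i. \<Sum>l<n. act (y m l t) (v l) i) (\<lambda>i. \<Sum>k<n. act (y m k t) (v k) i))"
      unfolding ip_sum_right ip_sum_left ..
    also have "Re \<dots> \<ge> 0"
      unfolding ip_self_nrm by (auto intro!: sum_nonneg)
    finally show ?thesis .
  qed
  have "(\<lambda>t. Re (\<Sum>k<n. \<Sum>l<n. ip J (act (z k l t) (v l)) (v k))) \<longlonglongrightarrow>
      Re (\<Sum>k<n. \<Sum>l<n. ip J (act (a k l) (v l)) (v k))"
    by (intro tendsto_Re tendsto_sum lim) auto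
  then have "0 \<le> Re (\<Sum>k<n. \<Sum>l<n. ip J (act (a k l) (v l)) (v k))"
    using pos by (intro LIMSEQ_le_const) auto
  then show ?thesis by (simp only: ip_act_left)
qed

end

section \<open>Positive matrices over a free product of cyclic groups\<close>

lemma lin_ext_sum:
  "finite S \<Longrightarrow> (\<And>k. k \<in> S \<Longrightarrow> f k \<in> finsupp A) \<Longrightarrow>
    lin_ext (\<lambda>x. \<Sum>k\<in>S. f k x) F = (\<Sum>k\<in>S. lin_ext (f k) F)"
proof (induction S rule: finite_induct)
  case empty
  show ?case by (simp add: lin_ext_def)
next
  case (insert k S)
  have "(\<lambda>x. \<Sum>k\<in>S. f k x) \<in> finsupp A"
    using insert by (intro finsupp_sum) auto
  then show ?case using insert lin_ext_add[of "f k" A] by simp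
qed

lemma zeta_pow: "zeta K ^ g = cis (2 * pi * real g / real K)"
  by (simp add: zeta_def DeMoivre mult_ac)

lemma zeta_pow_inj:
  assumes "g < K" "h < K" "zeta K ^ g = zeta K ^ h"
  shows "g = h"
  using bij_betw_imp_inj_on[OF bij_betw_roots_unity[of K]] assms
  by (auto simp: zeta_pow dest: inj_onD)

lemma cnj_zeta_pow: "K > 0 \<Longrightarrow> (cnj (zeta K) ^ j) ^ K = 1"
proof -
  assume K: "K > 0"
  have "(cnj (zeta K) ^ j) ^ K = cnj ((zeta K ^ K) ^ j)"
    unfolding power_mult[symmetric] complex_cnj_power by (simp add: mult.commute)
  then show ?thesis using zeta_pow_order[OF K] by simp
qed

lemma zeta_orthogonal:
  assumes K: "g < K" "h < K"
  shows "(\<Sum>j<K. zeta K ^ (j * g) * cnj (zeta K) ^ (j * h)) = (if g = h then of_nat K else 0)"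
proof -
  define x where "x = zeta K ^ g * cnj (zeta K) ^ h"
  have pow: "zeta K ^ (j * g) * cnj (zeta K) ^ (j * h) = x ^ j" for j
    by (simp add: x_def power_mult_distrib mult.commute[of j] power_mult)
  have zz: "zeta K ^ m * cnj (zeta K) ^ m = 1" for m
    using zeta_cnj[of K] by (simp flip: power_mult_distrib)
  have xK: "x ^ K = 1"
  proof -
    have "(zeta K ^ g) ^ K = (zeta K ^ K) ^ g" by (simp add: power_mult[symmetric] mult.commute)
    then show ?thesis
      unfolding x_def power_mult_distrib using zeta_pow_order[of K] cnj_zeta_pow[of K h] K by simp
  qed
  show ?thesis
  proof (cases "g = h")
    case True
    then show ?thesis unfolding pow using zz[of g] by (simp add: x_def)
  next
    case False
    have "x \<noteq> 1"
    proof
      assume "x = 1"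
      then have "zeta K ^ h = zeta K ^ g * (zeta K ^ h * cnj (zeta K) ^ h)"
        by (simp add: x_def mult_ac)
      then show False using zz zeta_pow_inj[OF K] False by simp
    qed
    then show ?thesis unfolding pow using False xK by (simp add: geometric_sum)
  qed
qed

context cyclic_free_product
begin

sublocale FPG: group FP
  by (rule group_free_product)

definition letter :: "'i \<Rightarrow> nat \<Rightarrow> ('i \<times> int) list" where
  "letter i g = (if g = 0 then [] else [(i, int g)])"

lemma letter_closed: "i \<in> I \<Longrightarrow> g < K i \<Longrightarrow> letter i g \<in> carrier FP"
  by (auto simp: letter_def free_product_carrier_Nil free_product_carrier_Cons carrier_integer_mod_group)

lemma letter_mult:
  assumes "g < K i" "h < K i"
  shows "letter i g \<otimes>\<^bsub>FP\<^esub> letter i h = letter i ((g + h) mod K i)"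
proof -
  have "(int g + int h) mod int (K i) = int ((g + h) mod K i)" by (simp add: zmod_int)
  then show ?thesis using assms by (auto simp: letter_def free_product_mult)
qed

lemma letter_inv:
  assumes "i \<in> I" "g < K i"
  shows "inv\<^bsub>FP\<^esub> (letter i g) = letter i ((K i - g) mod K i)"
proof (rule FPG.inv_equality)
  show "letter i ((K i - g) mod K i) \<otimes>\<^bsub>FP\<^esub> letter i g = \<one>\<^bsub>FP\<^esub>"
    using assms by (subst letter_mult) (auto simp: mod_simps free_product_one letter_def)
qed (use assms in \<open>auto intro!: letter_closed\<close>)

text \<open>The minimal projections of the group algebra of the cyclic factor \<open>i\<close>.\<close>

definition proj :: "'i \<Rightarrow> nat \<Rightarrow> ('i \<times> int) list \<Rightarrow> complex" where
  "proj i j = (\<lambda>w. (1 / of_nat (K i)) * (\<Sum>g<K i. cnj (zeta (K i)) ^ (j * g) * delta (letter i g) w))"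

definition letters :: "('i \<times> int) list set" where
  "letters = (\<Union>i\<in>I. letter i ` {..<K i})"

lemma letters_closed: "letters \<subseteq> carrier FP"
  using letter_closed by (auto simp: letters_def)

lemma finsupp_mono: "A \<subseteq> B \<Longrightarrow> finsupp A \<subseteq> finsupp B"
  by (auto simp: finsupp_def)

lemma proj_letters: "i \<in> I \<Longrightarrow> proj i j \<in> finsupp letters"
  unfolding proj_def
  by (intro finsupp_smult finsupp_sum finsupp_delta) (auto simp: letters_def)

lemma proj_closed: "i \<in> I \<Longrightarrow> proj i j \<in> finsupp (carrier FP)"
  using proj_letters finsupp_mono[OF letters_closed] by blast

lemma lin_ext_proj:
  assumes "i \<in> I"
  shows "lin_ext (proj i j) F = (1 / of_nat (K i)) * (\<Sum>g<K i. cnj (zeta (K i)) ^ (j * g) * F (letter i g))"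
proof -
  have d: "delta (letter i g) \<in> finsupp (carrier FP)" if "g < K i" for g
    by (rule finsupp_delta[OF letter_closed[OF assms that]])
  let ?t = "\<lambda>g w. cnj (zeta (K i)) ^ (j * g) * delta (letter i g) w"
  have t: "?t g \<in> finsupp (carrier FP)" if "g \<in> {..<K i}" for g
    by (rule finsupp_smult[OF d]) (use that in simp)
  have "lin_ext (proj i j) F = (1 / of_nat (K i)) * lin_ext (\<lambda>w. \<Sum>g<K i. ?t g w) F"
    unfolding proj_def by (rule lin_ext_smult) (rule finsupp_sum[OF finite_lessThan t])
  also have "lin_ext (\<lambda>w. \<Sum>g<K i. ?t g w) F = (\<Sum>g<K i. lin_ext (?t g) F)"
    by (rule lin_ext_sum[OF finite_lessThan t])
  also have "\<dots> = (\<Sum>g<K i. cnj (zeta (K i)) ^ (j * g) * F (letter i g))"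
    by (intro sum.cong refl) (subst lin_ext_smult[OF d], simp_all add: lin_ext_delta)
  finally show ?thesis .
qed

text \<open>Fourier inversion on the cyclic group: the generator is the spectral sum of its projections. For
  \<open>g = 0\<close> it says that the projections of each factor sum to the unit.\<close>

lemma proj_dft:
  assumes "i \<in> I" "g < K i"
  shows "(\<Sum>j<K i. zeta (K i) ^ (j * g) * lin_ext (proj i j) F) = F (letter i g)"
proof -
  have "(\<Sum>j<K i. zeta (K i) ^ (j * g) * lin_ext (proj i j) F) =
      (1 / of_nat (K i)) * (\<Sum>j<K i. \<Sum>h<K i. zeta (K i) ^ (j * g) * cnj (zeta (K i)) ^ (j * h) * F (letter i h))"
    unfolding lin_ext_proj[OF assms(1)] by (simp add: sum_distrib_left mult_ac)
  also have "\<dots> = (1 / of_nat (K i)) * (\<Sum>h<K i. \<Sum>j<K i. zeta (K i) ^ (j * g) * cnj (zeta (K i)) ^ (j * h) * F (letter i h))"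
    by (subst sum.swap) simp
  also have "\<dots> = (1 / of_nat (K i)) * (\<Sum>h<K i. if h = g then of_nat (K i) * F (letter i h) else 0)"
    using zeta_orthogonal[OF assms(2)] by (intro arg_cong[of _ _ "(*) _"] sum.cong) (auto simp flip: sum_distrib_right)
  also have "\<dots> = F (letter i g)" using assms by (simp add: sum.delta)
  finally show ?thesis .
qed

lemma proj_star:
  assumes i: "i \<in> I"
  shows "star FPG.CG (proj i j) = proj i j"
proof (rule FPG.CG_eqI)
  fix F
  define c where "c = cnj (zeta (K i)) ^ j"
  have cK: "c ^ K i = 1"
    unfolding c_def by (rule cnj_zeta_pow[OF K_pos[OF i]])
  have cc: "c ^ g * cnj c ^ g = 1" for g
    using zeta_cnj[of "K i"] unfolding c_def
    by (simp add: power_mult[symmetric] power_mult_distrib[symmetric] mult.commute)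
  have "(\<Sum>g<K i. cnj c ^ g * F (inv\<^bsub>FP\<^esub> (letter i g))) = (\<Sum>g<K i. c ^ g * F (letter i g))"
  proof (rule sum.reindex_bij_witness[of _ "\<lambda>g. (K i - g) mod K i" "\<lambda>g. (K i - g) mod K i"])
    fix g assume "g \<in> {..<K i}"
    then have g: "g < K i" by simp
    have inv: "(K i - (K i - g) mod K i) mod K i = g" using g by (cases "g = 0") auto
    then show "(K i - (K i - g) mod K i) mod K i = g" "(K i - (K i - g) mod K i) mod K i = g" by auto
    show "(K i - g) mod K i \<in> {..<K i}" "(K i - g) mod K i \<in> {..<K i}" using g by auto
    have "c ^ ((K i - g) mod K i) * c ^ g = 1"
      using g cK by (cases "g = 0") (auto simp flip: power_add)
    then have "c ^ ((K i - g) mod K i) * c ^ g * cnj c ^ g = cnj c ^ g" by simp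
    then have "c ^ ((K i - g) mod K i) = cnj c ^ g" unfolding mult.assoc cc by simp
    then show "c ^ ((K i - g) mod K i) * F (letter i ((K i - g) mod K i)) = cnj c ^ g * F (inv\<^bsub>FP\<^esub> (letter i g))"
      using letter_inv[OF i g] by simp
  qed
  then show "lin_ext (star FPG.CG (proj i j)) F = lin_ext (proj i j) F"
    unfolding FPG.lin_ext_star[OF proj_closed[OF i]] lin_ext_proj[OF i] power_mult c_def[symmetric] by simp
qed (use i in \<open>auto intro!: proj_closed FPG.CG_star_closed\<close>)

lemma proj_idem:
  assumes i: "i \<in> I"
  shows "proj i j \<otimes>\<^bsub>FPG.CG\<^esub> proj i j = proj i j"
proof (rule FPG.CG_eqI)
  fix F
  define c where "c = cnj (zeta (K i)) ^ j"
  have cK: "c ^ K i = 1"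
    unfolding c_def by (rule cnj_zeta_pow[OF K_pos[OF i]])
  have cmod: "c ^ (m mod K i) = c ^ m" for m
  proof -
    have "c ^ m = c ^ (m mod K i + K i * (m div K i))" by simp
    also have "\<dots> = c ^ (m mod K i)" unfolding power_add power_mult cK by simp
    finally show ?thesis by simp
  qed
  have shift: "(\<Sum>h<K i. c ^ g * (c ^ h * F (letter i g \<otimes>\<^bsub>FP\<^esub> letter i h))) = (\<Sum>m<K i. c ^ m * F (letter i m))"
    if g: "g < K i" for g
  proof (rule sum.reindex_bij_witness[of _ "\<lambda>m. (m + (K i - g)) mod K i" "\<lambda>h. (g + h) mod K i"])
    fix h assume "h \<in> {..<K i}"
    then have h: "h < K i" by simp
    have "((g + h) mod K i + (K i - g)) mod K i = (g + h + (K i - g)) mod K i" by (simp add: mod_simps)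
    also have "g + h + (K i - g) = h + K i" using g by simp
    finally show "((g + h) mod K i + (K i - g)) mod K i = h" using h by simp
    show "c ^ ((g + h) mod K i) * F (letter i ((g + h) mod K i)) = c ^ g * (c ^ h * F (letter i g \<otimes>\<^bsub>FP\<^esub> letter i h))"
      unfolding letter_mult[OF g h] cmod by (simp add: power_add)
    have "(g + (h + (K i - g)) mod K i) mod K i = (g + (h + (K i - g))) mod K i" by (simp add: mod_simps)
    also have "g + (h + (K i - g)) = h + K i" using g by simp
    finally show "(g + (h + (K i - g)) mod K i) mod K i = h" using h by simp
  qed (use g in auto)
  have "lin_ext (proj i j \<otimes>\<^bsub>FPG.CG\<^esub> proj i j) F =
      (1 / of_nat (K i)) * ((1 / of_nat (K i)) * (\<Sum>g<K i. \<Sum>h<K i. c ^ g * (c ^ h * F (letter i g \<otimes>\<^bsub>FP\<^esub> letter i h))))"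
    unfolding FPG.lin_ext_mult[OF proj_closed[OF i] proj_closed[OF i]] lin_ext_proj[OF i] power_mult c_def[symmetric]
    by (simp add: sum_distrib_left mult_ac)
  also have "(\<Sum>g<K i. \<Sum>h<K i. c ^ g * (c ^ h * F (letter i g \<otimes>\<^bsub>FP\<^esub> letter i h))) =
      of_nat (K i) * (\<Sum>m<K i. c ^ m * F (letter i m))"
    using shift by simp
  finally show "lin_ext (proj i j \<otimes>\<^bsub>FPG.CG\<^esub> proj i j) F = lin_ext (proj i j) F"
    using K_pos[OF i] unfolding lin_ext_proj[OF i] power_mult c_def[symmetric] by simp
qed (use i in \<open>auto intro!: proj_closed FPG.CG_mult_closed\<close>)

lemma proj_at_one: assumes i: "i \<in> I" shows "proj i j [] = 1 / of_nat (K i)"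
proof -
  have "(\<Sum>g<K i. cnj (zeta (K i)) ^ (j * g) * delta (letter i g) []) = (\<Sum>g<K i. if g = 0 then 1 else 0)"
    by (intro sum.cong) (auto simp: letter_def)
  then show ?thesis using K_pos[OF i] by (simp add: proj_def sum.delta)
qed

lemma word_rep_unitary:
  assumes W: "\<And>i. i \<in> I \<Longrightarrow> unitary_op J (W i) (W' i)"
    and WK: "\<And>i x. i \<in> I \<Longrightarrow> (W i ^^ K i) x = x"
  shows "unitary_rep FP J (word_rep W)"
proof (intro unitary_rep.intro FPG.is_group unitary_rep_axioms.intro)
  have pow: "lin_op (W i ^^ n) \<and> (\<forall>x y. ip J ((W i ^^ n) x) ((W i ^^ n) y) = ip J x y)" if "i \<in> I" for i n
  proof (induction n)
    case 0
    show ?case by (simp add: lin_op_def)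
  next
    case (Suc n)
    then show ?case using W[OF that] unitary_ip[OF W[OF that]] by (simp add: lin_op_def unitary_op_def)
  qed
  have "lin_op (word_rep W g) \<and> (\<forall>x y. ip J (word_rep W g x) (word_rep W g y) = ip J x y)"
    if "g \<in> carrier FP" for g
    using that
  proof (induction g)
    case Nil
    show ?case by (simp add: lin_op_def)
  next
    case (Cons a g)
    obtain i h where a: "a = (i, h)" by (cases a)
    have "i \<in> I" "g \<in> carrier FP" using Cons.prems by (auto simp: a free_product_carrier_Cons)
    then show ?case using Cons.IH pow[of i "nat h"] by (simp add: a lin_op_def)
  qed
  then show "lin_op (word_rep W g)" "ip J (word_rep W g x) (word_rep W g y) = ip J x y"
    if "g \<in> carrier FP" for g x y
    using that by auto
  show "word_rep W (g \<otimes>\<^bsub>FP\<^esub> h) x = word_rep W g (word_rep W h x)"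
    if "g \<in> carrier FP" "h \<in> carrier FP" for g h x
    using word_rep_mult[OF WK that] by simp
  show "word_rep W \<one>\<^bsub>FP\<^esub> x = x" for x by (simp add: free_product_one)
qed

lemma word_rep_letter: "word_rep W (letter i g) x = (W i ^^ g) x"
  by (simp add: letter_def)

interpretation SA: seminormed_star_algebra FPG.CG FPG.MN
  by (rule FPG.seminormed_CG)

text \<open>The key step. Project \<open>a\<close> onto the cone of all \<open>\<Sum>s. B s \<otimes> proj s\<close> and let \<open>d\<close> be the residual. Up to sign,
  the functional of \<open>d\<close> takes positive values \<open>E i j\<close> on the projections. For each factor these sum to its
  value at the unit, which is the same for all factors. So the \<open>E i j\<close> have a simultaneous dilation,
  which is a representation of the free product, and in it the quadratic form of \<open>a\<close> has
  the real part \<open>- \<parallel>d\<parallel>\<^sup>2\<close>. As \<open>a\<close> is positive in every representation, \<open>d = 0\<close>.\<close>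

theorem positive_decomposition:
  fixes n :: nat
  assumes I: "finite I" "I \<noteq> {}"
    and a: "\<And>k l. k < n \<Longrightarrow> l < n \<Longrightarrow> a k l \<in> finsupp letters"
    and herm: "\<And>k l. k < n \<Longrightarrow> l < n \<Longrightarrow> star FPG.CG (a k l) = a l k"
    and y: "\<And>m k. m < n \<Longrightarrow> k < n \<Longrightarrow> y m k \<in> carrier SA.C"
    and eq: "\<And>k l. k < n \<Longrightarrow> l < n \<Longrightarrow> SA.emb (a k l) =
      SA.Q.coset (\<lambda>t. \<Oplus>\<^bsub>FPG.CG\<^esub>m\<in>{..<n}. star FPG.CG (y m k t) \<otimes>\<^bsub>FPG.CG\<^esub> y m l t)"
  shows "\<exists>B. (\<forall>i\<in>I. \<forall>j<K i. psd n (B (i, j))) \<and>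
    (\<forall>k<n. \<forall>l<n. a k l = (\<lambda>w. \<Sum>s\<in>Sigma I (\<lambda>i. {..<K i}). B s k l * proj (fst s) (snd s) w))"
proof -
  define S where "S = Sigma I (\<lambda>i. {..<K i})"
  define e where "e s = proj (fst s) (snd s)" for s
  have finS: "finite S" using I by (simp add: S_def)
  have finL: "finite letters" using I by (simp add: letters_def)
  have nil: "[] \<in> letters" using I K_pos by (force simp: letters_def letter_def)
  have eI: "e s \<in> finsupp letters" "e s \<in> finsupp (carrier FP)" if "s \<in> S" for s
    using that proj_letters proj_closed by (auto simp: S_def e_def)
  have trace: "0 < Re (e s []) \<and> Im (e s []) = 0" if "s \<in> S" for s
    using that K_pos by (auto simp: S_def e_def proj_at_one)
  have toL: "lin_ext f F = (\<Sum>g\<in>letters. f g * F g)" if "f \<in> finsupp letters" for f F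
    using finL by (rule lin_ext_eq_sum) (use finsuppD(2)[OF that] in auto)
  obtain B d where B: "\<And>s. s \<in> S \<Longrightarrow> psd n (B s)"
    and d: "d = (\<lambda>k l g. a k l g - (\<Sum>s\<in>S. B s k l * e s g))"
    and cone: "\<And>s x. s \<in> S \<Longrightarrow>
      Re (\<Sum>k<n. \<Sum>l<n. \<Sum>g\<in>letters. x k * cnj (x l) * (e s g * cnj (d k l g))) \<le> 0"
    and orth: "Re (\<Sum>k<n. \<Sum>l<n. \<Sum>g\<in>letters. cnj (d k l g) * a k l g) =
      (\<Sum>k<n. \<Sum>l<n. \<Sum>g\<in>letters. (cmod (d k l g))\<^sup>2)"
  proof (rule psd_cone_projection[where a = a and e = e and n = n and S = S and \<Gamma> = letters and u = "[]"])
    show "0 < Re (e s []) \<and> Im (e s []) = 0" if "s \<in> S" for s by (rule trace[OF that])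
  qed (rule finL finS nil that; assumption)+
  have dherm: "cnj (d k l (inv\<^bsub>FP\<^esub> w)) = d l k w" if kl: "k < n" "l < n" and w: "w \<in> carrier FP" for k l w
  proof -
    have "cnj (a k l (inv\<^bsub>FP\<^esub> w)) = a l k w"
      using fun_cong[OF herm[OF kl], of w] w by (simp add: FPG.CG_star)
    moreover have "cnj (e s (inv\<^bsub>FP\<^esub> w)) = e s w" if "s \<in> S" for s
      using fun_cong[OF proj_star[of "fst s" "snd s"], of w] w that by (auto simp: FPG.CG_star e_def S_def)
    moreover have "cnj (B s k l) = B s l k" if "s \<in> S" for s
      using psd_hermitian[OF B[OF that] kl] .
    ultimately show ?thesis by (simp add: d)
  qed
  define E where "E i j k l = - lin_ext (proj i j) (\<lambda>g. cnj (d l k g))" for i j k l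
  have Epsd: "psd n (E i j)" if i: "i \<in> I" and j: "j < K i" for i j
    unfolding psd_def
  proof (intro conjI allI impI)
    have s: "(i, j) \<in> S" using i j by (simp add: S_def)
    fix k l assume kl: "k < n" "l < n"
    have "lin_ext (proj i j) (\<lambda>g. cnj (d k l g)) = cnj (lin_ext (proj i j) (\<lambda>g. d k l (inv\<^bsub>FP\<^esub> g)))"
      using FPG.lin_ext_star[OF proj_closed[OF i], of j "\<lambda>g. cnj (d k l g)"] by (simp add: proj_star[OF i])
    also have "lin_ext (proj i j) (\<lambda>g. d k l (inv\<^bsub>FP\<^esub> g)) = lin_ext (proj i j) (\<lambda>g. cnj (d l k g))"
      unfolding lin_ext_def
    proof (intro sum.cong refl)
      fix g assume "g \<in> {g. proj i j g \<noteq> 0}"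
      then have "g \<in> carrier FP" using finsuppD(2)[OF proj_closed[OF i]] by blast
      from dherm[OF kl this] have "d k l (inv\<^bsub>FP\<^esub> g) = cnj (d l k g)" by (metis complex_cnj_cnj)
      then show "proj i j g * d k l (inv\<^bsub>FP\<^esub> g) = proj i j g * cnj (d l k g)" by simp
    qed
    finally show "cnj (E i j k l) = E i j l k" by (simp add: E_def)
  next
    have s: "(i, j) \<in> S" using i j by (simp add: S_def)
    fix x
    have "(\<Sum>k<n. \<Sum>l<n. x k * cnj (x l) * E i j k l) =
      - (\<Sum>k<n. \<Sum>l<n. \<Sum>g\<in>letters. cnj (x l) * cnj (cnj (x k)) * (e (i, j) g * cnj (d l k g)))"
      unfolding E_def toL[OF proj_letters[OF i]]
      by (simp add: e_def sum_negf sum_distrib_left mult_ac)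
    also have "(\<Sum>k<n. \<Sum>l<n. \<Sum>g\<in>letters. cnj (x l) * cnj (cnj (x k)) * (e (i, j) g * cnj (d l k g))) =
      (\<Sum>k<n. \<Sum>l<n. \<Sum>g\<in>letters. cnj (x k) * cnj (cnj (x l)) * (e (i, j) g * cnj (d k l g)))"
      by (rule sum.swap)
    finally show "0 \<le> Re (\<Sum>k<n. \<Sum>l<n. x k * cnj (x l) * E i j k l)"
      using cone[OF s, of "\<lambda>k. cnj (x k)"] by simp
  qed
  \<comment> \<open>the dilation reproduces the functional of the residual on every letter\<close>
  have dft: "(\<Sum>j<K i. zeta (K i) ^ (j * g) * E i j k l) = - cnj (d l k (letter i g))"
    if "i \<in> I" "g < K i" for i g k l
    unfolding E_def using proj_dft[OF that, of "\<lambda>g. cnj (d l k g)"] by (simp add: sum_negf)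
  have total: "(\<Sum>j<K i. E i j k l) = - cnj (d l k [])" if "i \<in> I" for i k l
    using dft[OF that K_pos[OF that], of k l] by (simp add: letter_def)
  obtain J :: "(nat \<times> nat) set" and W W' v where J: "finite J"
    and W: "\<And>i. i \<in> I \<Longrightarrow> unitary_op J (W i) (W' i)"
    and WK: "\<And>i x. i \<in> I \<Longrightarrow> (W i ^^ K i) x = x"
    and Wip: "\<And>i g k l. i \<in> I \<Longrightarrow> k < n \<Longrightarrow> l < n \<Longrightarrow>
      ip J ((W i ^^ g) (v k)) (v l) = (\<Sum>j<K i. zeta (K i) ^ (j * g) * E i j k l)"
  proof (rule simultaneous_dilation[where I = I and E = E and K = K and p = n and S = "\<lambda>k l. - cnj (d l k [])"])
  qed (rule I Epsd K_pos total that; assumption)+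
  have "0 \<le> Re (\<Sum>k<n. \<Sum>l<n. lin_ext (a k l) (\<lambda>g. ip J (word_rep W g (v l)) (v k)))"
  proof (rule FPG.gram_positive[where y = y, OF word_rep_unitary[OF W WK]])
    show "a k l \<in> finsupp (carrier FP)" if "k < n" "l < n" for k l
      using a[OF that] finsupp_mono[OF letters_closed] by (rule rev_subsetD)
  qed ((assumption | rule y eq; assumption)+)
  also have "(\<Sum>k<n. \<Sum>l<n. lin_ext (a k l) (\<lambda>g. ip J (word_rep W g (v l)) (v k))) =
    (\<Sum>k<n. \<Sum>l<n. \<Sum>g\<in>letters. - (cnj (d k l g) * a k l g))"
  proof (intro sum.cong refl)
    fix k l assume "k \<in> {..<n}" "l \<in> {..<n}"
    then have kl: "k < n" "l < n" by auto
    have "ip J (word_rep W g (v l)) (v k) = - cnj (d k l g)" if g: "g \<in> letters" for g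
    proof -
      obtain i h where "i \<in> I" "h < K i" "g = letter i h" using g by (auto simp: letters_def)
      then show ?thesis using Wip[of i l k h] kl dft[of i h l k] by (simp add: word_rep_letter)
    qed
    then show "lin_ext (a k l) (\<lambda>g. ip J (word_rep W g (v l)) (v k)) = (\<Sum>g\<in>letters. - (cnj (d k l g) * a k l g))"
      unfolding toL[OF a[OF kl]] by (intro sum.cong) auto
  qed
  also have "Re \<dots> = - (\<Sum>k<n. \<Sum>l<n. \<Sum>g\<in>letters. (cmod (d k l g))\<^sup>2)"
    unfolding orth[symmetric] by (simp add: sum_negf del: times_complex.simps)
  finally have le: "(\<Sum>k<n. \<Sum>l<n. \<Sum>g\<in>letters. (cmod (d k l g))\<^sup>2) \<le> 0" by simp
  have d0: "d k l g = 0" if kl: "k < n" "l < n" and g: "g \<in> letters" for k l g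
  proof -
    have "(cmod (d k l g))\<^sup>2 \<le> (\<Sum>g\<in>letters. (cmod (d k l g))\<^sup>2)"
      using finL g by (intro member_le_sum) auto
    also have "\<dots> \<le> (\<Sum>l<n. \<Sum>g\<in>letters. (cmod (d k l g))\<^sup>2)"
      using kl by (intro member_le_sum[of l _ "\<lambda>l. \<Sum>g\<in>letters. (cmod (d k l g))\<^sup>2"]) (auto intro!: sum_nonneg)
    also have "\<dots> \<le> (\<Sum>k<n. \<Sum>l<n. \<Sum>g\<in>letters. (cmod (d k l g))\<^sup>2)"
      using kl by (intro member_le_sum[of k _ "\<lambda>k. \<Sum>l<n. \<Sum>g\<in>letters. (cmod (d k l g))\<^sup>2"]) (auto intro!: sum_nonneg)
    finally have "(cmod (d k l g))\<^sup>2 \<le> 0" using le by linarith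
    then show ?thesis by simp
  qed
  have "a k l w = (\<Sum>s\<in>S. B s k l * e s w)" if kl: "k < n" "l < n" for k l w
  proof (cases "w \<in> letters")
    case True
    then show ?thesis using d0[OF kl True] by (simp add: d)
  next
    case False
    then have "a k l w = 0" "\<And>s. s \<in> S \<Longrightarrow> e s w = 0"
      using finsuppD(2)[OF a[OF kl], of w] finsuppD(2)[OF eI(1), of _ w] by auto
    then show ?thesis by simp
  qed
  then show ?thesis using B unfolding S_def e_def by (intro exI[of _ B]) (auto simp: fun_eq_iff)
qed

end

section \<open>Conic combinations of rank one matrices\<close>

context complex_module
begin

lemma smult_in [simp]: "x \<in> carrier V \<Longrightarrow> c \<odot> x \<in> carrier V"
  using smult_closed[of c x] by simp

lemma finsum_smult:
  assumes "finite F" "\<And>k. k \<in> F \<Longrightarrow> f k \<in> carrier V"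
  shows "c \<odot> (\<Oplus>k\<in>F. f k) = (\<Oplus>k\<in>F. c \<odot> f k)"
  using finsum_smult_ldistr[OF assms(1), of c f] assms(2) by auto

lemma finsum_scalars:
  assumes "finite F" "u \<in> carrier V"
  shows "(\<Oplus>k\<in>F. c k \<odot> u) = (\<Sum>k\<in>F. c k) \<odot> u"
  using assms
proof (induction F rule: finite_induct)
  case empty
  then show ?case using smult_l_null[of u] by simp
next
  case (insert k F)
  then show ?case using smult_l_distr[of "c k" "\<Sum>k\<in>F. c k" u] by (simp add: Pi_def)
qed

lemma finsum_Sigma:
  assumes "finite A" "\<And>x. x \<in> A \<Longrightarrow> finite (B x)" "\<And>x y. x \<in> A \<Longrightarrow> y \<in> B x \<Longrightarrow> f x y \<in> carrier V"
  shows "(\<Oplus>x\<in>A. \<Oplus>y\<in>B x. f x y) = (\<Oplus>z\<in>Sigma A B. f (fst z) (snd z))"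
  using assms
proof (induction A rule: finite_induct)
  case (insert a A)
  have S: "Sigma (insert a A) B = (\<lambda>y. (a, y)) ` B a \<union> Sigma A B" by auto
  have "(\<Oplus>z\<in>Sigma (insert a A) B. f (fst z) (snd z)) =
      (\<Oplus>z\<in>(\<lambda>y. (a, y)) ` B a. f (fst z) (snd z)) \<oplus> (\<Oplus>z\<in>Sigma A B. f (fst z) (snd z))"
    unfolding S using insert by (intro M.finsum_Un_disjoint) auto
  also have "(\<Oplus>z\<in>(\<lambda>y. (a, y)) ` B a. f (fst z) (snd z)) = (\<Oplus>y\<in>B a. f a y)"
    using insert.prems by (subst M.finsum_reindex) (auto simp: inj_on_def Pi_def)
  also have "(\<Oplus>z\<in>Sigma A B. f (fst z) (snd z)) = (\<Oplus>x\<in>A. \<Oplus>y\<in>B x. f x y)"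
    using insert by simp
  finally show ?case
    using insert by (subst M.finsum_insert) (auto intro!: M.finsum_closed simp: Pi_def)
qed simp

lemma finsum_swap:
  assumes "finite A" "finite B" "\<And>x y. x \<in> A \<Longrightarrow> y \<in> B \<Longrightarrow> f x y \<in> carrier V"
  shows "(\<Oplus>x\<in>A. \<Oplus>y\<in>B. f x y) = (\<Oplus>y\<in>B. \<Oplus>x\<in>A. f x y)"
  using assms(1,3)
proof (induction A rule: finite_induct)
  case empty
  then show ?case by simp
next
  case (insert a A)
  have "(\<Oplus>x\<in>insert a A. \<Oplus>y\<in>B. f x y) = (\<Oplus>y\<in>B. f a y) \<oplus> (\<Oplus>y\<in>B. \<Oplus>x\<in>A. f x y)"
    using insert by (subst M.finsum_insert) (auto intro!: M.finsum_closed)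
  also have "\<dots> = (\<Oplus>y\<in>B. f a y \<oplus> (\<Oplus>x\<in>A. f x y))"
    using insert by (intro M.finsum_addf[symmetric]) (auto intro!: M.finsum_closed)
  also have "\<dots> = (\<Oplus>y\<in>B. \<Oplus>x\<in>insert a A. f x y)"
    using insert by (intro M.finsum_cong' refl) (auto intro!: M.finsum_closed M.finsum_insert[symmetric])
  finally show ?case .
qed

end

text \<open>The compressions \<open>\<alpha> diag(us) \<alpha>\<^sup>*\<close> of the definition of \<^const>\<open>OMAX\<close>, written as sums of rank one matrices
  with coefficients in \<open>W\<close>. Sums over several index sets are joined more easily than lists and
  rectangular matrices.\<close>

definition conic :: "('a, 'm) star_space_scheme \<Rightarrow> 'a set \<Rightarrow> nat \<Rightarrow> 'a mat \<Rightarrow> bool" where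
  "conic V W n X \<longleftrightarrow> (\<exists>(N::nat) (b :: nat \<Rightarrow> nat \<Rightarrow> complex) u. (\<forall>m<N. u m \<in> W) \<and>
     X = mat n n (\<lambda>(i, j). \<Oplus>\<^bsub>V\<^esub>m\<in>{..<N}. (b m i * cnj (b m j)) \<odot>\<^bsub>V\<^esub> u m))"

lemma conicE:
  assumes "conic V W n X"
  obtains N :: nat and b :: "nat \<Rightarrow> nat \<Rightarrow> complex" and u where "\<And>m. m < N \<Longrightarrow> u m \<in> W"
    "X = mat n n (\<lambda>(i, j). \<Oplus>\<^bsub>V\<^esub>m\<in>{..<N}. (b m i * cnj (b m j)) \<odot>\<^bsub>V\<^esub> u m)"
  using assms by (auto simp: conic_def)

context complex_module
begin

lemma conicI:
  assumes F: "finite F" and W: "W \<subseteq> carrier V" and u: "\<And>m. m \<in> F \<Longrightarrow> u m \<in> W"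
    and X: "X \<in> carrier_mat n n"
    and eq: "\<And>i j. i < n \<Longrightarrow> j < n \<Longrightarrow> X $$ (i, j) = (\<Oplus>m\<in>F. (b m i * cnj (b m j)) \<odot> u m)"
  shows "conic V W n X"
proof -
  obtain h where h: "bij_betw h {..<card F} F"
    using ex_bij_betw_nat_finite[OF F] by (auto simp: atLeast0LessThan)
  have hF: "m < card F \<Longrightarrow> h m \<in> F" for m using bij_betwE[OF h] by auto
  have "X = mat n n (\<lambda>(i, j). \<Oplus>m\<in>{..<card F}. (b (h m) i * cnj (b (h m) j)) \<odot> u (h m))"
  proof (rule eq_matI)
    fix i j assume "i < dim_row (mat n n (\<lambda>(i, j). \<Oplus>m\<in>{..<card F}. (b (h m) i * cnj (b (h m) j)) \<odot> u (h m)))"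
      "j < dim_col (mat n n (\<lambda>(i, j). \<Oplus>m\<in>{..<card F}. (b (h m) i * cnj (b (h m) j)) \<odot> u (h m)))"
    then have ij: "i < n" "j < n" by auto
    have "(\<Oplus>m\<in>h ` {..<card F}. (b m i * cnj (b m j)) \<odot> u m) =
        (\<Oplus>m\<in>{..<card F}. (b (h m) i * cnj (b (h m) j)) \<odot> u (h m))"
      using h bij_betw_imp_surj_on[OF h]
      by (intro M.finsum_reindex) (auto simp: bij_betw_def intro!: smult_in W[THEN subsetD, OF u])
    then show "X $$ (i, j) = mat n n (\<lambda>(i, j). \<Oplus>m\<in>{..<card F}. (b (h m) i * cnj (b (h m) j)) \<odot> u (h m)) $$ (i, j)"
      using ij eq[OF ij] bij_betw_imp_surj_on[OF h] by simp
  qed (use X in auto)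
  then show ?thesis unfolding conic_def using u[OF hF]
    by (intro exI[of _ "card F"] exI[of _ "\<lambda>m. b (h m)"] exI[of _ "\<lambda>m. u (h m)"]) simp
qed

lemma compress_mdiag:
  assumes us: "set us \<subseteq> carrier V" and \<alpha>: "\<alpha> \<in> carrier_mat n (length us)"
  shows "compress V \<alpha> (mdiag V us) =
    mat n n (\<lambda>(i, j). \<Oplus>m\<in>{..<length us}. (\<alpha> $$ (i, m) * cnj (\<alpha> $$ (j, m))) \<odot> us ! m)"
proof (rule eq_matI)
  fix i j assume "i < dim_row (mat n n (\<lambda>(i, j). \<Oplus>m\<in>{..<length us}. (\<alpha> $$ (i, m) * cnj (\<alpha> $$ (j, m))) \<odot> us ! m))"
    "j < dim_col (mat n n (\<lambda>(i, j). \<Oplus>m\<in>{..<length us}. (\<alpha> $$ (i, m) * cnj (\<alpha> $$ (j, m))) \<odot> us ! m))"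
  then have ij: "i < n" "j < n" by auto
  have inner: "(\<Oplus>l\<in>{..<length us}. (\<alpha> $$ (i, k) * cnj (\<alpha> $$ (j, l))) \<odot> mdiag V us $$ (k, l)) =
      (\<alpha> $$ (i, k) * cnj (\<alpha> $$ (j, k))) \<odot> us ! k" if k: "k < length us" for k
  proof -
    have uk: "us ! k \<in> carrier V" using us k nth_mem by blast
    have "(\<Oplus>l\<in>{..<length us}. (\<alpha> $$ (i, k) * cnj (\<alpha> $$ (j, l))) \<odot> mdiag V us $$ (k, l)) =
        (\<Oplus>l\<in>{..<length us}. if k = l then (\<alpha> $$ (i, k) * cnj (\<alpha> $$ (j, l))) \<odot> us ! k else \<zero>)"
      using k uk smult_r_null[simplified]
      by (intro M.finsum_cong' refl) (auto simp: mdiag_def)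
    also have "\<dots> = (\<alpha> $$ (i, k) * cnj (\<alpha> $$ (j, k))) \<odot> us ! k"
      using k uk by (intro M.finsum_singleton) auto
    finally show ?thesis .
  qed
  have "(\<Oplus>k\<in>{..<length us}. \<Oplus>l\<in>{..<length us}. (\<alpha> $$ (i, k) * cnj (\<alpha> $$ (j, l))) \<odot> mdiag V us $$ (k, l)) =
      (\<Oplus>m\<in>{..<length us}. (\<alpha> $$ (i, m) * cnj (\<alpha> $$ (j, m))) \<odot> us ! m)"
    using us by (intro M.finsum_cong' refl) (auto simp: inner intro!: smult_in dest: nth_mem)
  then show "compress V \<alpha> (mdiag V us) $$ (i, j) =
      mat n n (\<lambda>(i, j). \<Oplus>m\<in>{..<length us}. (\<alpha> $$ (i, m) * cnj (\<alpha> $$ (j, m))) \<odot> us ! m) $$ (i, j)"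
    using ij \<alpha> by (simp add: compress_def)
qed (use \<alpha> in \<open>auto simp: compress_def\<close>)

lemma conic_iff_compress:
  assumes W: "W \<subseteq> carrier V"
  shows "conic V W n X \<longleftrightarrow> (\<exists>us \<alpha>. set us \<subseteq> W \<and> \<alpha> \<in> carrier_mat n (length us) \<and> X = compress V \<alpha> (mdiag V us))"
proof
  assume "conic V W n X"
  then obtain N :: nat and b u where u: "\<And>m. m < N \<Longrightarrow> u m \<in> W"
    and X: "X = mat n n (\<lambda>(i, j). \<Oplus>m\<in>{..<N}. (b m i * cnj (b m j)) \<odot> u m)"
    by (rule conicE) (rule that)
  define us where "us = map u [0..<N]"
  define \<alpha> where "\<alpha> = mat n N (\<lambda>(i, m). b m i)"
  have us: "set us \<subseteq> W" "length us = N" using u by (auto simp: us_def)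
  have \<alpha>: "\<alpha> \<in> carrier_mat n (length us)" by (simp add: \<alpha>_def us)
  have "compress V \<alpha> (mdiag V us) = mat n n (\<lambda>(i, j). \<Oplus>m\<in>{..<N}. (\<alpha> $$ (i, m) * cnj (\<alpha> $$ (j, m))) \<odot> us ! m)"
    using compress_mdiag[OF _ \<alpha>] us W by auto
  also have "\<dots> = X" unfolding X
  proof (rule cong_mat[OF refl refl])
    fix i j assume ij: "i < n" "j < n"
    have "(\<Oplus>m\<in>{..<N}. (\<alpha> $$ (i, m) * cnj (\<alpha> $$ (j, m))) \<odot> us ! m) = (\<Oplus>m\<in>{..<N}. (b m i * cnj (b m j)) \<odot> u m)"
      using ij by (intro M.finsum_cong' refl) (auto simp: \<alpha>_def us_def intro!: smult_in W[THEN subsetD, OF u])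
    then show "(case (i, j) of (i, j) \<Rightarrow> \<Oplus>m\<in>{..<N}. (\<alpha> $$ (i, m) * cnj (\<alpha> $$ (j, m))) \<odot> us ! m) =
      (case (i, j) of (i, j) \<Rightarrow> \<Oplus>m\<in>{..<N}. (b m i * cnj (b m j)) \<odot> u m)" by simp
  qed
  finally show "\<exists>us \<alpha>. set us \<subseteq> W \<and> \<alpha> \<in> carrier_mat n (length us) \<and> X = compress V \<alpha> (mdiag V us)"
    using us \<alpha> by blast
next
  assume "\<exists>us \<alpha>. set us \<subseteq> W \<and> \<alpha> \<in> carrier_mat n (length us) \<and> X = compress V \<alpha> (mdiag V us)"
  then obtain us \<alpha> where us: "set us \<subseteq> W" "\<alpha> \<in> carrier_mat n (length us)" "X = compress V \<alpha> (mdiag V us)" by blast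
  then show "conic V W n X"
    using compress_mdiag[of us \<alpha> n] W unfolding conic_def
    by (intro exI[of _ "length us"] exI[of _ "\<lambda>m i. \<alpha> $$ (i, m)"] exI[of _ "\<lambda>m. us ! m"]) auto
qed

lemma conic_compress:
  assumes W: "W \<subseteq> carrier V" and X: "conic V W n X" and \<alpha>: "\<alpha> \<in> carrier_mat q n"
  shows "conic V W q (compress V \<alpha> X)"
proof -
  obtain N :: nat and b u where u: "\<And>m. m < N \<Longrightarrow> u m \<in> W"
    and X: "X = mat n n (\<lambda>(i, j). \<Oplus>m\<in>{..<N}. (b m i * cnj (b m j)) \<odot> u m)"
    using X by (rule conicE) (rule that)
  have uc: "u m \<in> carrier V" if "m < N" for m using u[OF that] W by auto
  show ?thesis
  proof (rule conicI[OF finite_lessThan W u])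
    show "compress V \<alpha> X \<in> carrier_mat q q" using \<alpha> by (simp add: compress_def)
    fix i j assume ij: "i < q" "j < q"
    let ?c = "\<lambda>k l. \<alpha> $$ (i, k) * cnj (\<alpha> $$ (j, l))"
    have "compress V \<alpha> X $$ (i, j) =
        (\<Oplus>k\<in>{..<n}. \<Oplus>l\<in>{..<n}. ?c k l \<odot> (\<Oplus>m\<in>{..<N}. (b m k * cnj (b m l)) \<odot> u m))"
      using ij \<alpha> uc unfolding compress_def X
      by (auto intro!: M.finsum_cong' M.finsum_closed)
    also have "\<dots> = (\<Oplus>k\<in>{..<n}. \<Oplus>l\<in>{..<n}. \<Oplus>m\<in>{..<N}. (?c k l * (b m k * cnj (b m l))) \<odot> u m)"
    proof (intro M.finsum_cong' refl)
      fix k l assume "k \<in> {..<n}" "l \<in> {..<n}"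
      have "?c k l \<odot> (\<Oplus>m\<in>{..<N}. (b m k * cnj (b m l)) \<odot> u m) =
          (\<Oplus>m\<in>{..<N}. ?c k l \<odot> ((b m k * cnj (b m l)) \<odot> u m))"
        using uc by (intro finsum_smult) auto
      also have "\<dots> = (\<Oplus>m\<in>{..<N}. (?c k l * (b m k * cnj (b m l))) \<odot> u m)"
        using uc smult_assoc1[simplified] by (intro M.finsum_cong' refl) auto
      finally show "?c k l \<odot> (\<Oplus>m\<in>{..<N}. (b m k * cnj (b m l)) \<odot> u m) =
        (\<Oplus>m\<in>{..<N}. (?c k l * (b m k * cnj (b m l))) \<odot> u m)" .
    qed (use uc in \<open>auto intro!: M.finsum_closed\<close>)
    also have "\<dots> = (\<Oplus>k\<in>{..<n}. \<Oplus>m\<in>{..<N}. \<Oplus>l\<in>{..<n}. (?c k l * (b m k * cnj (b m l))) \<odot> u m)"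
      using uc by (intro M.finsum_cong' refl finsum_swap) (auto intro!: M.finsum_closed)
    also have "\<dots> = (\<Oplus>m\<in>{..<N}. \<Oplus>k\<in>{..<n}. \<Oplus>l\<in>{..<n}. (?c k l * (b m k * cnj (b m l))) \<odot> u m)"
      using uc by (intro finsum_swap) (auto intro!: M.finsum_closed)
    also have "\<dots> = (\<Oplus>m\<in>{..<N}. (\<Sum>k<n. \<Sum>l<n. ?c k l * (b m k * cnj (b m l))) \<odot> u m)"
      using uc by (intro M.finsum_cong' refl) (auto simp: finsum_scalars)
    also have "\<dots> = (\<Oplus>m\<in>{..<N}. ((\<Sum>k<n. \<alpha> $$ (i, k) * b m k) * cnj (\<Sum>l<n. \<alpha> $$ (j, l) * b m l)) \<odot> u m)"
      by (simp add: sum_product mult_ac)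
    finally show "compress V \<alpha> X $$ (i, j) =
      (\<Oplus>m\<in>{..<N}. ((\<Sum>k<n. \<alpha> $$ (i, k) * b m k) * cnj (\<Sum>l<n. \<alpha> $$ (j, l) * b m l)) \<odot> u m)" .
  qed auto
qed

lemma conic_mono: "W \<subseteq> W' \<Longrightarrow> conic V W n X \<Longrightarrow> conic V W' n X"
  unfolding conic_def by blast

text \<open>The Archimedean closure of a cone is not enlarged by adding elements of its closure at level one. Write
  \<open>X + \<epsilon>/2\<close> with generators \<open>u m\<close> and coefficient vectors \<open>b m\<close>, and replace each \<open>u m\<close> by \<open>u m + \<delta>\<close>. The surplus
  \<open>\<delta> (\<Sum>m. b m b m\<^sup>*)\<close> is at most \<open>\<epsilon>/2\<close> for small \<open>\<delta>\<close>, and the positive scalar matrix that remains is a sum of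
  rank one matrices with coefficient \<open>\<one>\<close>.\<close>

lemma conic_almost_trans:
  assumes W: "W \<subseteq> carrier V" and one: "\<one> \<in> W" and X: "X \<in> mats V n"
    and almost: "\<And>\<epsilon>. \<epsilon> > 0 \<Longrightarrow> conic V W' n (madd V (munit V n (complex_of_real \<epsilon>)) X)"
    and W': "W' \<subseteq> carrier V"
    and gen: "\<And>u \<epsilon>. u \<in> W' \<Longrightarrow> \<epsilon> > 0 \<Longrightarrow> conic V W 1 (mat 1 1 (\<lambda>_. complex_of_real \<epsilon> \<odot> \<one> \<oplus> u))"
    and \<epsilon>: "\<epsilon> > 0"
  shows "conic V W n (madd V (munit V n (complex_of_real \<epsilon>)) X)"
proof -
  have onec: "\<one> \<in> carrier V" using one W by auto
  have Xc: "X $$ (i, j) \<in> carrier V" if "i < n" "j < n" for i j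
    using X elements_matI[of X n n i j, OF _ that refl] by (auto simp: mats_def)
  have Xd: "dim_row X = n" "dim_col X = n" using X by (auto simp: mats_def)
  define \<eta> where "\<eta> = \<epsilon> / 2"
  have \<eta>: "\<eta> > 0" using \<epsilon> by (simp add: \<eta>_def)
  obtain N :: nat and b u where u: "\<And>m. m < N \<Longrightarrow> u m \<in> W'"
    and XN: "madd V (munit V n (complex_of_real \<eta>)) X =
      mat n n (\<lambda>(i, j). \<Oplus>m\<in>{..<N}. (b m i * cnj (b m j)) \<odot> u m)"
    using almost[OF \<eta>] by (rule conicE) (rule that)
  have uc: "u m \<in> carrier V" if "m < N" for m using u[OF that] W' by auto
  define M where "M = (\<Sum>m<N. \<Sum>k<n. (cmod (b m k))\<^sup>2)"
  have M0: "M \<ge> 0" by (auto simp: M_def intro!: sum_nonneg)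
  define \<delta> where "\<delta> = \<eta> / (M + 1)"
  have \<delta>: "\<delta> > 0" "\<delta> * M \<le> \<eta>" using \<eta> M0 by (auto simp: \<delta>_def field_simps)
  \<comment> \<open>the scalar matrix that remains; positive by the Cauchy--Schwarz inequality\<close>
  define E where "E k l = (if k = l then complex_of_real \<eta> else 0) - complex_of_real \<delta> * (\<Sum>m<N. b m k * cnj (b m l))" for k l
  have "psd n E"
    unfolding psd_def
  proof (intro conjI allI impI)
    show "cnj (E k l) = E l k" for k l by (simp add: E_def mult.commute)
    fix x :: "nat \<Rightarrow> complex"
    have 1: "(\<Sum>k<n. \<Sum>l<n. x k * cnj (x l) * (if k = l then complex_of_real \<eta> else 0)) =
        complex_of_real (\<eta> * (\<Sum>k<n. (cmod (x k))\<^sup>2))"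
    proof -
      have "(\<Sum>l<n. x k * cnj (x l) * (if k = l then complex_of_real \<eta> else 0)) =
          complex_of_real \<eta> * complex_of_real ((cmod (x k))\<^sup>2)" if "k < n" for k
      proof -
        have "(\<Sum>l<n. x k * cnj (x l) * (if k = l then complex_of_real \<eta> else 0)) =
            (\<Sum>l<n. if l = k then x k * cnj (x k) * complex_of_real \<eta> else 0)"
          by (intro sum.cong) auto
        then show ?thesis using that unfolding complex_norm_square by (simp add: sum.delta)
      qed
      then show ?thesis by (simp add: sum_distrib_left)
    qed
    have 2: "(\<Sum>k<n. \<Sum>l<n. x k * cnj (x l) * (\<Sum>m<N. b m k * cnj (b m l))) =
        complex_of_real (\<Sum>m<N. (cmod (\<Sum>k<n. x k * b m k))\<^sup>2)"
    proof -
      have "(\<Sum>k<n. \<Sum>l<n. x k * cnj (x l) * (\<Sum>m<N. b m k * cnj (b m l))) =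
          (\<Sum>k<n. \<Sum>l<n. \<Sum>m<N. x k * cnj (x l) * (b m k * cnj (b m l)))"
        by (simp add: sum_distrib_left)
      also have "\<dots> = (\<Sum>k<n. \<Sum>m<N. \<Sum>l<n. x k * cnj (x l) * (b m k * cnj (b m l)))"
        by (intro sum.cong refl sum.swap)
      also have "\<dots> = (\<Sum>m<N. \<Sum>k<n. \<Sum>l<n. x k * cnj (x l) * (b m k * cnj (b m l)))"
        by (rule sum.swap)
      finally show ?thesis unfolding sum_rank_one by simp
    qed
    have "(\<Sum>m<N. (cmod (\<Sum>k<n. x k * b m k))\<^sup>2) \<le> (\<Sum>m<N. (\<Sum>k<n. (cmod (x k))\<^sup>2) * (\<Sum>k<n. (cmod (b m k))\<^sup>2))"
    proof (rule sum_mono)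
      fix m
      have "cmod (\<Sum>k<n. x k * b m k) \<le> nrm {..<n} x * nrm {..<n} (\<lambda>k. cnj (b m k))"
        using cauchy_schwarz[of "{..<n}" x "\<lambda>k. cnj (b m k)"] by (simp add: ip_def)
      then have "(cmod (\<Sum>k<n. x k * b m k))\<^sup>2 \<le> (nrm {..<n} x * nrm {..<n} (\<lambda>k. cnj (b m k)))\<^sup>2"
        by (intro power_mono) auto
      then show "(cmod (\<Sum>k<n. x k * b m k))\<^sup>2 \<le> (\<Sum>k<n. (cmod (x k))\<^sup>2) * (\<Sum>k<n. (cmod (b m k))\<^sup>2)"
        by (simp add: power_mult_distrib nrm_def L2_set_def sum_nonneg)
    qed
    also have "\<dots> = (\<Sum>k<n. (cmod (x k))\<^sup>2) * M"
      by (simp add: M_def sum_distrib_left)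
    finally have "\<delta> * (\<Sum>m<N. (cmod (\<Sum>k<n. x k * b m k))\<^sup>2) \<le> \<delta> * ((\<Sum>k<n. (cmod (x k))\<^sup>2) * M)"
      using \<delta> by (intro mult_left_mono) auto
    also have "\<dots> = (\<delta> * M) * (\<Sum>k<n. (cmod (x k))\<^sup>2)" by (simp add: mult_ac)
    also have "\<dots> \<le> \<eta> * (\<Sum>k<n. (cmod (x k))\<^sup>2)"
      using \<delta> by (intro mult_right_mono sum_nonneg) auto
    finally have le: "\<delta> * (\<Sum>m<N. (cmod (\<Sum>k<n. x k * b m k))\<^sup>2) \<le> \<eta> * (\<Sum>k<n. (cmod (x k))\<^sup>2)" .
    have "(\<Sum>k<n. \<Sum>l<n. x k * cnj (x l) * E k l) =
        (\<Sum>k<n. \<Sum>l<n. x k * cnj (x l) * (if k = l then complex_of_real \<eta> else 0)) -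
        complex_of_real \<delta> * (\<Sum>k<n. \<Sum>l<n. x k * cnj (x l) * (\<Sum>m<N. b m k * cnj (b m l)))"
    proof -
      have "x k * cnj (x l) * E k l = x k * cnj (x l) * (if k = l then complex_of_real \<eta> else 0) -
          complex_of_real \<delta> * (x k * cnj (x l) * (\<Sum>m<N. b m k * cnj (b m l)))" for k l
        unfolding E_def by (simp only: right_diff_distrib mult_ac)
      then show ?thesis by (simp only: sum_subtractf sum_distrib_left)
    qed
    then have "Re (\<Sum>k<n. \<Sum>l<n. x k * cnj (x l) * E k l) =
        \<eta> * (\<Sum>k<n. (cmod (x k))\<^sup>2) - \<delta> * (\<Sum>m<N. (cmod (\<Sum>k<n. x k * b m k))\<^sup>2)"
      unfolding 1 2 by (simp only: minus_complex.simps Re_complex_of_real of_real_mult[symmetric])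
    then show "0 \<le> Re (\<Sum>k<n. \<Sum>l<n. x k * cnj (x l) * E k l)" using le by simp
  qed
  then obtain g where g: "\<And>k l. k < n \<Longrightarrow> l < n \<Longrightarrow> E k l = (\<Sum>q<n. g q k * cnj (g q l))"
    using psd_gram by blast
  have "\<exists>(N'::nat) c w. (\<forall>q<N'. w q \<in> W) \<and> complex_of_real \<delta> \<odot> \<one> \<oplus> u m = (\<Oplus>q\<in>{..<N'}. (c q * cnj (c q)) \<odot> w q)"
    if m: "m < N" for m
  proof -
    obtain N' :: nat and c w where cw: "\<And>q. q < N' \<Longrightarrow> w q \<in> W"
      "mat 1 1 (\<lambda>_. complex_of_real \<delta> \<odot> \<one> \<oplus> u m) = mat 1 1 (\<lambda>(i, j). \<Oplus>q\<in>{..<N'}. (c q i * cnj (c q j)) \<odot> w q)"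
      using gen[OF u[OF m] \<delta>(1)] by (rule conicE) (rule that)
    have "complex_of_real \<delta> \<odot> \<one> \<oplus> u m = (\<Oplus>q\<in>{..<N'}. (c q 0 * cnj (c q 0)) \<odot> w q)"
      using arg_cong[OF cw(2), of "\<lambda>A. A $$ (0, 0)"] by simp
    then show ?thesis using cw(1)
      by (intro exI[of _ N'] exI[of _ "\<lambda>q. c q 0"] exI[of _ w]) auto
  qed
  then have "\<forall>m. \<exists>(N'::nat) c w. m < N \<longrightarrow> (\<forall>q<N'. w q \<in> W) \<and>
      complex_of_real \<delta> \<odot> \<one> \<oplus> u m = (\<Oplus>q\<in>{..<N'}. (c q * cnj (c q)) \<odot> w q)" by blast
  then obtain N' where "\<forall>m. \<exists>c w. m < N \<longrightarrow> (\<forall>q<N' m. w q \<in> W) \<and>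
      complex_of_real \<delta> \<odot> \<one> \<oplus> u m = (\<Oplus>q\<in>{..<N' m :: nat}. (c q * cnj (c q)) \<odot> w q)"
    by (rule choice[THEN exE])
  then obtain c where "\<forall>m. \<exists>w. m < N \<longrightarrow> (\<forall>q<N' m. w q \<in> W) \<and>
      complex_of_real \<delta> \<odot> \<one> \<oplus> u m = (\<Oplus>q\<in>{..<N' m}. (c m q * cnj (c m q)) \<odot> w q)"
    by (rule choice[THEN exE])
  then obtain w where "\<forall>m. m < N \<longrightarrow> (\<forall>q<N' m. w m q \<in> W) \<and>
      complex_of_real \<delta> \<odot> \<one> \<oplus> u m = (\<Oplus>q\<in>{..<N' m}. (c m q * cnj (c m q)) \<odot> w m q)"
    by (rule choice[THEN exE])
  then have w: "\<And>m q. m < N \<Longrightarrow> q < N' m \<Longrightarrow> w m q \<in> W"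
    and cw: "\<And>m. m < N \<Longrightarrow> complex_of_real \<delta> \<odot> \<one> \<oplus> u m = (\<Oplus>q\<in>{..<N' m}. (c m q * cnj (c m q)) \<odot> w m q)"
    by auto
  have wc: "w m q \<in> carrier V" if "m < N" "q < N' m" for m q using w[OF that] W by auto
  define F1 where "F1 = Sigma {..<N} (\<lambda>m. {..<N' m})"
  define F where "F = Inl ` F1 \<union> Inr ` {..<n}"
  define bb where "bb z i = (case z of Inl (m, q) \<Rightarrow> b m i * c m q | Inr q \<Rightarrow> g q i)" for z i
  define ww where "ww z = (case z of Inl (m, q) \<Rightarrow> w m q | Inr q \<Rightarrow> \<one>)" for z :: "nat \<times> nat + nat"
  show ?thesis
  proof (rule conicI[where F = F and b = bb and u = ww])
    show "finite F" by (simp add: F_def F1_def)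
    show "W \<subseteq> carrier V" by (rule W)
    show "ww z \<in> W" if "z \<in> F" for z using that w one by (auto simp: F_def F1_def ww_def)
    show "madd V (munit V n (complex_of_real \<epsilon>)) X \<in> carrier_mat n n" by (simp add: madd_def munit_def)
    fix i j assume ij: "i < n" "j < n"
    let ?e = "\<lambda>t. (if i = j then complex_of_real t else 0)"
    have unit: "munit V n (complex_of_real t) $$ (i, j) = ?e t \<odot> \<one>" for t
      using ij onec smult_l_null[OF onec] by (simp add: munit_def)
    have "(\<Oplus>z\<in>F. (bb z i * cnj (bb z j)) \<odot> ww z) =
        (\<Oplus>z\<in>Inl ` F1. (bb z i * cnj (bb z j)) \<odot> ww z) \<oplus> (\<Oplus>z\<in>Inr ` {..<n}. (bb z i * cnj (bb z j)) \<odot> ww z)"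
      unfolding F_def using wc onec
      by (intro M.finsum_Un_disjoint) (auto simp: F1_def ww_def)
    also have "(\<Oplus>z\<in>Inr ` {..<n}. (bb z i * cnj (bb z j)) \<odot> ww z) = (\<Oplus>q\<in>{..<n}. (g q i * cnj (g q j)) \<odot> \<one>)"
      using onec by (subst M.finsum_reindex) (auto simp: bb_def ww_def)
    also have "\<dots> = E i j \<odot> \<one>"
      using onec by (simp add: finsum_scalars g[OF ij])
    also have "(\<Oplus>z\<in>Inl ` F1. (bb z i * cnj (bb z j)) \<odot> ww z) =
        (\<Oplus>z\<in>F1. ((b (fst z) i * c (fst z) (snd z)) * cnj (b (fst z) j * c (fst z) (snd z))) \<odot> w (fst z) (snd z))"
      using wc by (subst M.finsum_reindex) (auto simp: bb_def ww_def F1_def split_beta)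
    also have "\<dots> = (\<Oplus>m\<in>{..<N}. \<Oplus>q\<in>{..<N' m}. ((b m i * c m q) * cnj (b m j * c m q)) \<odot> w m q)"
      unfolding F1_def using wc by (subst finsum_Sigma) auto
    also have "\<dots> = (\<Oplus>m\<in>{..<N}. (b m i * cnj (b m j)) \<odot> (complex_of_real \<delta> \<odot> \<one> \<oplus> u m))"
    proof (intro M.finsum_cong' refl)
      fix m assume "m \<in> {..<N}"
      then have m: "m < N" by simp
      have "(b m i * cnj (b m j)) \<odot> (complex_of_real \<delta> \<odot> \<one> \<oplus> u m) =
          (\<Oplus>q\<in>{..<N' m}. (b m i * cnj (b m j)) \<odot> ((c m q * cnj (c m q)) \<odot> w m q))"
        unfolding cw[OF m] using wc[OF m] by (intro finsum_smult) auto
      also have "\<dots> = (\<Oplus>q\<in>{..<N' m}. ((b m i * c m q) * cnj (b m j * c m q)) \<odot> w m q)"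
        using wc[OF m] by (intro M.finsum_cong' refl) (auto simp: smult_assoc1[simplified, symmetric] mult_ac)
      finally show "(\<Oplus>q\<in>{..<N' m}. ((b m i * c m q) * cnj (b m j * c m q)) \<odot> w m q) =
          (b m i * cnj (b m j)) \<odot> (complex_of_real \<delta> \<odot> \<one> \<oplus> u m)" by simp
    qed (use uc onec in auto)
    also have "\<dots> = (\<Oplus>m\<in>{..<N}. (b m i * cnj (b m j) * complex_of_real \<delta>) \<odot> \<one> \<oplus> (b m i * cnj (b m j)) \<odot> u m)"
      using uc onec by (intro M.finsum_cong' refl) (auto simp: smult_r_distr smult_assoc1[simplified])
    also have "\<dots> = (\<Oplus>m\<in>{..<N}. (b m i * cnj (b m j) * complex_of_real \<delta>) \<odot> \<one>) \<oplus> (\<Oplus>m\<in>{..<N}. (b m i * cnj (b m j)) \<odot> u m)"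
      using uc onec by (intro M.finsum_addf) auto
    also have "(\<Oplus>m\<in>{..<N}. (b m i * cnj (b m j) * complex_of_real \<delta>) \<odot> \<one>) = (\<Sum>m<N. b m i * cnj (b m j) * complex_of_real \<delta>) \<odot> \<one>"
      using onec by (simp add: finsum_scalars)
    also have "(\<Oplus>m\<in>{..<N}. (b m i * cnj (b m j)) \<odot> u m) = ?e \<eta> \<odot> \<one> \<oplus> X $$ (i, j)"
    proof -
      have "(\<Oplus>m\<in>{..<N}. (b m i * cnj (b m j)) \<odot> u m) = madd V (munit V n (complex_of_real \<eta>)) X $$ (i, j)"
        unfolding XN using ij by simp
      also have "\<dots> = munit V n (complex_of_real \<eta>) $$ (i, j) \<oplus> X $$ (i, j)"
        using ij by (simp add: madd_def munit_def)
      finally show ?thesis unfolding unit .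
    qed
    finally have "(\<Oplus>z\<in>F. (bb z i * cnj (bb z j)) \<odot> ww z) =
        (\<Sum>m<N. b m i * cnj (b m j) * complex_of_real \<delta>) \<odot> \<one> \<oplus> (?e \<eta> \<odot> \<one> \<oplus> X $$ (i, j)) \<oplus> E i j \<odot> \<one>" .
    also have "\<dots> = ((\<Sum>m<N. b m i * cnj (b m j) * complex_of_real \<delta>) \<odot> \<one> \<oplus> E i j \<odot> \<one>) \<oplus> ?e \<eta> \<odot> \<one> \<oplus> X $$ (i, j)"
      using onec Xc[OF ij] by (simp add: M.a_ac)
    also have "(\<Sum>m<N. b m i * cnj (b m j) * complex_of_real \<delta>) \<odot> \<one> \<oplus> E i j \<odot> \<one> = ?e \<eta> \<odot> \<one>"
      using onec by (simp add: smult_l_distr[simplified, symmetric] E_def sum_distrib_left mult_ac)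
    also have "?e \<eta> \<odot> \<one> \<oplus> ?e \<eta> \<odot> \<one> = ?e \<epsilon> \<odot> \<one>"
      using onec by (simp add: smult_l_distr[simplified, symmetric] \<eta>_def flip: of_real_add)
    also have "?e \<epsilon> \<odot> \<one> \<oplus> X $$ (i, j) = madd V (munit V n (complex_of_real \<epsilon>)) X $$ (i, j)"
      unfolding unit[symmetric] using ij by (simp add: madd_def munit_def)
    finally show "madd V (munit V n (complex_of_real \<epsilon>)) X $$ (i, j) = (\<Oplus>z\<in>F. (bb z i * cnj (bb z j)) \<odot> ww z)"
      by simp
  qed
qed

end

section \<open>The algebraic tensor product\<close>

locale tensor_pair = V: complex_module V + W: complex_module W
  for V :: "('a, 'm) star_space_scheme" and W :: "('b, 'n) star_space_scheme"
begin

abbreviation P where "P \<equiv> pair_space V W"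

lemma P_simps [simp]:
  "carrier P = finsupp (carrier V \<times> carrier W)" "\<zero>\<^bsub>P\<^esub> = (\<lambda>_. 0)" "\<one>\<^bsub>P\<^esub> = delta (\<one>\<^bsub>V\<^esub>, \<one>\<^bsub>W\<^esub>)"
  "f \<oplus>\<^bsub>P\<^esub> h = (\<lambda>x. f x + h x)" "c \<odot>\<^bsub>P\<^esub> f = (\<lambda>x. c * f x)"
  by (simp_all add: pair_space_def)

sublocale P: complex_module P
  by (intro complex_module.intro complex_moduleI)
    (auto simp: finsupp_add finsupp_zero finsupp_smult algebra_simps)

lemma P_minus: "f \<in> carrier P \<Longrightarrow> h \<in> carrier P \<Longrightarrow> f \<ominus>\<^bsub>P\<^esub> h = (\<lambda>x. f x - h x)"
  using P.smult_minus_one[of h] by (auto simp: a_minus_def fun_eq_iff)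

lemma finsupp_diff: "f \<in> finsupp A \<Longrightarrow> h \<in> finsupp A \<Longrightarrow> (\<lambda>x. f x - h x) \<in> finsupp A"
  using finsupp_add[of f A "\<lambda>x. (-1) * h x"] finsupp_smult[of h A "-1"] by simp

lemma relations_carrier: "bilinear_relations V W \<subseteq> carrier P"
  unfolding bilinear_relations_def
  by (auto intro!: finsupp_diff finsupp_smult finsupp_delta)

sublocale Q: quotient_space P "tensor_null V W"
  unfolding tensor_null_def
  by (intro quotient_space.intro P.complex_module_axioms quotient_space_axioms.intro P.cspan_submodule relations_carrier)

abbreviation T where "T \<equiv> alg_tensor V W"

abbreviation et where "et \<equiv> elem_tensor V W"

lemma T_eq: "T = Q.Q"
  by (simp add: alg_tensor_def)

lemma et_eq: "et v w = Q.coset (delta (v, w))"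
  by (simp add: elem_tensor_def)

sublocale T: complex_module T
  unfolding T_eq by (rule complex_module.intro) (rule Q.quotient_module)

lemma delta_in: "v \<in> carrier V \<Longrightarrow> w \<in> carrier W \<Longrightarrow> delta (v, w) \<in> carrier P"
  by (simp add: finsupp_delta)

lemma et_closed [simp]: "v \<in> carrier V \<Longrightarrow> w \<in> carrier W \<Longrightarrow> et v w \<in> carrier T"
  unfolding et_eq T_eq by (intro Q.coset_closed delta_in)

lemma relation_null: "f \<in> bilinear_relations V W \<Longrightarrow> f \<in> tensor_null V W"
  unfolding tensor_null_def by (rule cspan_base)

lemma et_add_l:
  assumes v: "v \<in> carrier V" "v' \<in> carrier V" and w: "w \<in> carrier W"
  shows "et (v \<oplus>\<^bsub>V\<^esub> v') w = et v w \<oplus>\<^bsub>T\<^esub> et v' w"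
proof -
  have "(\<lambda>z. delta (v \<oplus>\<^bsub>V\<^esub> v', w) z - delta (v, w) z - delta (v', w) z) \<in> bilinear_relations V W"
    unfolding bilinear_relations_def using v w by blast
  from relation_null[OF this] have "delta (v \<oplus>\<^bsub>V\<^esub> v', w) \<ominus>\<^bsub>P\<^esub> (\<lambda>z. delta (v, w) z + delta (v', w) z) \<in> tensor_null V W"
    using v w by (subst P_minus) (auto simp: finsupp_add finsupp_delta diff_diff_eq)
  then show ?thesis
    unfolding et_eq T_eq using v w by (simp add: Q.coset_add Q.coset_eq_iff finsupp_add finsupp_delta)
qed

lemma et_add_r:
  assumes v: "v \<in> carrier V" and w: "w \<in> carrier W" "w' \<in> carrier W"
  shows "et v (w \<oplus>\<^bsub>W\<^esub> w') = et v w \<oplus>\<^bsub>T\<^esub> et v w'"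
proof -
  have "(\<lambda>z. delta (v, w \<oplus>\<^bsub>W\<^esub> w') z - delta (v, w) z - delta (v, w') z) \<in> bilinear_relations V W"
    unfolding bilinear_relations_def using v w by blast
  from relation_null[OF this] have "delta (v, w \<oplus>\<^bsub>W\<^esub> w') \<ominus>\<^bsub>P\<^esub> (\<lambda>z. delta (v, w) z + delta (v, w') z) \<in> tensor_null V W"
    using v w by (subst P_minus) (auto simp: finsupp_add finsupp_delta diff_diff_eq)
  then show ?thesis
    unfolding et_eq T_eq using v w by (simp add: Q.coset_add Q.coset_eq_iff finsupp_add finsupp_delta)
qed

lemma et_smult_l:
  assumes v: "v \<in> carrier V" and w: "w \<in> carrier W"
  shows "et (c \<odot>\<^bsub>V\<^esub> v) w = c \<odot>\<^bsub>T\<^esub> et v w"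
proof -
  have "(\<lambda>z. delta (c \<odot>\<^bsub>V\<^esub> v, w) z - c * delta (v, w) z) \<in> bilinear_relations V W"
    unfolding bilinear_relations_def using v w by blast
  from relation_null[OF this] have "delta (c \<odot>\<^bsub>V\<^esub> v, w) \<ominus>\<^bsub>P\<^esub> (\<lambda>z. c * delta (v, w) z) \<in> tensor_null V W"
    using v w by (subst P_minus) (auto simp: finsupp_smult finsupp_delta)
  then show ?thesis
    unfolding et_eq T_eq using v w by (simp add: Q.coset_smult Q.coset_eq_iff finsupp_smult finsupp_delta)
qed

lemma et_smult_r:
  assumes v: "v \<in> carrier V" and w: "w \<in> carrier W"
  shows "et v (c \<odot>\<^bsub>W\<^esub> w) = c \<odot>\<^bsub>T\<^esub> et v w"
proof -
  have "(\<lambda>z. delta (v, c \<odot>\<^bsub>W\<^esub> w) z - c * delta (v, w) z) \<in> bilinear_relations V W"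
    unfolding bilinear_relations_def using v w by blast
  from relation_null[OF this] have "delta (v, c \<odot>\<^bsub>W\<^esub> w) \<ominus>\<^bsub>P\<^esub> (\<lambda>z. c * delta (v, w) z) \<in> tensor_null V W"
    using v w by (subst P_minus) (auto simp: finsupp_smult finsupp_delta)
  then show ?thesis
    unfolding et_eq T_eq using v w by (simp add: Q.coset_smult Q.coset_eq_iff finsupp_smult finsupp_delta)
qed

lemma et_zero_l: "w \<in> carrier W \<Longrightarrow> et \<zero>\<^bsub>V\<^esub> w = \<zero>\<^bsub>T\<^esub>"
  using et_smult_l[of "\<zero>\<^bsub>V\<^esub>" w 0] T.smult_l_null[of "et \<zero>\<^bsub>V\<^esub> w"] V.smult_l_null[of "\<zero>\<^bsub>V\<^esub>"] by simp

lemma et_zero_r: "v \<in> carrier V \<Longrightarrow> et v \<zero>\<^bsub>W\<^esub> = \<zero>\<^bsub>T\<^esub>"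
  using et_smult_r[of v "\<zero>\<^bsub>W\<^esub>" 0] T.smult_l_null[of "et v \<zero>\<^bsub>W\<^esub>"] W.smult_l_null[of "\<zero>\<^bsub>W\<^esub>"] by simp

lemma et_finsum_l:
  assumes "finite F" "\<And>k. k \<in> F \<Longrightarrow> f k \<in> carrier V" "w \<in> carrier W"
  shows "et (\<Oplus>\<^bsub>V\<^esub>k\<in>F. f k) w = (\<Oplus>\<^bsub>T\<^esub>k\<in>F. et (f k) w)"
  using assms
proof (induction F rule: finite_induct)
  case (insert k F)
  have "(\<Oplus>\<^bsub>V\<^esub>k\<in>insert k F. f k) = f k \<oplus>\<^bsub>V\<^esub> (\<Oplus>\<^bsub>V\<^esub>k\<in>F. f k)"
    using insert by (intro V.M.finsum_insert) auto
  moreover have "(\<Oplus>\<^bsub>V\<^esub>k\<in>F. f k) \<in> carrier V" using insert by (intro V.M.finsum_closed) auto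
  moreover have "(\<Oplus>\<^bsub>T\<^esub>k\<in>insert k F. et (f k) w) = et (f k) w \<oplus>\<^bsub>T\<^esub> (\<Oplus>\<^bsub>T\<^esub>k\<in>F. et (f k) w)"
    using insert by (intro T.M.finsum_insert) auto
  ultimately show ?case using insert by (simp add: et_add_l)
qed (simp add: et_zero_l)

lemma et_finsum_r:
  assumes "finite F" "\<And>k. k \<in> F \<Longrightarrow> f k \<in> carrier W" "v \<in> carrier V"
  shows "et v (\<Oplus>\<^bsub>W\<^esub>k\<in>F. f k) = (\<Oplus>\<^bsub>T\<^esub>k\<in>F. et v (f k))"
  using assms
proof (induction F rule: finite_induct)
  case (insert k F)
  have "(\<Oplus>\<^bsub>W\<^esub>k\<in>insert k F. f k) = f k \<oplus>\<^bsub>W\<^esub> (\<Oplus>\<^bsub>W\<^esub>k\<in>F. f k)"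
    using insert by (intro W.M.finsum_insert) auto
  moreover have "(\<Oplus>\<^bsub>W\<^esub>k\<in>F. f k) \<in> carrier W" using insert by (intro W.M.finsum_closed) auto
  moreover have "(\<Oplus>\<^bsub>T\<^esub>k\<in>insert k F. et v (f k)) = et v (f k) \<oplus>\<^bsub>T\<^esub> (\<Oplus>\<^bsub>T\<^esub>k\<in>F. et v (f k))"
    using insert by (intro T.M.finsum_insert) auto
  ultimately show ?case using insert by (simp add: et_add_r)
qed (simp add: et_zero_r)

text \<open>Bilinearity: a product of two sums of rank one terms is the sum over all pairs.\<close>

lemma kron_conic:
  assumes A: "A \<subseteq> carrier V" and B: "B \<subseteq> carrier W"
    and X: "conic V A p X" and Y: "conic W B r Y"
  shows "conic T {et s t | s t. s \<in> A \<and> t \<in> B} (p * r) (kron V W X Y)"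
proof -
  obtain N1 :: nat and b s where s: "\<And>m. m < N1 \<Longrightarrow> s m \<in> A"
    and X: "X = mat p p (\<lambda>(i, j). \<Oplus>\<^bsub>V\<^esub>m\<in>{..<N1}. (b m i * cnj (b m j)) \<odot>\<^bsub>V\<^esub> s m)"
    using X by (rule conicE) (rule that)
  obtain N2 :: nat and c t where t: "\<And>m. m < N2 \<Longrightarrow> t m \<in> B"
    and Y: "Y = mat r r (\<lambda>(i, j). \<Oplus>\<^bsub>W\<^esub>m\<in>{..<N2}. (c m i * cnj (c m j)) \<odot>\<^bsub>W\<^esub> t m)"
    using Y by (rule conicE) (rule that)
  have sc: "s m \<in> carrier V" if "m < N1" for m using s[OF that] A by auto
  have tc: "t m \<in> carrier W" if "m < N2" for m using t[OF that] B by auto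
  show ?thesis
  proof (rule T.conicI[where F = "{..<N1} \<times> {..<N2}" and u = "\<lambda>z. et (s (fst z)) (t (snd z))"
        and b = "\<lambda>z i. b (fst z) (i div r) * c (snd z) (i mod r)"])
    show "{et s t |s t. s \<in> A \<and> t \<in> B} \<subseteq> carrier T"
      using et_closed A B by blast
    show "et (s (fst m)) (t (snd m)) \<in> {et s t |s t. s \<in> A \<and> t \<in> B}" if "m \<in> {..<N1} \<times> {..<N2}" for m
      unfolding mem_Collect_eq using that s t by (intro exI[of _ "s (fst m)"] exI[of _ "t (snd m)"]) auto
    show "kron V W X Y \<in> carrier_mat (p * r) (p * r)" by (simp add: kron_def Let_def X Y)
    fix i j assume ij: "i < p * r" "j < p * r"
    then have r: "0 < r" by (cases r) auto
    then have div: "i div r < p" "j div r < p" "i mod r < r" "j mod r < r"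
      using ij by (auto simp: less_mult_imp_div_less)
    let ?b = "\<lambda>m. b m (i div r) * cnj (b m (j div r))" and ?c = "\<lambda>q. c q (i mod r) * cnj (c q (j mod r))"
    have "kron V W X Y $$ (i, j) = et (X $$ (i div r, j div r)) (Y $$ (i mod r, j mod r))"
      using ij by (simp add: kron_def Let_def X Y)
    also have "\<dots> = et (\<Oplus>\<^bsub>V\<^esub>m\<in>{..<N1}. ?b m \<odot>\<^bsub>V\<^esub> s m) (\<Oplus>\<^bsub>W\<^esub>q\<in>{..<N2}. ?c q \<odot>\<^bsub>W\<^esub> t q)"
      using div by (simp add: X Y)
    also have "\<dots> = (\<Oplus>\<^bsub>T\<^esub>m\<in>{..<N1}. et (?b m \<odot>\<^bsub>V\<^esub> s m) (\<Oplus>\<^bsub>W\<^esub>q\<in>{..<N2}. ?c q \<odot>\<^bsub>W\<^esub> t q))"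
      using sc tc by (intro et_finsum_l) (auto intro!: W.M.finsum_closed)
    also have "\<dots> = (\<Oplus>\<^bsub>T\<^esub>m\<in>{..<N1}. \<Oplus>\<^bsub>T\<^esub>q\<in>{..<N2}. et (?b m \<odot>\<^bsub>V\<^esub> s m) (?c q \<odot>\<^bsub>W\<^esub> t q))"
      using sc tc by (intro T.M.finsum_cong' refl et_finsum_r) (auto intro!: T.M.finsum_closed)
    also have "\<dots> = (\<Oplus>\<^bsub>T\<^esub>z\<in>{..<N1} \<times> {..<N2}. et (?b (fst z) \<odot>\<^bsub>V\<^esub> s (fst z)) (?c (snd z) \<odot>\<^bsub>W\<^esub> t (snd z)))"
      using sc tc by (intro T.finsum_Sigma) auto
    also have "\<dots> = (\<Oplus>\<^bsub>T\<^esub>z\<in>{..<N1} \<times> {..<N2}. (b (fst z) (i div r) * c (snd z) (i mod r) *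
        cnj (b (fst z) (j div r) * c (snd z) (j mod r))) \<odot>\<^bsub>T\<^esub> et (s (fst z)) (t (snd z)))"
      using sc tc by (intro T.M.finsum_cong' refl)
        (auto simp: et_smult_l et_smult_r T.smult_assoc1[simplified, symmetric] mult_ac)
    finally show "kron V W X Y $$ (i, j) = (\<Oplus>\<^bsub>T\<^esub>z\<in>{..<N1} \<times> {..<N2}. (b (fst z) (i div r) * c (snd z) (i mod r) *
        cnj (b (fst z) (j div r) * c (snd z) (j mod r))) \<odot>\<^bsub>T\<^esub> et (s (fst z)) (t (snd z)))" .
  qed simp
qed

text \<open>Conversely \<open>\<Sum>m. b m b m\<^sup>* (s m \<otimes> t m)\<close> is a compression of \<open>diag(s) \<otimes> diag(t)\<close>: keep the diagonal indices
  \<open>(m, m)\<close>, whose position in the Kronecker product is \<open>m * N + m\<close>.\<close>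

lemma conic_kron:
  assumes A: "A \<subseteq> carrier V" and B: "B \<subseteq> carrier W"
    and X: "conic T {et s t | s t. s \<in> A \<and> t \<in> B} n X"
  shows "\<exists>ss ts \<alpha>. set ss \<subseteq> A \<and> set ts \<subseteq> B \<and> \<alpha> \<in> carrier_mat n (length ss * length ts) \<and>
    X = compress T \<alpha> (kron V W (mdiag V ss) (mdiag W ts))"
proof -
  obtain N :: nat and b u where u: "\<And>m. m < N \<Longrightarrow> u m \<in> {et s t | s t. s \<in> A \<and> t \<in> B}"
    and X: "X = mat n n (\<lambda>(i, j). \<Oplus>\<^bsub>T\<^esub>m\<in>{..<N}. (b m i * cnj (b m j)) \<odot>\<^bsub>T\<^esub> u m)"
    using X by (rule conicE) (rule that)
  have "\<forall>m. \<exists>s t. m < N \<longrightarrow> s \<in> A \<and> t \<in> B \<and> u m = et s t" using u by blast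
  then obtain s where "\<forall>m. \<exists>t. m < N \<longrightarrow> s m \<in> A \<and> t \<in> B \<and> u m = et (s m) t"
    by (rule choice[THEN exE])
  then obtain t where "\<forall>m. m < N \<longrightarrow> s m \<in> A \<and> t m \<in> B \<and> u m = et (s m) (t m)"
    by (rule choice[THEN exE])
  then have st: "\<And>m. m < N \<Longrightarrow> s m \<in> A" "\<And>m. m < N \<Longrightarrow> t m \<in> B" "\<And>m. m < N \<Longrightarrow> u m = et (s m) (t m)"
    by auto
  have c: "s m \<in> carrier V" "t m \<in> carrier W" "u m \<in> carrier T" if "m < N" for m
  proof -
    show 1: "s m \<in> carrier V" and 2: "t m \<in> carrier W" using st[OF that] A B by auto
    show "u m \<in> carrier T" unfolding st(3)[OF that] by (rule et_closed[OF 1 2])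
  qed
  define ss where "ss = map s [0..<N]"
  define ts where "ts = map t [0..<N]"
  define \<alpha> where "\<alpha> = mat n (N * N) (\<lambda>(i, k). if k div N = k mod N then b (k mod N) i else 0)"
  have len: "length ss = N" "length ts = N" by (auto simp: ss_def ts_def)
  have "compress T \<alpha> (kron V W (mdiag V ss) (mdiag W ts)) = X"
  proof (rule eq_matI)
    fix i j assume "i < dim_row X" "j < dim_col X"
    then have ij: "i < n" "j < n" by (auto simp: X)
    let ?K = "kron V W (mdiag V ss) (mdiag W ts)"
    let ?g = "\<lambda>k. (b (k mod N) i * cnj (b (k mod N) j)) \<odot>\<^bsub>T\<^esub> u (k mod N)"
    have entry: "(\<alpha> $$ (i, k) * cnj (\<alpha> $$ (j, l))) \<odot>\<^bsub>T\<^esub> ?K $$ (k, l) =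
        (if k = l then (if k div N = k mod N then ?g k else \<zero>\<^bsub>T\<^esub>) else \<zero>\<^bsub>T\<^esub>)"
      if k: "k < N * N" and l: "l < N * N" for k l
    proof -
      have N: "N > 0" using k by (cases N) auto
      have d: "k div N < N" "l div N < N" "k mod N < N" "l mod N < N"
        using k l N by (auto simp: less_mult_imp_div_less)
      have K: "?K $$ (k, l) = et (if k div N = l div N then s (k div N) else \<zero>\<^bsub>V\<^esub>)
          (if k mod N = l mod N then t (k mod N) else \<zero>\<^bsub>W\<^esub>)"
        using k l d by (simp add: kron_def Let_def mdiag_def ss_def ts_def)
      have Kc: "?K $$ (k, l) \<in> carrier T" unfolding K using c d by simp
      have kl: "k = l" if "k div N = l div N" "k mod N = l mod N"
        using that by (metis div_mult_mod_eq)
      show ?thesis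
      proof (cases "k div N = k mod N \<and> l div N = l mod N")
        case True
        then show ?thesis
          using k l ij d c kl st(3) T.smult_r_null[simplified] by (auto simp: K \<alpha>_def et_zero_l)
      next
        case False
        then have 0: "\<alpha> $$ (i, k) * cnj (\<alpha> $$ (j, l)) = 0" using k l ij by (auto simp: \<alpha>_def)
        have "(\<alpha> $$ (i, k) * cnj (\<alpha> $$ (j, l))) \<odot>\<^bsub>T\<^esub> ?K $$ (k, l) = \<zero>\<^bsub>T\<^esub>"
          unfolding 0 using T.smult_l_null[OF Kc] by simp
        then show ?thesis using False by auto
      qed
    qed
    have gc: "?g k \<in> carrier T" if "k < N * N" for k
      using that c by (cases N) auto
    have "compress T \<alpha> ?K $$ (i, j) =
        (\<Oplus>\<^bsub>T\<^esub>k\<in>{..<N * N}. \<Oplus>\<^bsub>T\<^esub>l\<in>{..<N * N}. (\<alpha> $$ (i, k) * cnj (\<alpha> $$ (j, l))) \<odot>\<^bsub>T\<^esub> ?K $$ (k, l))"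
      using ij by (simp add: compress_def \<alpha>_def)
    also have "\<dots> = (\<Oplus>\<^bsub>T\<^esub>k\<in>{..<N * N}. \<Oplus>\<^bsub>T\<^esub>l\<in>{..<N * N}.
        (if k = l then (if k div N = k mod N then ?g k else \<zero>\<^bsub>T\<^esub>) else \<zero>\<^bsub>T\<^esub>))"
      using gc by (intro T.M.finsum_cong' refl) (auto simp: entry intro!: T.M.finsum_closed)
    also have "\<dots> = (\<Oplus>\<^bsub>T\<^esub>k\<in>{..<N * N}. (if k div N = k mod N then ?g k else \<zero>\<^bsub>T\<^esub>))"
    proof (intro T.M.finsum_cong' refl)
      fix k assume "k \<in> {..<N * N}"
      then show "(\<Oplus>\<^bsub>T\<^esub>l\<in>{..<N * N}. (if k = l then (if k div N = k mod N then ?g k else \<zero>\<^bsub>T\<^esub>) else \<zero>\<^bsub>T\<^esub>)) =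
          (if k div N = k mod N then ?g k else \<zero>\<^bsub>T\<^esub>)"
        using gc by (intro T.M.finsum_singleton) auto
    qed (use gc in auto)
    also have "\<dots> = (\<Oplus>\<^bsub>T\<^esub>k\<in>(\<lambda>m. m * N + m) ` {..<N}. ?g k)"
    proof (rule T.M.add.finprod_mono_neutral_cong_right)
      have "m * N + m < N * N" if "m < N" for m
      proof -
        have "m * N + m < m * N + N" using that by simp
        also have "\<dots> = Suc m * N" by simp
        also have "\<dots> \<le> N * N" using that by (intro mult_le_mono1) simp
        finally show ?thesis .
      qed
      then show "(\<lambda>m. m * N + m) ` {..<N} \<subseteq> {..<N * N}" by auto
      show "(if k div N = k mod N then ?g k else \<zero>\<^bsub>T\<^esub>) = \<zero>\<^bsub>T\<^esub>"
        if "k \<in> {..<N * N} - (\<lambda>m. m * N + m) ` {..<N}" for k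
      proof -
        have "k div N \<noteq> k mod N"
        proof
          assume "k div N = k mod N"
          then have "k = (k mod N) * N + k mod N" by (metis div_mult_mod_eq)
          moreover have "k mod N < N" using that by (cases N) auto
          ultimately show False using that by blast
        qed
        then show ?thesis by simp
      qed
      show "(if k div N = k mod N then ?g k else \<zero>\<^bsub>T\<^esub>) = ?g k"
        if "k \<in> (\<lambda>m. m * N + m) ` {..<N}" for k
        using that by auto
    qed (use gc in auto)
    also have "\<dots> = (\<Oplus>\<^bsub>T\<^esub>m\<in>{..<N}. ?g (m * N + m))"
    proof (rule T.M.finsum_reindex)
      show "inj_on (\<lambda>m. m * N + m) {..<N}"
      proof (rule inj_onI)
        fix x y assume "x * N + x = y * N + y"
        then have "x * Suc N = y * Suc N" by simp
        then show "x = y" by (simp only: mult_cancel2) simp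
      qed
    qed (use c in auto)
    also have "\<dots> = (\<Oplus>\<^bsub>T\<^esub>m\<in>{..<N}. (b m i * cnj (b m j)) \<odot>\<^bsub>T\<^esub> u m)"
      using c by (intro T.M.finsum_cong' refl) auto
    finally show "compress T \<alpha> ?K $$ (i, j) = X $$ (i, j)" using ij by (simp add: X)
  qed (auto simp: X compress_def \<alpha>_def)
  moreover have "\<alpha> \<in> carrier_mat n (length ss * length ts)" by (simp add: \<alpha>_def len)
  moreover have "set ss \<subseteq> A" "set ts \<subseteq> B" using st by (auto simp: ss_def ts_def)
  ultimately show ?thesis by metis
qed

end

section \<open>The maximal tensor product\<close>

text \<open>The matrix cones are generated by level one exactly, before any Archimedean closure. Exactness makes products of
  such matrices exact as well, so that the tensor product requires no estimates.\<close>

locale omax_system = complex_module R for R :: "'a opsys" (structure) +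
  assumes one_pos: "\<one> \<in> pos_elems R"
    and matpos_conic: "X \<in> matpos R n \<Longrightarrow> conic R (pos_elems R) n X"
    and mdiag_matpos: "set ss \<subseteq> pos_elems R \<Longrightarrow> mdiag R ss \<in> matpos R (length ss)"

lemma pos_elems_carrier: "pos_elems R \<subseteq> carrier R"
  by (auto simp: pos_elems_def)

lemma finsum_same_add:
  assumes "carrier V' = carrier V" "add V' = add V" "zero V' = zero V"
  shows "finsum V' f A = finsum V f A"
  unfolding finsum_def finprod_def using assms by simp

context operator_system
begin

lemma complex_module_axioms': "complex_module V"
  by (rule complex_module.intro) (rule module_axioms)

text \<open>Each rank one term is the compression of a positive one by one matrix.\<close>

lemma conic_matpos:
  assumes "conic V (pos_elems V) n X"
  shows "X \<in> matpos V n"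
proof -
  interpret complex_module V by (rule complex_module_axioms')
  obtain N :: nat and b u where u: "\<And>m. m < N \<Longrightarrow> u m \<in> pos_elems V"
    and X: "X = mat n n (\<lambda>(i, j). \<Oplus>m\<in>{..<N}. (b m i * cnj (b m j)) \<odot> u m)"
    using assms by (rule conicE) (rule that)
  have "mat n n (\<lambda>(i, j). \<Oplus>m\<in>{..<M}. (b m i * cnj (b m j)) \<odot> u m) \<in> matpos V n" if "M \<le> N" for M
    using that
  proof (induction M)
    case 0
    let ?Z = "mat 1 1 (\<lambda>_. \<zero>)"
    have star0: "star V \<zero> = \<zero>"
      using star_smult[of \<zero> 0] smult_l_null[of \<zero>] smult_l_null[of "star V \<zero>"] star_closed[of \<zero>] by simp
    have "?Z \<in> mats V 1" by (auto simp: mats_def elements_mat_def)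
    moreover have "madj V ?Z = ?Z" by (rule eq_matI) (auto simp: madj_def star0)
    ultimately obtain r where r: "madd V (munit V 1 (complex_of_real r)) ?Z \<in> matpos V 1"
      using matrix_order_unit by blast
    have "compress V (mat n 1 (\<lambda>_. 0)) (madd V (munit V 1 (complex_of_real r)) ?Z) \<in> matpos V n"
      by (rule matpos_compress[OF r]) simp
    moreover have "compress V (mat n 1 (\<lambda>_. 0)) (madd V (munit V 1 (complex_of_real r)) ?Z) =
        mat n n (\<lambda>(i, j). \<Oplus>m\<in>{..<0}. (b m i * cnj (b m j)) \<odot> u m)"
      using one_closed smult_l_null[of "complex_of_real r \<odot> \<one> \<oplus> \<zero>"]
      by (intro eq_matI) (auto simp: compress_def madd_def munit_def lessThan_Suc)
    ultimately show ?case by (simp only:)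
  next
    case (Suc M)
    have uM: "u M \<in> carrier V" "mat 1 1 (\<lambda>_. u M) \<in> matpos V 1"
      using u[of M] Suc.prems by (auto simp: pos_elems_def)
    have uc: "u m \<in> carrier V" if "m < Suc M" for m
      using u[of m] that Suc.prems by (auto simp: pos_elems_def)
    let ?\<alpha> = "mat n 1 (\<lambda>(i, _). b M i)"
    have "madd V (mat n n (\<lambda>(i, j). \<Oplus>m\<in>{..<M}. (b m i * cnj (b m j)) \<odot> u m))
        (compress V ?\<alpha> (mat 1 1 (\<lambda>_. u M))) \<in> matpos V n"
      using Suc by (intro matpos_add matpos_compress[OF uM(2)]) auto
    moreover have "madd V (mat n n (\<lambda>(i, j). \<Oplus>m\<in>{..<M}. (b m i * cnj (b m j)) \<odot> u m))
        (compress V ?\<alpha> (mat 1 1 (\<lambda>_. u M))) =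
        mat n n (\<lambda>(i, j). \<Oplus>m\<in>{..<Suc M}. (b m i * cnj (b m j)) \<odot> u m)"
    proof (rule eq_matI)
      fix i j assume "i < dim_row (mat n n (\<lambda>(i, j). \<Oplus>m\<in>{..<Suc M}. (b m i * cnj (b m j)) \<odot> u m))"
        "j < dim_col (mat n n (\<lambda>(i, j). \<Oplus>m\<in>{..<Suc M}. (b m i * cnj (b m j)) \<odot> u m))"
      then have ij: "i < n" "j < n" by auto
      have "(\<Oplus>m\<in>{..<Suc M}. (b m i * cnj (b m j)) \<odot> u m) =
          (b M i * cnj (b M j)) \<odot> u M \<oplus> (\<Oplus>m\<in>{..<M}. (b m i * cnj (b m j)) \<odot> u m)"
        unfolding lessThan_Suc using uc by (intro M.finsum_insert) auto
      also have "\<dots> = (\<Oplus>m\<in>{..<M}. (b m i * cnj (b m j)) \<odot> u m) \<oplus> (b M i * cnj (b M j)) \<odot> u M"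
        using uc by (intro M.a_comm) (auto intro!: M.finsum_closed)
      finally show "madd V (mat n n (\<lambda>(i, j). \<Oplus>m\<in>{..<M}. (b m i * cnj (b m j)) \<odot> u m))
        (compress V ?\<alpha> (mat 1 1 (\<lambda>_. u M))) $$ (i, j) =
        mat n n (\<lambda>(i, j). \<Oplus>m\<in>{..<Suc M}. (b m i * cnj (b m j)) \<odot> u m) $$ (i, j)"
        using ij uM(1) by (simp add: madd_def compress_def lessThan_Suc[of 0])
    qed (auto simp: madd_def)
    ultimately show ?case by simp
  qed
  then show ?thesis unfolding X by simp
qed

end

locale omax_pair = V: omax_system R1 + W: omax_system R2 for R1 :: "'a opsys" and R2 :: "'b opsys"
begin

sublocale tensor_pair R1 R2
  by unfold_locales

abbreviation MT where "MT \<equiv> R1 \<otimes>\<^sub>m\<^sub>a\<^sub>x R2"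

lemma MT_simps:
  "carrier MT = carrier T" "add MT = add T" "zero MT = zero T" "one MT = one T" "smult MT = smult T" "star MT = star T"
  by (simp_all add: max_tensor_def Let_def star_space.extend_def)

lemma MT_matpos: "matpos MT q = {X. X \<in> mats T q \<and>
    (\<forall>\<epsilon>>0. \<exists>p r. \<exists>P\<in>matpos R1 p. \<exists>Q\<in>matpos R2 r. \<exists>\<alpha>\<in>carrier_mat q (p * r).
      madd T (munit T q (complex_of_real \<epsilon>)) X = compress T \<alpha> (kron R1 R2 P Q))}"
  by (simp add: max_tensor_def Let_def star_space.extend_def)

lemma MT_finsum: "finsum MT f A = finsum T f A"
  by (rule finsum_same_add) (simp_all add: MT_simps)

lemma MT_mats:
  "mats MT n = mats T n" "madd MT X Y = madd T X Y" "munit MT n c = munit T n c"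
  "compress MT \<alpha> X = compress T \<alpha> X" "mdiag MT xs = mdiag T xs"
  unfolding mats_def madd_def munit_def compress_def mdiag_def MT_finsum MT_simps by (rule refl)+

text \<open>The generators of all the cones of the maximal tensor product.\<close>

definition tensors where
  "tensors = {et s t | s t. s \<in> pos_elems R1 \<and> t \<in> pos_elems R2}"

lemma tensors_carrier: "tensors \<subseteq> carrier T"
proof
  fix u assume "u \<in> tensors"
  then obtain s t where u: "u = et s t" "s \<in> pos_elems R1" "t \<in> pos_elems R2"
    unfolding tensors_def by blast
  have "s \<in> carrier R1" "t \<in> carrier R2" using u pos_elems_carrier by (auto simp: pos_elems_def)
  then show "u \<in> carrier T" unfolding u(1) by (rule et_closed)
qed

text \<open>Factors \<open>P\<close> and \<open>Q\<close> may be taken diagonal, because both systems are generated by level one.\<close>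

lemma matpos_iff:
  "X \<in> matpos MT n \<longleftrightarrow> X \<in> mats T n \<and> (\<forall>\<epsilon>>0. conic T tensors n (madd T (munit T n (complex_of_real \<epsilon>)) X))"
proof -
  have "(\<exists>p r. \<exists>P\<in>matpos R1 p. \<exists>Q\<in>matpos R2 r. \<exists>\<alpha>\<in>carrier_mat n (p * r). Z = compress T \<alpha> (kron R1 R2 P Q)) \<longleftrightarrow>
      conic T tensors n Z" for Z
  proof
    assume "\<exists>p r. \<exists>P\<in>matpos R1 p. \<exists>Q\<in>matpos R2 r. \<exists>\<alpha>\<in>carrier_mat n (p * r). Z = compress T \<alpha> (kron R1 R2 P Q)"
    then obtain p r P Q \<alpha> where PQ: "P \<in> matpos R1 p" "Q \<in> matpos R2 r" and \<alpha>: "\<alpha> \<in> carrier_mat n (p * r)"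
      and Z: "Z = compress T \<alpha> (kron R1 R2 P Q)" by blast
    have "conic T tensors (p * r) (kron R1 R2 P Q)"
      unfolding tensors_def
      by (rule kron_conic[OF pos_elems_carrier pos_elems_carrier V.matpos_conic[OF PQ(1)] W.matpos_conic[OF PQ(2)]])
    then show "conic T tensors n Z"
      unfolding Z by (rule T.conic_compress[OF tensors_carrier _ \<alpha>])
  next
    assume "conic T tensors n Z"
    then obtain ss ts \<alpha> where st: "set ss \<subseteq> pos_elems R1" "set ts \<subseteq> pos_elems R2"
      "\<alpha> \<in> carrier_mat n (length ss * length ts)" "Z = compress T \<alpha> (kron R1 R2 (mdiag R1 ss) (mdiag R2 ts))"
      using conic_kron[OF pos_elems_carrier pos_elems_carrier] unfolding tensors_def by blast
    then show "\<exists>p r. \<exists>P\<in>matpos R1 p. \<exists>Q\<in>matpos R2 r. \<exists>\<alpha>\<in>carrier_mat n (p * r). Z = compress T \<alpha> (kron R1 R2 P Q)"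
      using V.mdiag_matpos[OF st(1)] W.mdiag_matpos[OF st(2)] by blast
  qed
  then show ?thesis unfolding MT_matpos by simp
qed

lemma one_tensor: "\<one>\<^bsub>T\<^esub> = et \<one>\<^bsub>R1\<^esub> \<one>\<^bsub>R2\<^esub>"
  unfolding T_eq et_eq by (simp add: Q.coset_one)

lemma one_in_tensors: "\<one>\<^bsub>T\<^esub> \<in> tensors"
  unfolding one_tensor tensors_def using V.one_pos W.one_pos by blast

lemma one_T: "\<one>\<^bsub>T\<^esub> \<in> carrier T"
  using one_in_tensors tensors_carrier by blast

lemma unit_plus_1x1:
  assumes "u \<in> carrier T"
  shows "madd T (munit T 1 c) (mat 1 1 (\<lambda>_. u)) = mat 1 1 (\<lambda>_. c \<odot>\<^bsub>T\<^esub> \<one>\<^bsub>T\<^esub> \<oplus>\<^bsub>T\<^esub> u)"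
  by (rule eq_matI) (auto simp: madd_def munit_def)

lemma tensors_pos: "tensors \<subseteq> pos_elems MT"
proof
  fix u assume u: "u \<in> tensors"
  then have uc: "u \<in> carrier T" using tensors_carrier by blast
  have "conic T tensors 1 (madd T (munit T 1 (complex_of_real \<epsilon>)) (mat 1 1 (\<lambda>_. u)))" if \<epsilon>: "\<epsilon> > 0" for \<epsilon>
  proof (rule T.conicI[where F = "{True, False}" and u = "\<lambda>z. if z then \<one>\<^bsub>T\<^esub> else u"
        and b = "\<lambda>z _. if z then complex_of_real (sqrt \<epsilon>) else 1"])
    fix i j :: nat assume "i < 1" "j < 1"
    have "complex_of_real (sqrt \<epsilon>) * complex_of_real (sqrt \<epsilon>) = complex_of_real \<epsilon>"
      using \<epsilon> by (simp flip: of_real_mult)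
    then show "madd T (munit T 1 (complex_of_real \<epsilon>)) (mat 1 1 (\<lambda>_. u)) $$ (i, j) =
      (\<Oplus>\<^bsub>T\<^esub>z\<in>{True, False}. ((if z then complex_of_real (sqrt \<epsilon>) else 1) *
          cnj (if z then complex_of_real (sqrt \<epsilon>) else 1)) \<odot>\<^bsub>T\<^esub> (if z then \<one>\<^bsub>T\<^esub> else u))"
      unfolding unit_plus_1x1[OF uc] using \<open>i < 1\<close> \<open>j < 1\<close> uc one_T T.smult_one[simplified, OF uc] by simp
  qed (use u one_in_tensors tensors_carrier in \<open>auto simp: madd_def munit_def\<close>)
  then have "mat 1 1 (\<lambda>_. u) \<in> matpos MT 1"
    unfolding matpos_iff using uc by (auto simp: mats_def elements_mat_def)
  then show "u \<in> pos_elems MT" using uc by (simp add: pos_elems_def MT_simps)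
qed

lemma pos_almost_tensor:
  assumes u: "u \<in> pos_elems MT" and \<epsilon>: "\<epsilon> > 0"
  shows "conic T tensors 1 (mat 1 1 (\<lambda>_. complex_of_real \<epsilon> \<odot>\<^bsub>T\<^esub> \<one>\<^bsub>T\<^esub> \<oplus>\<^bsub>T\<^esub> u))"
proof -
  have uc: "u \<in> carrier T" and "mat 1 1 (\<lambda>_. u) \<in> matpos MT 1" using u by (auto simp: pos_elems_def MT_simps)
  then have "conic T tensors 1 (madd T (munit T 1 (complex_of_real \<epsilon>)) (mat 1 1 (\<lambda>_. u)))"
    using \<epsilon> unfolding matpos_iff by blast
  then show ?thesis unfolding unit_plus_1x1[OF uc] .
qed

lemma OMAX_matpos_iff:
  "X \<in> matpos (OMAX MT) n \<longleftrightarrow>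
    X \<in> mats T n \<and> (\<forall>\<epsilon>>0. conic T (pos_elems MT) n (madd T (munit T n (complex_of_real \<epsilon>)) X))"
proof -
  have "pos_elems MT \<subseteq> carrier T" using pos_elems_carrier[of MT] by (simp add: MT_simps)
  from T.conic_iff_compress[OF this] show ?thesis
    by (simp add: OMAX_def MT_mats)
qed

text \<open>Tensors of positive elements are positive at level one, which gives one inclusion. For the other,
  every positive element at level one is almost a conic combination of tensors.\<close>

theorem max_tensor_eq_OMAX: "matpos MT n = matpos (OMAX MT) n"
proof (rule subset_antisym; rule subsetI)
  fix X assume "X \<in> matpos MT n"
  then show "X \<in> matpos (OMAX MT) n"
    unfolding matpos_iff OMAX_matpos_iff using T.conic_mono[OF tensors_pos] by blast
next
  fix X assume X: "X \<in> matpos (OMAX MT) n"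
  have sub: "pos_elems MT \<subseteq> carrier T" using pos_elems_carrier[of MT] by (simp add: MT_simps)
  have "conic T tensors n (madd T (munit T n (complex_of_real \<epsilon>)) X)" if "\<epsilon> > 0" for \<epsilon>
  proof (rule T.conic_almost_trans[OF tensors_carrier one_in_tensors _ _ sub pos_almost_tensor that])
    show "X \<in> mats T n" using X unfolding OMAX_matpos_iff by blast
    show "conic T (pos_elems MT) n (madd T (munit T n (complex_of_real \<epsilon>)) X)" if "\<epsilon> > 0" for \<epsilon>
      using X that unfolding OMAX_matpos_iff by blast
  qed
  then show "X \<in> matpos MT n" using X unfolding matpos_iff OMAX_matpos_iff by blast
qed

text \<open>A positive map sends rank one terms to rank one terms with positive coefficients. It need not be
  unital, so \<open>\<phi> 1\<close> is first dominated by a multiple of the unit, by the order unit axiom; then the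
  Archimedean axiom removes \<open>\<epsilon>\<close>.\<close>

theorem positive_imp_completely_positive:
  fixes S :: "'t opsys"
  assumes S: "operator_system S" and lin: "linear_map MT S \<phi>" and pos: "positive_map MT S \<phi>"
  shows "completely_positive_map MT S \<phi>"
  unfolding completely_positive_map_def
proof (intro allI ballI)
  fix n X assume X: "X \<in> matpos MT n"
  interpret S: operator_system S by (rule S)
  interpret SM: complex_module S by (rule S.complex_module_axioms')
  have Xm: "X \<in> mats T n" using X unfolding matpos_iff by blast
  have Xd: "dim_row X = n" "dim_col X = n" using Xm by (auto simp: mats_def)
  have Xc: "X $$ (i, j) \<in> carrier T" if "i < n" "j < n" for i j
    using Xm elements_matI[of X n n i j, OF _ that refl] by (auto simp: mats_def)
  have \<phi>_closed: "\<phi> x \<in> carrier S" if "x \<in> carrier T" for x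
    using lin that by (simp add: linear_map_def MT_simps)
  have \<phi>_add: "\<phi> (x \<oplus>\<^bsub>T\<^esub> y) = \<phi> x \<oplus>\<^bsub>S\<^esub> \<phi> y" if "x \<in> carrier T" "y \<in> carrier T" for x y
    using lin that by (simp add: linear_map_def MT_simps)
  have \<phi>_smult: "\<phi> (c \<odot>\<^bsub>T\<^esub> x) = c \<odot>\<^bsub>S\<^esub> \<phi> x" if "x \<in> carrier T" for c x
    using lin that by (simp add: linear_map_def MT_simps)
  have \<phi>_zero: "\<phi> \<zero>\<^bsub>T\<^esub> = \<zero>\<^bsub>S\<^esub>"
    using \<phi>_smult[of "\<zero>\<^bsub>T\<^esub>" 0] T.smult_l_null[of "\<zero>\<^bsub>T\<^esub>"] S.smult_l_null[of "\<phi> \<zero>\<^bsub>T\<^esub>"] \<phi>_closed by simp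
  have \<phi>_finsum: "\<phi> (\<Oplus>\<^bsub>T\<^esub>m\<in>F. f m) = (\<Oplus>\<^bsub>S\<^esub>m\<in>F. \<phi> (f m))"
    if "finite F" "\<And>m. m \<in> F \<Longrightarrow> f m \<in> carrier T" for F :: "nat set" and f
    using that
  proof (induction F rule: finite_induct)
    case (insert m F)
    have "(\<Oplus>\<^bsub>T\<^esub>m\<in>insert m F. f m) = f m \<oplus>\<^bsub>T\<^esub> (\<Oplus>\<^bsub>T\<^esub>m\<in>F. f m)"
      using insert by (intro T.M.finsum_insert) auto
    moreover have "(\<Oplus>\<^bsub>S\<^esub>m\<in>insert m F. \<phi> (f m)) = \<phi> (f m) \<oplus>\<^bsub>S\<^esub> (\<Oplus>\<^bsub>S\<^esub>m\<in>F. \<phi> (f m))"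
      using insert \<phi>_closed by (intro S.M.finsum_insert) auto
    moreover have "(\<Oplus>\<^bsub>T\<^esub>m\<in>F. f m) \<in> carrier T" using insert by (intro T.M.finsum_closed) auto
    ultimately show ?case using insert by (simp add: \<phi>_add)
  qed (simp add: \<phi>_zero)
  have pos_\<phi>: "\<phi> u \<in> pos_elems S" if "u \<in> pos_elems MT" for u
    using pos that by (auto simp: positive_map_def)
  define e where "e = \<phi> \<one>\<^bsub>T\<^esub>"
  have e_pos: "e \<in> pos_elems S" unfolding e_def using one_in_tensors tensors_pos by (intro pos_\<phi>) blast
  have ec: "e \<in> carrier S" using e_pos by (simp add: pos_elems_def)
  define Y where "Y = map_mat \<phi> X"
  have Yc: "Y $$ (i, j) \<in> carrier S" if "i < n" "j < n" for i j
    using that Xc \<phi>_closed by (simp add: Y_def Xd)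
  have Yd: "dim_row Y = n" "dim_col Y = n" by (auto simp: Y_def Xd)
  have Ym: "Y \<in> mats S n"
    using Yc Yd by (auto simp: mats_def elements_mat_def)
  have "\<exists>r>0. complex_of_real r \<odot>\<^bsub>S\<^esub> \<one>\<^bsub>S\<^esub> \<oplus>\<^bsub>S\<^esub> (-1) \<odot>\<^bsub>S\<^esub> e \<in> pos_elems S"
  proof -
    let ?E = "mat 1 1 (\<lambda>_. (-1) \<odot>\<^bsub>S\<^esub> e)"
    have "madj S (mat 1 1 (\<lambda>_. e)) = mat 1 1 (\<lambda>_. e)"
      using S.matpos_hermitian e_pos by (auto simp: pos_elems_def)
    from arg_cong[OF this, of "\<lambda>A. A $$ (0, 0)"] have "star S e = e" by (simp add: madj_def)
    then have "madj S ?E = ?E" using ec by (intro eq_matI) (auto simp: madj_def S.star_smult)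
    moreover have "?E \<in> mats S 1" using ec by (auto simp: mats_def elements_mat_def)
    ultimately obtain r where r: "r > 0" "madd S (munit S 1 (complex_of_real r)) ?E \<in> matpos S 1"
      using S.matrix_order_unit by blast
    moreover have "madd S (munit S 1 (complex_of_real r)) ?E = mat 1 1 (\<lambda>_. complex_of_real r \<odot>\<^bsub>S\<^esub> \<one>\<^bsub>S\<^esub> \<oplus>\<^bsub>S\<^esub> (-1) \<odot>\<^bsub>S\<^esub> e)"
      by (rule eq_matI) (auto simp: madd_def munit_def)
    ultimately show ?thesis using ec S.one_closed by (auto simp: pos_elems_def)
  qed
  then obtain r where r: "r > 0" and w: "complex_of_real r \<odot>\<^bsub>S\<^esub> \<one>\<^bsub>S\<^esub> \<oplus>\<^bsub>S\<^esub> (-1) \<odot>\<^bsub>S\<^esub> e \<in> pos_elems S" by blast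
  define d where "d = complex_of_real r \<odot>\<^bsub>S\<^esub> \<one>\<^bsub>S\<^esub> \<oplus>\<^bsub>S\<^esub> (-1) \<odot>\<^bsub>S\<^esub> e"
  have dc: "d \<in> carrier S" using ec S.one_closed by (simp add: d_def)
  have pos: "madd S (munit S n (complex_of_real \<epsilon>)) Y \<in> matpos S n" if \<epsilon>: "\<epsilon> > 0" for \<epsilon>
  proof -
    define \<eta> where "\<eta> = \<epsilon> / r"
    have \<eta>: "\<eta> > 0" using \<epsilon> r by (simp add: \<eta>_def)
    have "conic T (pos_elems MT) n (madd T (munit T n (complex_of_real \<eta>)) X)"
      using X \<eta> T.conic_mono[OF tensors_pos] unfolding matpos_iff by blast
    then obtain N :: nat and b u where u: "\<And>m. m < N \<Longrightarrow> u m \<in> pos_elems MT"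
      and XN: "madd T (munit T n (complex_of_real \<eta>)) X =
        mat n n (\<lambda>(i, j). \<Oplus>\<^bsub>T\<^esub>m\<in>{..<N}. (b m i * cnj (b m j)) \<odot>\<^bsub>T\<^esub> u m)"
      by (rule conicE) (rule that)
    have uc: "u m \<in> carrier T" if "m < N" for m
      using u[OF that] pos_elems_carrier[of MT] by (auto simp: MT_simps)
    let ?Z = "mat n n (\<lambda>(i, j). \<Oplus>\<^bsub>S\<^esub>m\<in>{..<N}. (b m i * cnj (b m j)) \<odot>\<^bsub>S\<^esub> \<phi> (u m))"
    have Z: "?Z \<in> matpos S n"
      by (rule S.conic_matpos, unfold conic_def, rule exI[of _ N], rule exI[of _ b], rule exI[of _ "\<lambda>m. \<phi> (u m)"])
        (use u pos_\<phi> in auto)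
    let ?D = "mat n n (\<lambda>(i, j). if i = j then complex_of_real \<eta> \<odot>\<^bsub>S\<^esub> d else \<zero>\<^bsub>S\<^esub>)"
    have "conic S (pos_elems S) n ?D"
    proof (rule SM.conicI[where F = "{..<n}" and u = "\<lambda>_. d" and b = "\<lambda>m i. if i = m then complex_of_real (sqrt \<eta>) else 0"])
      fix i j assume ij: "i < n" "j < n"
      have sq: "complex_of_real (sqrt \<eta>) * complex_of_real (sqrt \<eta>) = complex_of_real \<eta>"
        using \<eta> by (simp flip: of_real_mult)
      have "(\<Oplus>\<^bsub>S\<^esub>m\<in>{..<n}. ((if i = m then complex_of_real (sqrt \<eta>) else 0) *
          cnj (if j = m then complex_of_real (sqrt \<eta>) else 0)) \<odot>\<^bsub>S\<^esub> d) =
          (\<Sum>m<n. (if i = m then complex_of_real (sqrt \<eta>) else 0) *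
          cnj (if j = m then complex_of_real (sqrt \<eta>) else 0)) \<odot>\<^bsub>S\<^esub> d"
        using dc by (intro SM.finsum_scalars) auto
      also have "(\<Sum>m<n. (if i = m then complex_of_real (sqrt \<eta>) else 0) *
          cnj (if j = m then complex_of_real (sqrt \<eta>) else 0)) = (\<Sum>m<n. if i = m then (if i = j then complex_of_real \<eta> else 0) else 0)"
        using sq by (intro sum.cong) auto
      also have "\<dots> \<odot>\<^bsub>S\<^esub> d = ?D $$ (i, j)"
        using ij S.smult_l_null[OF dc] by (simp add: sum.delta)
      finally show "?D $$ (i, j) = (\<Oplus>\<^bsub>S\<^esub>m\<in>{..<n}. ((if i = m then complex_of_real (sqrt \<eta>) else 0) *
          cnj (if j = m then complex_of_real (sqrt \<eta>) else 0)) \<odot>\<^bsub>S\<^esub> d)" by simp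
    qed (use w d_def pos_elems_carrier[of S] in auto)
    then have D: "?D \<in> matpos S n" by (rule S.conic_matpos)
    have "madd S ?Z ?D = madd S (munit S n (complex_of_real \<epsilon>)) Y"
    proof (rule eq_matI)
      fix i j assume "i < dim_row (madd S (munit S n (complex_of_real \<epsilon>)) Y)"
        "j < dim_col (madd S (munit S n (complex_of_real \<epsilon>)) Y)"
      then have ij: "i < n" "j < n" by (auto simp: madd_def munit_def)
      let ?c = "if i = j then complex_of_real \<eta> else 0"
      have "\<phi> (\<Oplus>\<^bsub>T\<^esub>m\<in>{..<N}. (b m i * cnj (b m j)) \<odot>\<^bsub>T\<^esub> u m) = (\<Oplus>\<^bsub>S\<^esub>m\<in>{..<N}. (b m i * cnj (b m j)) \<odot>\<^bsub>S\<^esub> \<phi> (u m))"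
        using uc \<phi>_closed by (subst \<phi>_finsum) (auto simp: \<phi>_smult intro!: S.M.finsum_cong')
      moreover have "(\<Oplus>\<^bsub>T\<^esub>m\<in>{..<N}. (b m i * cnj (b m j)) \<odot>\<^bsub>T\<^esub> u m) = ?c \<odot>\<^bsub>T\<^esub> \<one>\<^bsub>T\<^esub> \<oplus>\<^bsub>T\<^esub> X $$ (i, j)"
      proof -
        have "(\<Oplus>\<^bsub>T\<^esub>m\<in>{..<N}. (b m i * cnj (b m j)) \<odot>\<^bsub>T\<^esub> u m) = madd T (munit T n (complex_of_real \<eta>)) X $$ (i, j)"
          unfolding XN using ij by simp
        also have "\<dots> = ?c \<odot>\<^bsub>T\<^esub> \<one>\<^bsub>T\<^esub> \<oplus>\<^bsub>T\<^esub> X $$ (i, j)"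
          using ij T.smult_l_null[OF one_T] by (simp add: madd_def munit_def)
        finally show ?thesis .
      qed
      ultimately have "?Z $$ (i, j) = ?c \<odot>\<^bsub>S\<^esub> e \<oplus>\<^bsub>S\<^esub> Y $$ (i, j)"
        using ij Xc[OF ij] one_T by (simp add: \<phi>_add \<phi>_smult e_def Y_def Xd)
      moreover have "?D $$ (i, j) = ?c \<odot>\<^bsub>S\<^esub> d" using ij S.smult_l_null[OF dc] by simp
      ultimately have "madd S ?Z ?D $$ (i, j) = (?c \<odot>\<^bsub>S\<^esub> e \<oplus>\<^bsub>S\<^esub> Y $$ (i, j)) \<oplus>\<^bsub>S\<^esub> ?c \<odot>\<^bsub>S\<^esub> d"
        using ij by (simp add: madd_def)
      also have "\<dots> = (?c \<odot>\<^bsub>S\<^esub> e \<oplus>\<^bsub>S\<^esub> ?c \<odot>\<^bsub>S\<^esub> d) \<oplus>\<^bsub>S\<^esub> Y $$ (i, j)"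
        using ec dc Yc[OF ij] S.M.a_assoc S.M.a_comm by (simp add: S.M.a_ac)
      also have "?c \<odot>\<^bsub>S\<^esub> e \<oplus>\<^bsub>S\<^esub> ?c \<odot>\<^bsub>S\<^esub> d = ?c \<odot>\<^bsub>S\<^esub> (e \<oplus>\<^bsub>S\<^esub> d)"
        using ec dc by (simp add: S.smult_r_distr)
      also have "e \<oplus>\<^bsub>S\<^esub> d = complex_of_real r \<odot>\<^bsub>S\<^esub> \<one>\<^bsub>S\<^esub>"
        using ec S.one_closed unfolding d_def SM.smult_minus_one[OF ec]
        by (simp add: S.M.a_comm[of "complex_of_real r \<odot>\<^bsub>S\<^esub> \<one>\<^bsub>S\<^esub>"] S.M.r_neg2)
      also have "?c \<odot>\<^bsub>S\<^esub> (complex_of_real r \<odot>\<^bsub>S\<^esub> \<one>\<^bsub>S\<^esub>) = (if i = j then complex_of_real \<epsilon> \<odot>\<^bsub>S\<^esub> \<one>\<^bsub>S\<^esub> else \<zero>\<^bsub>S\<^esub>)"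
      proof -
        have "complex_of_real \<eta> * complex_of_real r = complex_of_real \<epsilon>"
          using r by (simp add: \<eta>_def)
        then show ?thesis
          using S.one_closed S.smult_l_null[of "complex_of_real r \<odot>\<^bsub>S\<^esub> \<one>\<^bsub>S\<^esub>"]
          by (simp add: S.smult_assoc1[simplified, symmetric] del: of_real_mult)
      qed
      also have "\<dots> \<oplus>\<^bsub>S\<^esub> Y $$ (i, j) = madd S (munit S n (complex_of_real \<epsilon>)) Y $$ (i, j)"
        using ij by (simp add: madd_def munit_def)
      finally show "madd S ?Z ?D $$ (i, j) = madd S (munit S n (complex_of_real \<epsilon>)) Y $$ (i, j)" .
    qed (auto simp: madd_def munit_def)
    then show ?thesis using S.matpos_add[OF Z D] by simp
  qed
  \<comment> \<open>the shift of \<open>Y\<close> by the unit is positive, hence hermitian, and the unit is hermitian\<close>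
  have "madj S Y = Y"
  proof (rule eq_matI)
    fix i j assume "i < dim_row Y" "j < dim_col Y"
    then have ij: "i < n" "j < n" by (auto simp: Yd)
    define q where "q = (if i = j then complex_of_real 1 \<odot>\<^bsub>S\<^esub> \<one>\<^bsub>S\<^esub> else \<zero>\<^bsub>S\<^esub>)"
    have qc: "q \<in> carrier S" using S.one_closed by (simp add: q_def)
    have star0: "star S \<zero>\<^bsub>S\<^esub> = \<zero>\<^bsub>S\<^esub>"
      using S.star_smult[of "\<zero>\<^bsub>S\<^esub>" 0] S.smult_l_null[of "\<zero>\<^bsub>S\<^esub>"] S.smult_l_null[of "star S \<zero>\<^bsub>S\<^esub>"] S.star_closed[of "\<zero>\<^bsub>S\<^esub>"] by simp
    have sq: "star S q = q" using S.one_closed by (auto simp: q_def S.star_smult S.star_one star0)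
    note sY = S.star_closed[OF Yc[OF ij(2,1)]]
    have "madj S (madd S (munit S n (complex_of_real 1)) Y) = madd S (munit S n (complex_of_real 1)) Y"
      using S.matpos_hermitian[OF pos[of 1]] by simp
    from arg_cong[OF this, of "\<lambda>A. A $$ (i, j)"]
    have "star S (q \<oplus>\<^bsub>S\<^esub> Y $$ (j, i)) = q \<oplus>\<^bsub>S\<^esub> Y $$ (i, j)"
      using ij by (cases "i = j") (simp_all add: madj_def madd_def munit_def q_def)
    then have "q \<oplus>\<^bsub>S\<^esub> star S (Y $$ (j, i)) = q \<oplus>\<^bsub>S\<^esub> Y $$ (i, j)"
      using S.star_add[OF qc Yc[OF ij(2,1)]] unfolding sq by simp
    then have "star S (Y $$ (j, i)) \<oplus>\<^bsub>S\<^esub> q = Y $$ (i, j) \<oplus>\<^bsub>S\<^esub> q"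
      using S.M.a_comm[OF qc sY] S.M.a_comm[OF qc Yc[OF ij]] by simp
    then have "star S (Y $$ (j, i)) = Y $$ (i, j)"
      using S.M.add.right_cancel[OF qc sY Yc[OF ij]] by blast
    then show "madj S Y $$ (i, j) = Y $$ (i, j)" using ij by (simp add: madj_def Yd)
  qed (auto simp: madj_def Yd)
  then show "map_mat \<phi> X \<in> matpos S n"
    using S.matrix_archimedean[OF Ym] pos unfolding Y_def by blast
qed

end

section \<open>The operator systems NC(d) and NCP(k)\<close>

context seminormed_star_algebra
begin

lemma mult_zero_l: "x \<in> carrier A \<Longrightarrow> \<zero> \<otimes> x = \<zero>"
  using smult_mult_l[of "\<zero>" x 0] smult_l_null[of "\<zero>"] smult_l_null[of "\<zero> \<otimes> x"] mult_closed by simp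

lemma mult_zero_r: "x \<in> carrier A \<Longrightarrow> x \<otimes> \<zero> = \<zero>"
  using smult_mult_r[of x "\<zero>" 0] smult_l_null[of "\<zero>"] smult_l_null[of "x \<otimes> \<zero>"] mult_closed by simp

lemma star_zero: "star A \<zero> = \<zero>"
  using star_smult[of "\<zero>" 0] smult_l_null[of "\<zero>"] smult_l_null[of "star A \<zero>"] star_closed by simp

lemma star_finsum:
  "finite F \<Longrightarrow> (\<And>k. k \<in> F \<Longrightarrow> f k \<in> carrier A) \<Longrightarrow> star A (\<Oplus>k\<in>F. f k) = (\<Oplus>k\<in>F. star A (f k))"
proof (induction F rule: finite_induct)
  case empty
  then show ?case by (simp add: star_zero)
next
  case (insert k F)
  have "(\<Oplus>k\<in>insert k F. f k) = f k \<oplus> (\<Oplus>k\<in>F. f k)"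
    using insert by (intro M.finsum_insert) auto
  moreover have "(\<Oplus>k\<in>F. f k) \<in> carrier A" using insert by (intro M.finsum_closed) auto
  moreover have "(\<Oplus>k\<in>insert k F. star A (f k)) = star A (f k) \<oplus> (\<Oplus>k\<in>F. star A (f k))"
    using insert star_closed by (intro M.finsum_insert) auto
  ultimately show ?case using insert by (simp add: star_add)
qed

lemma Q_mult_zero:
  assumes "X \<in> carrier Q.Q"
  shows "\<zero>\<^bsub>Q.Q\<^esub> \<otimes>\<^bsub>Q.Q\<^esub> X = \<zero>\<^bsub>Q.Q\<^esub>" "X \<otimes>\<^bsub>Q.Q\<^esub> \<zero>\<^bsub>Q.Q\<^esub> = \<zero>\<^bsub>Q.Q\<^esub>"
proof -
  obtain x where x: "x \<in> carrier C" "X = Q.coset x" using assms by (auto simp: Q.Q_carrier)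
  have z: "(\<lambda>_. \<zero>) \<in> carrier C" by (simp add: const_C)
  show "\<zero>\<^bsub>Q.Q\<^esub> \<otimes>\<^bsub>Q.Q\<^esub> X = \<zero>\<^bsub>Q.Q\<^esub>" "X \<otimes>\<^bsub>Q.Q\<^esub> \<zero>\<^bsub>Q.Q\<^esub> = \<zero>\<^bsub>Q.Q\<^esub>"
    unfolding x(2) Q.coset_zero using x(1) z
    by (simp_all add: coset_mult mult_zero_l mult_zero_r C_in)
qed

lemma Q_star_zero: "star Q.Q \<zero>\<^bsub>Q.Q\<^esub> = \<zero>\<^bsub>Q.Q\<^esub>"
  unfolding emb_zero by (simp add: emb_star star_zero)

lemma Q_star_closed: "X \<in> carrier Q.Q \<Longrightarrow> star Q.Q X \<in> carrier Q.Q"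
  by (auto simp: Q.Q_carrier coset_star C_star)

lemma Q_mult_closed: "X \<in> carrier Q.Q \<Longrightarrow> Y \<in> carrier Q.Q \<Longrightarrow> X \<otimes>\<^bsub>Q.Q\<^esub> Y \<in> carrier Q.Q"
  by (auto simp: Q.Q_carrier coset_mult C_mult)

end

context cyclic_free_product
begin

interpretation SA: seminormed_star_algebra FPG.CG FPG.MN
  by (rule FPG.seminormed_CG)

interpretation QM: complex_module SA.Q.Q
  by (rule complex_module.intro) (rule SA.Q.quotient_module)

lemma full_group_cstar_eq: "full_group_cstar FP = SA.Q.Q"
  by (simp add: full_group_cstar_def SA.completion_eq)

lemma group_unitary_eq: "group_unitary FP g = SA.emb (delta g)"
  by (simp add: group_unitary_def SA.emb_def)

text \<open>The span of the one-letter words in the C*-algebra of a free product of cyclic groups, a common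
  generalisation of \<^const>\<open>NC\<close> and \<^const>\<open>NCP\<close>.\<close>

definition span_system :: "(nat \<Rightarrow> ('i \<times> int) list \<Rightarrow> complex) set opsys" where
  "span_system = opsys_in (full_group_cstar FP) (cspan (full_group_cstar FP) (group_unitary FP ` letters))"

abbreviation E where "E \<equiv> cspan SA.Q.Q ((\<lambda>g. SA.emb (delta g)) ` letters)"

lemma span_system_simps:
  "carrier span_system = E" "add span_system = add SA.Q.Q" "zero span_system = zero SA.Q.Q"
  "one span_system = one SA.Q.Q" "smult span_system = smult SA.Q.Q" "star span_system = star SA.Q.Q"
  "matpos span_system n = {X. X \<in> mats \<lparr>carrier = E\<rparr> n \<and> (\<exists>Y\<in>mats SA.Q.Q n. X = mmult SA.Q.Q (madj SA.Q.Q Y) Y)}"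
  by (simp_all add: span_system_def opsys_in_def full_group_cstar_eq group_unitary_eq[abs_def])

lemma letters_delta: "g \<in> letters \<Longrightarrow> delta g \<in> carrier FPG.CG"
  using letters_closed by (auto intro: finsupp_delta)

lemma E_submodule: "submodule E complex_ring SA.Q.Q"
  by (rule QM.cspan_submodule) (auto intro: SA.emb_closed letters_delta)

lemmas E_D = QM.submodule_complexD[OF E_submodule]

lemma finsupp_letters_carrier: "a \<in> finsupp letters \<Longrightarrow> a \<in> carrier FPG.CG"
  using finsupp_mono[OF letters_closed] by auto

lemma E_sub: "E \<subseteq> SA.emb ` finsupp letters"
proof (rule cspan_least)
  show "submodule (SA.emb ` finsupp letters) complex_ring SA.Q.Q"
  proof (rule QM.submodule_complexI)
    show "SA.emb ` finsupp letters \<subseteq> carrier SA.Q.Q" using SA.emb_closed finsupp_letters_carrier by blast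
    show "\<zero>\<^bsub>SA.Q.Q\<^esub> \<in> SA.emb ` finsupp letters"
      unfolding SA.emb_zero by (intro imageI) (simp add: finsupp_zero)
    show "x \<oplus>\<^bsub>SA.Q.Q\<^esub> y \<in> SA.emb ` finsupp letters"
      if xy: "x \<in> SA.emb ` finsupp letters" "y \<in> SA.emb ` finsupp letters" for x y
    proof -
      obtain a b where ab: "x = SA.emb a" "y = SA.emb b" "a \<in> finsupp letters" "b \<in> finsupp letters" using xy by blast
      have "x \<oplus>\<^bsub>SA.Q.Q\<^esub> y = SA.emb (\<lambda>g. a g + b g)"
        unfolding ab(1,2) using SA.emb_add[OF finsupp_letters_carrier[OF ab(3)] finsupp_letters_carrier[OF ab(4)]] by simp
      then show ?thesis using finsupp_add[OF ab(3,4)] by (rule image_eqI)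
    qed
    show "c \<odot>\<^bsub>SA.Q.Q\<^esub> x \<in> SA.emb ` finsupp letters" if x: "x \<in> SA.emb ` finsupp letters" for c x
    proof -
      obtain a where a: "x = SA.emb a" "a \<in> finsupp letters" using x by blast
      have "c \<odot>\<^bsub>SA.Q.Q\<^esub> x = SA.emb (\<lambda>g. c * a g)"
        unfolding a(1) using SA.emb_smult[OF finsupp_letters_carrier[OF a(2)], of c] by simp
      then show ?thesis using finsupp_smult[OF a(2)] by (rule image_eqI)
    qed
  qed
  show "(\<lambda>g. SA.emb (delta g)) ` letters \<subseteq> SA.emb ` finsupp letters"
    by (auto intro: finsupp_delta)
qed

lemma emb_in_E:
  assumes a: "a \<in> finsupp letters"
  shows "SA.emb a \<in> E"
proof -
  have "SA.emb (\<lambda>x. \<Sum>g\<in>S. a g * delta g x) \<in> E" if "finite S" "S \<subseteq> letters" for S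
    using that
  proof (induction S rule: finite_induct)
    case empty
    then show ?case using E_D(2) by (simp add: SA.emb_zero)
  next
    case (insert g S)
    have gl: "g \<in> letters" using insert.prems by simp
    have g: "delta g \<in> carrier FPG.CG" by (rule letters_delta[OF gl])
    have gE: "SA.emb (delta g) \<in> E" using gl by (intro cspan_base) (rule imageI)
    have sm: "SA.emb (\<lambda>x. a g * delta g x) = a g \<odot>\<^bsub>SA.Q.Q\<^esub> SA.emb (delta g)"
      using SA.emb_smult[OF g, of "a g"] by simp
    have S: "(\<lambda>x. \<Sum>g\<in>S. a g * delta g x) \<in> carrier FPG.CG"
      using insert letters_closed finsupp_delta[of _ "carrier FP"]
      by (simp, intro finsupp_sum finsupp_smult) (auto simp: subset_iff)
    have "SA.emb (\<lambda>x. \<Sum>g\<in>insert g S. a g * delta g x) =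
        SA.emb (\<lambda>x. a g * delta g x) \<oplus>\<^bsub>SA.Q.Q\<^esub> SA.emb (\<lambda>x. \<Sum>g\<in>S. a g * delta g x)"
      using insert.hyps g S by (subst SA.emb_add) (auto intro: finsupp_smult)
    also have "\<dots> \<in> E"
      unfolding sm using insert by (intro E_D(3) E_D(4) gE) auto
    finally show ?case .
  qed
  from this[of "{g. a g \<noteq> 0}"] finsuppD[OF a]
  have "SA.emb (\<lambda>x. \<Sum>g\<in>{g. a g \<noteq> 0}. a g * delta g x) \<in> E" by blast
  moreover have "(\<lambda>x. \<Sum>g\<in>{g. a g \<noteq> 0}. a g * delta g x) = a"
  proof
    fix x
    have "(\<Sum>g\<in>{g. a g \<noteq> 0}. a g * delta g x) = (\<Sum>g\<in>{g. a g \<noteq> 0}. if g = x then a x else 0)"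
      by (intro sum.cong) (auto simp: delta_def)
    then show "(\<Sum>g\<in>{g. a g \<noteq> 0}. a g * delta g x) = a x" using finsuppD(1)[OF a] by (simp add: sum.delta)
  qed
  ultimately show ?thesis by simp
qed

lemma E_carrier: "x \<in> E \<Longrightarrow> x \<in> carrier SA.Q.Q"
  using E_D(1) by blast

lemma span_system_module: "complex_module span_system"
proof (intro complex_module.intro complex_moduleI)
  show "x \<oplus>\<^bsub>span_system\<^esub> y = y \<oplus>\<^bsub>span_system\<^esub> x" if "x \<in> carrier span_system" "y \<in> carrier span_system" for x y
    using that QM.M.a_comm E_carrier by (simp add: span_system_simps)
qed (auto simp: span_system_simps E_carrier QM.M.a_assoc QM.smult_r_distr QM.smult_l_distr[simplified]
    QM.smult_assoc1[simplified] QM.smult_l_null[simplified] QM.smult_one[simplified] intro: E_D(2-4))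

lemma span_system_finsum:
  "finite F \<Longrightarrow> (\<And>k. k \<in> F \<Longrightarrow> f k \<in> E) \<Longrightarrow> finsum span_system f F = finsum SA.Q.Q f F"
proof (induction F rule: finite_induct)
  case empty
  interpret SS: complex_module span_system by (rule span_system_module)
  show ?case by (simp add: span_system_simps)
next
  case (insert k F)
  interpret SS: complex_module span_system by (rule span_system_module)
  have "finsum span_system f (insert k F) = f k \<oplus>\<^bsub>span_system\<^esub> finsum span_system f F"
    using insert by (intro SS.M.finsum_insert) (auto simp: span_system_simps)
  also have "\<dots> = f k \<oplus>\<^bsub>SA.Q.Q\<^esub> finsum SA.Q.Q f F" using insert by (simp add: span_system_simps)
  also have "\<dots> = finsum SA.Q.Q f (insert k F)"
    using insert E_carrier by (intro QM.M.finsum_insert[symmetric]) auto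
  finally show ?case .
qed

lemma pos_elems_iff:
  "s \<in> pos_elems span_system \<longleftrightarrow> s \<in> E \<and> (\<exists>y\<in>carrier SA.Q.Q. s = star SA.Q.Q y \<otimes>\<^bsub>SA.Q.Q\<^esub> y)"
proof -
  have sq: "mmult SA.Q.Q (madj SA.Q.Q Y) Y = mat 1 1 (\<lambda>_. star SA.Q.Q (Y $$ (0, 0)) \<otimes>\<^bsub>SA.Q.Q\<^esub> Y $$ (0, 0))"
    if "Y \<in> mats SA.Q.Q 1" for Y
  proof -
    have Y: "Y \<in> carrier_mat 1 1" "Y $$ (0, 0) \<in> carrier SA.Q.Q"
      using that elements_matI[of Y 1 1 0 0, OF _ _ _ refl] by (auto simp: mats_def)
    then show ?thesis
      using SA.Q_mult_closed[OF SA.Q_star_closed[OF Y(2)] Y(2)]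
      by (intro eq_matI) (auto simp: mmult_def madj_def lessThan_Suc)
  qed
  have "(\<exists>Y\<in>mats SA.Q.Q 1. mat 1 1 (\<lambda>_. s) = mmult SA.Q.Q (madj SA.Q.Q Y) Y) \<longleftrightarrow>
      (\<exists>y\<in>carrier SA.Q.Q. s = star SA.Q.Q y \<otimes>\<^bsub>SA.Q.Q\<^esub> y)"
  proof
    assume "\<exists>Y\<in>mats SA.Q.Q 1. mat 1 1 (\<lambda>_. s) = mmult SA.Q.Q (madj SA.Q.Q Y) Y"
    then obtain Y where Y: "Y \<in> mats SA.Q.Q 1" "mat 1 1 (\<lambda>_. s) = mmult SA.Q.Q (madj SA.Q.Q Y) Y" by blast
    have "Y $$ (0, 0) \<in> carrier SA.Q.Q"
      using Y(1) elements_matI[of Y 1 1 0 0, OF _ _ _ refl] by (auto simp: mats_def)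
    moreover have "s = star SA.Q.Q (Y $$ (0, 0)) \<otimes>\<^bsub>SA.Q.Q\<^esub> Y $$ (0, 0)"
      using arg_cong[OF Y(2)[unfolded sq[OF Y(1)]], of "\<lambda>A. A $$ (0, 0)"] by simp
    ultimately show "\<exists>y\<in>carrier SA.Q.Q. s = star SA.Q.Q y \<otimes>\<^bsub>SA.Q.Q\<^esub> y" by blast
  next
    assume "\<exists>y\<in>carrier SA.Q.Q. s = star SA.Q.Q y \<otimes>\<^bsub>SA.Q.Q\<^esub> y"
    then obtain y where y: "y \<in> carrier SA.Q.Q" "s = star SA.Q.Q y \<otimes>\<^bsub>SA.Q.Q\<^esub> y" by blast
    have m: "mat 1 1 (\<lambda>_. y) \<in> mats SA.Q.Q 1" using y(1) by (auto simp: mats_def elements_mat_def)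
    show "\<exists>Y\<in>mats SA.Q.Q 1. mat 1 1 (\<lambda>_. s) = mmult SA.Q.Q (madj SA.Q.Q Y) Y"
      by (rule bexI[OF _ m]) (simp add: sq[OF m, simplified] y(2))
  qed
  moreover have "s \<in> E \<Longrightarrow> mat 1 1 (\<lambda>_. s) \<in> mats \<lparr>carrier = E\<rparr> 1"
    by (auto simp: mats_def elements_mat_def)
  ultimately show ?thesis by (auto simp: pos_elems_def span_system_simps)
qed

text \<open>A projection is \<open>e\<^sup>* e\<close>.\<close>

lemma emb_proj_pos:
  assumes i: "i \<in> I"
  shows "SA.emb (proj i j) \<in> pos_elems span_system"
proof -
  have p: "proj i j \<in> carrier FPG.CG" using proj_closed[OF i] by simp
  have "star SA.Q.Q (SA.emb (proj i j)) \<otimes>\<^bsub>SA.Q.Q\<^esub> SA.emb (proj i j) = SA.emb (proj i j)"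
    using p proj_star[OF i] proj_idem[OF i] by (simp add: SA.emb_star SA.emb_mult)
  then show ?thesis
    unfolding pos_elems_iff using emb_in_E[OF proj_letters[OF i]] SA.emb_closed[OF p] by metis
qed

lemma one_in_pos:
  assumes "I \<noteq> {}"
  shows "\<one>\<^bsub>span_system\<^esub> \<in> pos_elems span_system"
proof -
  have nil: "[] \<in> letters" using assms K_pos by (force simp: letters_def letter_def)
  have d: "delta [] \<in> carrier FPG.CG" by (rule letters_delta[OF nil])
  have one: "\<one>\<^bsub>span_system\<^esub> = SA.emb (delta [])"
    by (simp add: span_system_simps SA.emb_one free_product_one)
  have n: "[] \<in> carrier FP" by (rule free_product_carrier_Nil)
  have m: "delta [] \<otimes>\<^bsub>FPG.CG\<^esub> delta [] = delta []"
    using FPG.CG_mult_delta[OF n n] by (simp add: free_product_mult)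
  have "inv\<^bsub>FP\<^esub> [] = []" using FPG.inv_one by (simp add: free_product_one)
  then have s: "star FPG.CG (delta []) = delta []" using FPG.CG_star_delta[OF n] by simp
  have "star SA.Q.Q (SA.emb (delta [])) \<otimes>\<^bsub>SA.Q.Q\<^esub> SA.emb (delta []) = SA.emb (delta [])"
    using d by (simp add: SA.emb_star SA.emb_mult m s del: FPG.CG_simps)
  moreover have "SA.emb (delta []) \<in> E" using nil by (intro cspan_base) blast
  ultimately show ?thesis unfolding one pos_elems_iff using SA.emb_closed[OF d] by metis
qed

lemma mdiag_in_matpos:
  assumes ss: "set ss \<subseteq> pos_elems span_system"
  shows "mdiag span_system ss \<in> matpos span_system (length ss)"
proof -
  let ?n = "length ss"
  have "\<forall>k. \<exists>y. k < ?n \<longrightarrow> y \<in> carrier SA.Q.Q \<and> ss ! k = star SA.Q.Q y \<otimes>\<^bsub>SA.Q.Q\<^esub> y"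
    using ss nth_mem[of _ ss] unfolding pos_elems_iff subset_iff by blast
  then obtain y where "\<forall>k. k < ?n \<longrightarrow> y k \<in> carrier SA.Q.Q \<and> ss ! k = star SA.Q.Q (y k) \<otimes>\<^bsub>SA.Q.Q\<^esub> y k"
    by (rule choice[THEN exE])
  then have y: "y k \<in> carrier SA.Q.Q" "ss ! k = star SA.Q.Q (y k) \<otimes>\<^bsub>SA.Q.Q\<^esub> y k" if "k < ?n" for k
    using that by auto
  have sE: "ss ! k \<in> E" if "k < ?n" for k
    using ss nth_mem[OF that] by (auto simp: pos_elems_iff)
  define Y where "Y = mat ?n ?n (\<lambda>(i, j). if i = j then y i else \<zero>\<^bsub>SA.Q.Q\<^esub>)"
  have Y: "Y \<in> mats SA.Q.Q ?n"
    using y(1) by (auto simp: Y_def mats_def elements_mat_def)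
  have "mdiag span_system ss = mmult SA.Q.Q (madj SA.Q.Q Y) Y"
  proof (rule eq_matI)
    fix i j assume "i < dim_row (mmult SA.Q.Q (madj SA.Q.Q Y) Y)" "j < dim_col (mmult SA.Q.Q (madj SA.Q.Q Y) Y)"
    then have ij: "i < ?n" "j < ?n" by (auto simp: mmult_def madj_def Y_def)
    have "mmult SA.Q.Q (madj SA.Q.Q Y) Y $$ (i, j) =
        (\<Oplus>\<^bsub>SA.Q.Q\<^esub>k\<in>{..<?n}. star SA.Q.Q (Y $$ (k, i)) \<otimes>\<^bsub>SA.Q.Q\<^esub> Y $$ (k, j))"
    proof -
      have dim: "dim_row Y = ?n" "dim_col Y = ?n" by (auto simp: Y_def)
      have Yc: "Y $$ (k, l) \<in> carrier SA.Q.Q" if "k < ?n" "l < ?n" for k l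
        using that y(1) by (simp add: Y_def)
      have "mmult SA.Q.Q (madj SA.Q.Q Y) Y $$ (i, j) =
          (\<Oplus>\<^bsub>SA.Q.Q\<^esub>k\<in>{..<?n}. madj SA.Q.Q Y $$ (i, k) \<otimes>\<^bsub>SA.Q.Q\<^esub> Y $$ (k, j))"
        using ij dim by (simp add: mmult_def madj_def)
      also have "\<dots> = (\<Oplus>\<^bsub>SA.Q.Q\<^esub>k\<in>{..<?n}. star SA.Q.Q (Y $$ (k, i)) \<otimes>\<^bsub>SA.Q.Q\<^esub> Y $$ (k, j))"
        using ij dim Yc SA.Q_mult_closed SA.Q_star_closed
        by (intro QM.M.finsum_cong' refl) (simp_all add: madj_def Pi_def)
      finally show ?thesis .
    qed
    also have "\<dots> = (\<Oplus>\<^bsub>SA.Q.Q\<^esub>k\<in>{..<?n}. if i = k then (if i = j then ss ! i else \<zero>\<^bsub>SA.Q.Q\<^esub>) else \<zero>\<^bsub>SA.Q.Q\<^esub>)"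
      using ij y sE[THEN E_carrier] SA.Q_star_closed
      by (intro QM.M.finsum_cong' refl) (auto simp: Y_def SA.Q_mult_zero SA.Q_star_zero)
    also have "\<dots> = (if i = j then ss ! i else \<zero>\<^bsub>SA.Q.Q\<^esub>)"
      using ij sE[THEN E_carrier] by (intro QM.M.finsum_singleton) auto
    finally show "mdiag span_system ss $$ (i, j) = mmult SA.Q.Q (madj SA.Q.Q Y) Y $$ (i, j)"
      using ij by (simp add: mdiag_def span_system_simps)
  qed (auto simp: mdiag_def mmult_def madj_def Y_def)
  moreover have "mdiag span_system ss \<in> mats \<lparr>carrier = E\<rparr> ?n"
    using sE E_D(2) by (auto simp: mats_def mdiag_def elements_mat_def span_system_simps)
  ultimately show ?thesis using Y by (auto simp: span_system_simps)
qed

lemma letters_inv: "g \<in> letters \<Longrightarrow> inv\<^bsub>FP\<^esub> g \<in> letters"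
proof -
  assume "g \<in> letters"
  then obtain i h where i: "i \<in> I" "h < K i" "g = letter i h" by (auto simp: letters_def)
  have "(K i - h) mod K i < K i" using K_pos[OF i(1)] by simp
  then show ?thesis unfolding i(3) letter_inv[OF i(1,2)] using i(1) by (auto simp: letters_def)
qed

lemma star_letters:
  assumes a: "a \<in> finsupp letters"
  shows "star FPG.CG a \<in> finsupp letters"
proof -
  have ac: "a \<in> finsupp (carrier FP)" using finsupp_letters_carrier[OF a] by simp
  have "{x. star FPG.CG a x \<noteq> 0} \<subseteq> letters"
    using FPG.CG_star_support[of a] finsuppD(2)[OF a] letters_inv by blast
  then show ?thesis using finsuppD(1)[OF FPG.CG_star_closed[OF ac]] by (simp add: finsupp_def)
qed

text \<open>Lift the entries of \<open>X = Y\<^sup>* Y\<close> to the span of the letters and apply the decomposition. Distinct lifts of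
  an entry are not excluded, so hermitian symmetry is enforced by averaging with the adjoint, which
  does not change the class because \<open>X\<close> is hermitian.\<close>

theorem matpos_conic_span:
  assumes I: "finite I" "I \<noteq> {}" and X: "X \<in> matpos span_system n"
  shows "conic span_system (pos_elems span_system) n X"
proof -
  interpret SS: complex_module span_system by (rule span_system_module)
  obtain Y where XE: "X \<in> mats \<lparr>carrier = E\<rparr> n" and Y: "Y \<in> mats SA.Q.Q n"
    and XY: "X = mmult SA.Q.Q (madj SA.Q.Q Y) Y"
    using X by (auto simp: span_system_simps)
  have Yd: "Y \<in> carrier_mat n n" and Xd: "X \<in> carrier_mat n n"
    using Y XE by (simp_all add: mats_def)
  have Yc: "Y $$ (m, k) \<in> carrier SA.Q.Q" if "m < n" "k < n" for m k
    using Y elements_matI[OF Yd that refl] unfolding mats_def by blast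
  have Xc: "X $$ (k, l) \<in> E" if "k < n" "l < n" for k l
    using XE elements_matI[OF Xd that refl] by (auto simp: mats_def)
  define y where "y m k = (SOME y. y \<in> carrier SA.C \<and> Y $$ (m, k) = SA.Q.coset y)" for m k
  have "y m k \<in> carrier SA.C \<and> Y $$ (m, k) = SA.Q.coset (y m k)" if "m < n" "k < n" for m k
  proof -
    have "\<exists>y. y \<in> carrier SA.C \<and> Y $$ (m, k) = SA.Q.coset y"
      using Yc[OF that] unfolding SA.Q.Q_carrier by blast
    from someI_ex[OF this] show ?thesis unfolding y_def .
  qed
  then have y: "\<And>m k. m < n \<Longrightarrow> k < n \<Longrightarrow> y m k \<in> carrier SA.C"
    and Yy: "\<And>m k. m < n \<Longrightarrow> k < n \<Longrightarrow> Y $$ (m, k) = SA.Q.coset (y m k)" by auto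
  define z where "z k l = (\<lambda>t. \<Oplus>\<^bsub>FPG.CG\<^esub>m\<in>{..<n}. star FPG.CG (y m k t) \<otimes>\<^bsub>FPG.CG\<^esub> y m l t)" for k l
  have gram_term: "(\<lambda>t. star FPG.CG (y m k t) \<otimes>\<^bsub>FPG.CG\<^esub> y m l t) \<in> carrier SA.C" if "m < n" "k < n" "l < n" for m k l
    using that by (intro SA.C_mult SA.C_star y)
  have zfin: "z k l = (\<Oplus>\<^bsub>SA.C\<^esub>m\<in>{..<n}. (\<lambda>t. star FPG.CG (y m k t) \<otimes>\<^bsub>FPG.CG\<^esub> y m l t))" if "k < n" "l < n" for k l
    unfolding z_def
    by (rule SA.C_finsum[of "{..<n}" "\<lambda>m t. star FPG.CG (y m k t) \<otimes>\<^bsub>FPG.CG\<^esub> y m l t", OF finite_lessThan gram_term, symmetric])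
      (use that in auto)
  have zC: "z k l \<in> carrier SA.C" if "k < n" "l < n" for k l
    unfolding zfin[OF that] by (rule SA.C.M.finsum_closed) (use that gram_term in auto)
  have Xz: "X $$ (k, l) = SA.Q.coset (z k l)" if kl: "k < n" "l < n" for k l
  proof -
    have "X $$ (k, l) = (\<Oplus>\<^bsub>SA.Q.Q\<^esub>m\<in>{..<n}. star SA.Q.Q (Y $$ (m, k)) \<otimes>\<^bsub>SA.Q.Q\<^esub> Y $$ (m, l))"
    proof -
      have "X $$ (k, l) = (\<Oplus>\<^bsub>SA.Q.Q\<^esub>m\<in>{..<n}. madj SA.Q.Q Y $$ (k, m) \<otimes>\<^bsub>SA.Q.Q\<^esub> Y $$ (m, l))"
        unfolding XY using kl Yd by (simp add: mmult_def madj_def)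
      also have "\<dots> = (\<Oplus>\<^bsub>SA.Q.Q\<^esub>m\<in>{..<n}. star SA.Q.Q (Y $$ (m, k)) \<otimes>\<^bsub>SA.Q.Q\<^esub> Y $$ (m, l))"
        using kl Yd Yc SA.Q_mult_closed SA.Q_star_closed
        by (intro QM.M.finsum_cong' refl) (simp_all add: madj_def Pi_def)
      finally show ?thesis .
    qed
    also have "\<dots> = (\<Oplus>\<^bsub>SA.Q.Q\<^esub>m\<in>{..<n}. SA.Q.coset (\<lambda>t. star FPG.CG (y m k t) \<otimes>\<^bsub>FPG.CG\<^esub> y m l t))"
      using kl gram_term SA.Q.coset_closed
      by (intro QM.M.finsum_cong' refl) (auto simp: Yy y SA.coset_star SA.coset_mult SA.C_star)
    also have "\<dots> = SA.Q.coset (z k l)"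
      unfolding zfin[OF kl] by (rule SA.Q.coset_finsum) (use kl gram_term in auto)
    finally show ?thesis .
  qed
  have Xstar: "star SA.Q.Q (X $$ (l, k)) = X $$ (k, l)" if kl: "k < n" "l < n" for k l
  proof -
    have "star FPG.CG (z l k t) = z k l t" for t
    proof -
      have c: "y m k t \<in> carrier FPG.CG" "y m l t \<in> carrier FPG.CG" if "m < n" for m
        using SA.C_in[OF y] that kl by auto
      have "star FPG.CG (z l k t) = (\<Oplus>\<^bsub>FPG.CG\<^esub>m\<in>{..<n}. star FPG.CG (star FPG.CG (y m l t) \<otimes>\<^bsub>FPG.CG\<^esub> y m k t))"
        unfolding z_def by (rule SA.star_finsum) (use c SA.mult_closed SA.star_closed in auto)
      also have "\<dots> = z k l t"
        unfolding z_def using c SA.mult_closed SA.star_closed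
        by (intro SA.M.finsum_cong' refl) (auto simp: SA.star_mult SA.star_star simp del: FPG.CG_simps)
      finally show ?thesis .
    qed
    then show ?thesis using kl by (simp add: Xz SA.coset_star[OF zC])
  qed
  define a0 where "a0 k l = (SOME a. a \<in> finsupp letters \<and> X $$ (k, l) = SA.emb a)" for k l
  have "a0 k l \<in> finsupp letters \<and> X $$ (k, l) = SA.emb (a0 k l)" if "k < n" "l < n" for k l
  proof -
    have "\<exists>a. a \<in> finsupp letters \<and> X $$ (k, l) = SA.emb a"
      using Xc[OF that] E_sub by blast
    from someI_ex[OF this] show ?thesis unfolding a0_def .
  qed
  then have a0: "\<And>k l. k < n \<Longrightarrow> l < n \<Longrightarrow> a0 k l \<in> finsupp letters"
    and Xa0: "\<And>k l. k < n \<Longrightarrow> l < n \<Longrightarrow> X $$ (k, l) = SA.emb (a0 k l)" by auto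
  define a where "a k l = (\<lambda>g. (1 / 2) * a0 k l g + (1 / 2) * star FPG.CG (a0 l k) g)" for k l
  have aL: "a k l \<in> finsupp letters" if "k < n" "l < n" for k l
    unfolding a_def using that by (intro finsupp_add finsupp_smult star_letters a0)
  have aherm: "star FPG.CG (a k l) = a l k" if kl: "k < n" "l < n" for k l
  proof -
    have c: "a0 k l \<in> finsupp (carrier FP)" using finsupp_letters_carrier[OF a0[OF kl]] by simp
    have c': "a0 l k \<in> finsupp (carrier FP)" using finsupp_letters_carrier[OF a0[OF kl(2,1)]] by simp
    have "x \<notin> carrier FP \<Longrightarrow> a0 l k x = 0" for x using finsuppD(2)[OF c'] by blast
    moreover have "cnj (star FPG.CG (a0 l k) (inv\<^bsub>FP\<^esub> x)) = a0 l k x" if "x \<in> carrier FP" for x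
      using that by (simp add: FPG.CG_star)
    ultimately show ?thesis
      unfolding a_def by (auto simp: FPG.CG_star fun_eq_iff)
  qed
  have Xa: "X $$ (k, l) = SA.emb (a k l)" if kl: "k < n" "l < n" for k l
  proof -
    have c: "a0 k l \<in> carrier FPG.CG" "star FPG.CG (a0 l k) \<in> carrier FPG.CG" "a0 l k \<in> carrier FPG.CG"
      by (intro finsupp_letters_carrier star_letters a0 kl)+
    have "SA.emb (a k l) = (1 / 2) \<odot>\<^bsub>SA.Q.Q\<^esub> SA.emb (a0 k l) \<oplus>\<^bsub>SA.Q.Q\<^esub> (1 / 2) \<odot>\<^bsub>SA.Q.Q\<^esub> SA.emb (star FPG.CG (a0 l k))"
      using SA.emb_smult[OF c(1), of "1/2"] SA.emb_smult[OF c(2), of "1/2"]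
        SA.emb_add[of "\<lambda>g. (1/2) * a0 k l g" "\<lambda>g. (1/2) * star FPG.CG (a0 l k) g"]
        finsupp_smult[of "a0 k l" "carrier FP" "1/2"] finsupp_smult[of "star FPG.CG (a0 l k)" "carrier FP" "1/2"] c
      by (simp add: a_def)
    also have "SA.emb (star FPG.CG (a0 l k)) = X $$ (k, l)"
      using SA.emb_star[OF c(3)] Xa0[OF kl(2,1)] Xstar[OF kl] by simp
    also have "SA.emb (a0 k l) = X $$ (k, l)" using Xa0[OF kl] by simp
    also have "(1 / 2) \<odot>\<^bsub>SA.Q.Q\<^esub> X $$ (k, l) \<oplus>\<^bsub>SA.Q.Q\<^esub> (1 / 2) \<odot>\<^bsub>SA.Q.Q\<^esub> X $$ (k, l) = X $$ (k, l)"
      using QM.smult_l_distr[of "1/2" "1/2" "X $$ (k, l)"] QM.smult_one[of "X $$ (k, l)"] E_carrier[OF Xc[OF kl]] by simp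
    finally show ?thesis by simp
  qed
  have "\<exists>B. (\<forall>i\<in>I. \<forall>j<K i. psd n (B (i, j))) \<and>
    (\<forall>k<n. \<forall>l<n. a k l = (\<lambda>w. \<Sum>s\<in>Sigma I (\<lambda>i. {..<K i}). B s k l * proj (fst s) (snd s) w))"
  proof (rule positive_decomposition[where y = y, OF I aL aherm y])
    show "SA.emb (a k l) = SA.Q.coset (\<lambda>t. \<Oplus>\<^bsub>FPG.CG\<^esub>m\<in>{..<n}. star FPG.CG (y m k t) \<otimes>\<^bsub>FPG.CG\<^esub> y m l t)"
      if "k < n" "l < n" for k l
      using Xa[OF that] Xz[OF that] by (simp add: z_def)
  qed
  then obtain B where Bpsd: "\<And>i j. i \<in> I \<Longrightarrow> j < K i \<Longrightarrow> psd n (B (i, j))"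
    and aB: "\<And>k l. k < n \<Longrightarrow> l < n \<Longrightarrow> a k l = (\<lambda>w. \<Sum>s\<in>Sigma I (\<lambda>i. {..<K i}). B s k l * proj (fst s) (snd s) w)"
    by blast
  define S where "S = Sigma I (\<lambda>i. {..<K i})"
  have finS: "finite S" using I by (simp add: S_def)
  define \<beta> where "\<beta> s = (SOME b. \<forall>k<n. \<forall>l<n. B s k l = (\<Sum>m<n. b m k * cnj (b m l)))" for s
  have \<beta>: "B s k l = (\<Sum>m<n. \<beta> s m k * cnj (\<beta> s m l))" if "s \<in> S" "k < n" "l < n" for s k l
  proof -
    have "psd n (B s)" using that(1) Bpsd by (auto simp: S_def)
    from someI_ex[OF psd_gram[OF this]] show ?thesis using that unfolding \<beta>_def by blast
  qed
  define e where "e s = SA.emb (proj (fst s) (snd s))" for s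
  have e_pos: "e s \<in> pos_elems span_system" if "s \<in> S" for s
    using that emb_proj_pos by (auto simp: e_def S_def)
  have eE: "e s \<in> E" if "s \<in> S" for s using e_pos[OF that] unfolding pos_elems_iff by blast
  show ?thesis
  proof (rule SS.conicI[where F = "S \<times> {..<n}" and u = "\<lambda>z. e (fst z)" and b = "\<lambda>z. \<beta> (fst z) (snd z)"])
    show "finite (S \<times> {..<n})" using finS by simp
    show "pos_elems span_system \<subseteq> carrier span_system" by (rule pos_elems_carrier)
    show "e (fst m) \<in> pos_elems span_system" if "m \<in> S \<times> {..<n}" for m using that e_pos by auto
    show "X \<in> carrier_mat n n" by (rule Xd)
    fix k l assume kl: "k < n" "l < n"
    have pc: "proj (fst s) (snd s) \<in> carrier FPG.CG" if "s \<in> S" for s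
      using that proj_closed by (auto simp: S_def)
    have pc': "(\<lambda>w. B s k l * proj (fst s) (snd s) w) \<in> finsupp (carrier FP)" if "s \<in> S" for s
      using pc[OF that] by (auto intro: finsupp_smult)
    have "X $$ (k, l) = SA.emb (\<lambda>w. \<Sum>s\<in>S. B s k l * proj (fst s) (snd s) w)"
      unfolding Xa[OF kl] aB[OF kl] S_def ..
    also have "(\<lambda>w. \<Sum>s\<in>S. B s k l * proj (fst s) (snd s) w) = (\<Oplus>\<^bsub>FPG.CG\<^esub>s\<in>S. (\<lambda>w. B s k l * proj (fst s) (snd s) w))"
      by (rule FPG.CG_finsum[OF finS pc', symmetric])
    also have "SA.emb \<dots> = (\<Oplus>\<^bsub>SA.Q.Q\<^esub>s\<in>S. SA.emb (\<lambda>w. B s k l * proj (fst s) (snd s) w))"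
      by (rule SA.emb_finsum[symmetric]) (use finS pc' in auto)
    also have "\<dots> = (\<Oplus>\<^bsub>SA.Q.Q\<^esub>s\<in>S. \<Oplus>\<^bsub>SA.Q.Q\<^esub>m\<in>{..<n}. (\<beta> s m k * cnj (\<beta> s m l)) \<odot>\<^bsub>SA.Q.Q\<^esub> e s)"
    proof (intro QM.M.finsum_cong' refl)
      fix s assume s: "s \<in> S"
      have "SA.emb (\<lambda>w. B s k l * proj (fst s) (snd s) w) = B s k l \<odot>\<^bsub>SA.Q.Q\<^esub> e s"
        unfolding e_def SA.emb_smult[OF pc[OF s]] by simp
      also have "\<dots> = (\<Oplus>\<^bsub>SA.Q.Q\<^esub>m\<in>{..<n}. (\<beta> s m k * cnj (\<beta> s m l)) \<odot>\<^bsub>SA.Q.Q\<^esub> e s)"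
        unfolding \<beta>[OF s kl] using E_carrier[OF eE[OF s]] by (intro QM.finsum_scalars[symmetric]) auto
      finally show "SA.emb (\<lambda>w. B s k l * proj (fst s) (snd s) w) =
        (\<Oplus>\<^bsub>SA.Q.Q\<^esub>m\<in>{..<n}. (\<beta> s m k * cnj (\<beta> s m l)) \<odot>\<^bsub>SA.Q.Q\<^esub> e s)" .
    qed (use E_carrier[OF eE] in \<open>auto intro!: QM.M.finsum_closed\<close>)
    also have "\<dots> = (\<Oplus>\<^bsub>SA.Q.Q\<^esub>z\<in>S \<times> {..<n}. (\<beta> (fst z) (snd z) k * cnj (\<beta> (fst z) (snd z) l)) \<odot>\<^bsub>SA.Q.Q\<^esub> e (fst z))"
      using finS E_carrier[OF eE] by (intro QM.finsum_Sigma) auto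
    also have "\<dots> = (\<Oplus>\<^bsub>span_system\<^esub>z\<in>S \<times> {..<n}. (\<beta> (fst z) (snd z) k * cnj (\<beta> (fst z) (snd z) l)) \<odot>\<^bsub>SA.Q.Q\<^esub> e (fst z))"
      by (rule span_system_finsum[symmetric]) (use finS eE in \<open>auto intro: E_D(4)\<close>)
    finally show "X $$ (k, l) = (\<Oplus>\<^bsub>span_system\<^esub>z\<in>S \<times> {..<n}.
        (\<beta> (fst z) (snd z) k * cnj (\<beta> (fst z) (snd z) l)) \<odot>\<^bsub>span_system\<^esub> e (fst z))"
      by (simp add: span_system_simps)
  qed
qed

theorem omax_span_system:
  assumes "finite I" "I \<noteq> {}"
  shows "omax_system span_system"
  by (intro omax_system.intro span_system_module omax_system_axioms.intro one_in_pos assms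
      matpos_conic_span mdiag_in_matpos)

lemma power_unitary:
  assumes i: "i \<in> I" and n: "n < K i"
  shows "group_unitary FP (letter i 1) [^]\<^bsub>full_group_cstar FP\<^esub> n = group_unitary FP (letter i n)"
  using n
proof (induction n)
  case 0
  show ?case
    by (simp add: full_group_cstar_eq group_unitary_eq letter_def nat_pow_def SA.emb_one free_product_one)
next
  case (Suc n)
  have l: "letter i n \<in> carrier FP" "letter i 1 \<in> carrier FP" using i Suc.prems by (auto intro!: letter_closed)
  then have d: "delta (letter i n) \<in> carrier FPG.CG" "delta (letter i 1) \<in> carrier FPG.CG"
    by (auto intro: finsupp_delta)
  have "letter i n \<otimes>\<^bsub>FP\<^esub> letter i 1 = letter i (Suc n)"
    using Suc.prems letter_mult[of n i 1] by simp
  then have "SA.emb (delta (letter i n)) \<otimes>\<^bsub>SA.Q.Q\<^esub> SA.emb (delta (letter i 1)) = SA.emb (delta (letter i (Suc n)))"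
    unfolding SA.emb_mult[OF d] FPG.CG_mult_delta[OF l] by simp
  then show ?case
    using Suc unfolding full_group_cstar_eq group_unitary_eq by (simp add: nat_pow_def)
qed

lemma unitary_one: "\<one>\<^bsub>full_group_cstar FP\<^esub> = group_unitary FP []"
  by (simp add: full_group_cstar_eq group_unitary_eq SA.emb_one free_product_one)

end

lemma NC_omax:
  assumes "d \<ge> 1"
  shows "omax_system (NC d)"
proof -
  interpret cyclic_free_product "{1..d}" "\<lambda>_. 2"
    by unfold_locales simp
  have "letter i ` {..<2} = {[], [(i, 1)]}" for i
    by (auto simp: letter_def image_iff less_2_cases_iff)
  then have "letters = {[]} \<union> {[(i, 1)] | i. i \<in> {1..d}}"
    unfolding letters_def using assms by auto
  then have eq: "group_unitary FP ` letters = {group_unitary FP []} \<union> {group_unitary FP [(i, 1)] | i. i \<in> {1..d}}"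
    unfolding image_Un image_insert image_empty by auto
  have "NC d = span_system"
    unfolding NC_def Z2_free_power_def span_system_def Let_def unitary_one eq ..
  then show ?thesis using omax_span_system assms by simp
qed

lemma NCP_omax:
  assumes "k \<ge> 2"
  shows "omax_system (NCP k)"
proof -
  interpret cyclic_free_product "{0, 1}" "\<lambda>i::nat. if i = 0 then k else 2"
    by unfold_locales (use assms in auto)
  have FP: "FP = Zk_free_Z2 k"
    unfolding Zk_free_Z2_def by (rule arg_cong[of _ _ "free_product_group {0, 1}"]) auto
  let ?w = "group_unitary FP [(0, 1)]"
  have w: "?w [^]\<^bsub>full_group_cstar FP\<^esub> j = group_unitary FP (letter 0 j)" if "j < k" for j
    using power_unitary[of 0 j] that by (simp add: letter_def)
  have two: "letter 1 ` {..<2} = {[], [(1, 1)]}"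
    by (auto simp: letter_def image_iff less_2_cases_iff)
  have nil: "[] \<in> letter 0 ` {..<k}" using assms by (auto simp: letter_def)
  have "letters = letter 0 ` {..<k} \<union> letter 1 ` {..<2}"
    unfolding letters_def by simp
  also have "\<dots> = letter 0 ` {..<k} \<union> {[(1, 1)]}"
    unfolding two using nil by blast
  finally have "group_unitary FP ` letters = (\<lambda>j. group_unitary FP (letter 0 j)) ` {..<k} \<union> {group_unitary FP [(1, 1)]}"
    by (simp only: image_Un image_image image_insert image_empty)
  also have "(\<lambda>j. group_unitary FP (letter 0 j)) ` {..<k} = (\<lambda>j. ?w [^]\<^bsub>full_group_cstar FP\<^esub> j) ` {..<k}"
    by (rule image_cong[OF refl], rule w[symmetric]) (simp only: lessThan_iff)
  also have "\<dots> = {?w [^]\<^bsub>full_group_cstar FP\<^esub> j | j::nat. j < k}" by blast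
  finally have eq: "group_unitary FP ` letters = {?w [^]\<^bsub>full_group_cstar FP\<^esub> j | j::nat. j < k} \<union> {group_unitary FP [(1, 1)]}" .
  have "NCP k = span_system"
    unfolding NCP_def span_system_def Let_def eq FP[symmetric] ..
  then show ?thesis using omax_span_system by simp
qed

theorem theorem7p9:
  fixes R1 R2 :: "fp_cstar opsys"
  assumes "R1 \<in> {NC d | d. d \<ge> 3} \<union> {NCP k | k. k \<ge> 3}"
    and "R2 \<in> {NC d | d. d \<ge> 3} \<union> {NCP k | k. k \<ge> 3}"
  shows "(\<forall>(T :: 't opsys) \<phi>.
            operator_system T \<and> linear_map (R1 \<otimes>\<^sub>m\<^sub>a\<^sub>x R2) T \<phi> \<and> positive_map (R1 \<otimes>\<^sub>m\<^sub>a\<^sub>x R2) T \<phi> \<longrightarrow>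
            completely_positive_map (R1 \<otimes>\<^sub>m\<^sub>a\<^sub>x R2) T \<phi>)
         \<and> (\<forall>n. matpos (R1 \<otimes>\<^sub>m\<^sub>a\<^sub>x R2) n = matpos (OMAX (R1 \<otimes>\<^sub>m\<^sub>a\<^sub>x R2)) n)"
proof -
  have omax: "omax_system R" if "R \<in> {NC d | d. d \<ge> 3} \<union> {NCP k | k. k \<ge> 3}" for R
    using that NC_omax NCP_omax by auto
  interpret omax_pair R1 R2
    by (intro omax_pair.intro omax assms)
  show ?thesis
  proof (intro conjI allI impI)
    fix T :: "'t opsys" and \<phi>
    assume "operator_system T \<and> linear_map (R1 \<otimes>\<^sub>m\<^sub>a\<^sub>x R2) T \<phi> \<and> positive_map (R1 \<otimes>\<^sub>m\<^sub>a\<^sub>x R2) T \<phi>"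
    then show "completely_positive_map (R1 \<otimes>\<^sub>m\<^sub>a\<^sub>x R2) T \<phi>"
      by (elim conjE) (rule positive_imp_completely_positive)
  next
    show "matpos (R1 \<otimes>\<^sub>m\<^sub>a\<^sub>x R2) n = matpos (OMAX (R1 \<otimes>\<^sub>m\<^sub>a\<^sub>x R2)) n" for n
      by (rule max_tensor_eq_OMAX)
  qed
qed

end
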